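(* Let $G$ be a finite connected graph (loops and multiple edges allowed) whose first Betti number equals $2g$, for some integer $g\ge 0$. Then the number of $1$-faced embeddings of $G$, divided by the total number of embeddings of $G$, equals the sum of the weights of all decorations of $G$.
   Context: Each edge of $G$ consists of two half-edges; a loop contributes two half-edges at its vertex. An embedding of $G$ is the choice, at every vertex, of a cyclic order of the half-edges incident to it. Equivalently, it is a cellular embedding into a closed oriented surface, considered up to orientation-preserving homeomorphism compatible with $G$. If the vertices have valencies $k_1,\dots,k_n$, there are $\prod_i (k_i-1)!$ embeddings. The faces of an embedding are defined as follows. Let $\iota$ be the involution on half-edges exchanging the two halves of each edge, and let $\rho$ send each half-edge to its successor in the cyclic order at its vertex. The faces are the cycles of the permutation $\rho\circ\iota$. An embedding is $1$-faced if there is exactly one face; equivalently, the surface has genus $g$. A decoration of $G$ consists of the following data: - a choice of some vertices $v$ of $G$; - for each chosen vertex $v$, a choice of a set of $k_v$ half-edges incident to $v$, where $k_v$ is a positive even integer. These choices must satisfy $\sum_v k_v=2g$. They must also satisfy: if the chosen half-edges are erased from $G$ (viewed as a topological space, removing each chosen half-edge except its endpoint at the vertex), the remaining space is contractible. The weight of a decoration is $\frac{1}{2^{2g}}\prod_v\frac{1}{k_v+1}$. *)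

theory Defs
  imports
    "HOL-Analysis.Analysis"
    "HOL-Library.Function_Algebras"
    "HOL-Combinatorics.Orbits"
    "Graph_Theory.Graph_Theory"
begin

text \<open>
  A finite graph with loops and multiple edges is a finite bidirected digraph: the arcs are the
  half-edges, the fixed-point-free involution \<open>\<iota>\<close> exchanges the two halves of each edge, and
  \<open>tail G h\<close> is the vertex at which the half-edge \<open>h\<close> is incident (\<open>head G h\<close> is
  then the vertex of the other half). A loop is a pair of arcs with the same tail, and
  \<open>out_arcs G v\<close> is the set of half-edges incident to \<open>v\<close>.
\<close>


text \<open>
  The first Betti number is the dimension of the first cellular homology with real coefficients.
  A 1-chain assigns a coefficient to each oriented edge, that is, to each half-edge (the edge
  oriented away from its vertex), and changes sign when the orientation is reversed. As there are no
  2-cells, homology in degree 1 is the space of 1-cycles.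
\<close>

definition one_cycles :: "('v, 'h) pre_digraph \<Rightarrow> ('h \<Rightarrow> 'h) \<Rightarrow> ('h \<Rightarrow> real) set" where
  "one_cycles G \<iota> = {c. (\<forall>h. h \<notin> arcs G \<longrightarrow> c h = 0) \<and>
     (\<forall>h\<in>arcs G. c (\<iota> h) = - c h) \<and>
     (\<forall>v\<in>verts G. (\<Sum>h\<in>out_arcs G v. c h) = 0)}"

definition first_betti :: "('v, 'h) pre_digraph \<Rightarrow> ('h \<Rightarrow> 'h) \<Rightarrow> nat" where
  "first_betti G \<iota> = vector_space.dim (\<lambda>(a::real) c h. a * c h) (one_cycles G \<iota>)"

lemma vector_space_chains: "vector_space (\<lambda>(a::real) (c :: 'h \<Rightarrow> real) h. a * c h)"
  by unfold_locales (auto simp: fun_eq_iff algebra_simps)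


definition embeddings :: "('v, 'h) pre_digraph \<Rightarrow> ('h \<Rightarrow> 'h) set" where
  "embeddings G = {\<rho>. \<rho> permutes arcs G \<and>
     (\<forall>v\<in>verts G. out_arcs G v \<noteq> {} \<longrightarrow> cyclic_on \<rho> (out_arcs G v))}"

text \<open>
  A face is represented by the set of half-edges in its cycle. The graph consisting of a single
  vertex has no half-edges; its only embedding is into the sphere and has one face, represented here
  by the empty cycle.
\<close>

definition faces :: "('v, 'h) pre_digraph \<Rightarrow> ('h \<Rightarrow> 'h) \<Rightarrow> ('h \<Rightarrow> 'h) \<Rightarrow> 'h set set" where
  "faces G \<iota> \<rho> = (if arcs G = {} then {{}} else orbit (\<rho> \<circ> \<iota>) ` arcs G)"

definition one_faced :: "('v, 'h) pre_digraph \<Rightarrow> ('h \<Rightarrow> 'h) \<Rightarrow> ('h \<Rightarrow> 'h) \<Rightarrow> bool" where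
  "one_faced G \<iota> \<rho> \<longleftrightarrow> card (faces G \<iota> \<rho>) = 1"


text \<open>
  The graph as a topological space: a half-edge is a closed interval parametrized by \<open>{0..1}\<close>
  that runs from its vertex (parameter 0) to the midpoint of its edge (parameter 1). The space is
  the quotient of the disjoint union of the vertices and these intervals.
\<close>

datatype ('v, 'h) point = Vertex 'v | Interior 'h real | Midpoint "'h set"

definition half_edge_point ::
  "('v, 'h) pre_digraph \<Rightarrow> ('h \<Rightarrow> 'h) \<Rightarrow> 'h \<Rightarrow> real \<Rightarrow> ('v, 'h) point" where
  "half_edge_point G \<iota> h t =
     (if t = 0 then Vertex (tail G h) else if t = 1 then Midpoint {h, \<iota> h} else Interior h t)"

definition graph_points :: "('v, 'h) pre_digraph \<Rightarrow> ('h \<Rightarrow> 'h) \<Rightarrow> ('v, 'h) point set" where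
  "graph_points G \<iota> = Vertex ` verts G \<union> (\<Union>h\<in>arcs G. half_edge_point G \<iota> h ` {0..1})"

definition graph_space :: "('v, 'h) pre_digraph \<Rightarrow> ('h \<Rightarrow> 'h) \<Rightarrow> ('v, 'h) point topology" where
  "graph_space G \<iota> = topology (\<lambda>U. U \<subseteq> graph_points G \<iota> \<and>
     (\<forall>h\<in>arcs G. openin (top_of_set {0..1}) {t\<in>{0..1}. half_edge_point G \<iota> h t \<in> U}))"

lemma openin_graph_space:
  "openin (graph_space G \<iota>) U \<longleftrightarrow> U \<subseteq> graph_points G \<iota> \<and>
     (\<forall>h\<in>arcs G. openin (top_of_set {0..1}) {t\<in>{0..1}. half_edge_point G \<iota> h t \<in> U})"
proof -
  let ?pre = "\<lambda>h U. {t\<in>{0..1}. half_edge_point G \<iota> h t \<in> U}"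
  have int: "?pre h (S \<inter> T) = ?pre h S \<inter> ?pre h T" for h S T
    by auto
  have un: "?pre h (\<Union>K) = \<Union>(?pre h ` K)" for h K
    by auto
  have "istopology (\<lambda>U. U \<subseteq> graph_points G \<iota> \<and> (\<forall>h\<in>arcs G. openin (top_of_set {0..1}) (?pre h U)))"
    unfolding istopology_def int un by (intro conjI allI impI ballI openin_Int openin_Union) auto
  then show ?thesis
    unfolding graph_space_def by (simp add: topology_inverse')
qed

lemma topspace_graph_space: "topspace (graph_space G \<iota>) = graph_points G \<iota>"
proof -
  have "{t\<in>{0..1}. half_edge_point G \<iota> h t \<in> graph_points G \<iota>} = {0..1}" if "h \<in> arcs G" for h
    using that by (auto simp: graph_points_def)
  then have "openin (graph_space G \<iota>) (graph_points G \<iota>)"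
    unfolding openin_graph_space by (metis openin_topspace order_refl topspace_euclidean_subtopology)
  then show ?thesis
    by (metis openin_graph_space openin_subset openin_topspace subset_antisym)
qed

text \<open>
  Erasing a half-edge removes everything except its vertex; in particular it removes the midpoint
  of its edge.
\<close>

definition remaining_space ::
  "('v, 'h) pre_digraph \<Rightarrow> ('h \<Rightarrow> 'h) \<Rightarrow> 'h set \<Rightarrow> ('v, 'h) point topology" where
  "remaining_space G \<iota> S = subtopology (graph_space G \<iota>)
     (graph_points G \<iota> - (\<Union>h\<in>S. half_edge_point G \<iota> h ` {0<..1}))"


text \<open>
  A decoration is a partial function: its domain is the set of chosen vertices, and it maps a
  chosen vertex to its set of chosen half-edges.
\<close>

definition decorations ::
  "('v, 'h) pre_digraph \<Rightarrow> ('h \<Rightarrow> 'h) \<Rightarrow> nat \<Rightarrow> ('v \<rightharpoonup> 'h set) set" where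
  "decorations G \<iota> g = {D. dom D \<subseteq> verts G \<and>
     (\<forall>v\<in>dom D. the (D v) \<subseteq> out_arcs G v \<and> card (the (D v)) > 0 \<and> even (card (the (D v)))) \<and>
     (\<Sum>v\<in>dom D. card (the (D v))) = 2 * g \<and>
     contractible_space (remaining_space G \<iota> (\<Union>(ran D)))}"

definition weight :: "nat \<Rightarrow> ('v \<rightharpoonup> 'h set) \<Rightarrow> real" where
  "weight g D = 1 / 2 ^ (2 * g) * (\<Prod>v\<in>dom D. 1 / (real (card (the (D v))) + 1))"

end

theory Submission
  imports Defs
    "HOL-Combinatorics.Multiset_Permutations"
    "Jordan_Normal_Form.Determinant"
begin

text \<open>A 1-faced embedding is recognised by the intersection form of its surface, restricted to the cycle
  space of \<open>G\<close>, which is an integral skew-symmetric form of rank \<open>2g\<close>. If there are several faces, the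
  boundary of one of them is a nonzero cycle in the radical, so the determinant of the form is 0. If
  there is only one face, every half-edge has a dual cycle, so the form is unimodular; a real
  skew-symmetric form has nonnegative determinant, so the determinant is 1. The proportion of 1-faced
  embeddings is therefore the expected determinant of the intersection form of a random embedding.

  A uniformly random cyclic order comes from a uniformly random linear order, and the form is the sum
  of independent contributions of the vertices, each read off the linear order there. Averaging a
  \<open>k\<close> by \<open>k\<close> minor over the orders at a vertex multiplies the corresponding minor of the identity by
  \<open>1 / (2 ^ k * (k + 1))\<close> if \<open>k\<close> is even and by 0 if \<open>k\<close> is odd, because cycles sum to zero at the
  vertex. As in the Cauchy-Binet formula, the expected determinant becomes a sum over the \<open>2g\<close>-sets of
  half-edges \<open>S\<close> of the weight of \<open>S\<close> times the square of the minor at \<open>S\<close> of an integral basis of the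
  cycle space. That square is 1 if erasing \<open>S\<close> leaves a tree, up to hanging pieces of half-edges, and 0
  otherwise.\<close>

section \<open>Determinants\<close>

text \<open>In matrix terms the form is \<open>B^T M B\<close>, where \<open>B\<close> holds the
  values of a cycle basis on the half-edges and \<open>M\<close> is block diagonal over the
  vertices. Only the left factor is expanded: row \<open>i\<close> becomes the row of
  \<open>M B\<close> at one chosen half-edge and involves the order at a single vertex, so the
  vertices can be averaged separately. The entries of \<open>M\<close> are 1, 1/2 and 0 for before,
  equal and after; they differ from a skew matrix by the constant 1/2, which vectors summing to zero
  do not see.

  The \<open>k + 1\<close> is the size of a set: a half-edge outside \<open>k\<close> chosen ones
  precedes all of them with probability \<open>1 / (k + 1)\<close>. The powers of 2 come from the
  diagonal 1/2, which shifts the moments of the uniform distribution on \<open>[-1, 0]\<close> to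
  those on \<open>[-1/2, 1/2]\<close>, where the odd ones vanish.

  In the topological part, erasing a half-edge leaves the other half of its edge as a half-open
  interval, so pieces are glued that are closed only relative to their union. In the converse
  direction, a surviving closed walk is detected by the winding of a circle-valued map.\<close>

definition dt :: "nat \<Rightarrow> (nat \<Rightarrow> nat \<Rightarrow> real) \<Rightarrow> real" where
  "dt m A = (\<Sum>p | p permutes {..<m}. of_int (sign p) * (\<Prod>i<m. A i (p i)))"

lemma dt_eq_det: "dt m A = Determinant.det (Matrix.mat m m (\<lambda>(i, j). A i j))"
proof -
  have "(\<Prod>i=0..<m. Matrix.mat m m (\<lambda>(i, j). A i j) $$ (i, p i)) = (\<Prod>i<m. A i (p i))"
    if "p permutes {0..<m}" for p
    using permutes_in_image[OF that] by (intro prod.cong) (auto simp: lessThan_atLeast0)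
  then show ?thesis
    unfolding dt_def by (subst det_def'[of _ m]) (auto simp: lessThan_atLeast0 intro!: sum.cong)
qed

lemma dt_cong:
  assumes "\<And>i j. i < m \<Longrightarrow> j < m \<Longrightarrow> A i j = B i j"
  shows "dt m A = dt m B"
  unfolding dt_def
proof (intro sum.cong refl arg_cong2[of _ _ _ _ "(*)"] prod.cong)
  fix p i assume "p \<in> {p. p permutes {..<m}}" "i \<in> {..<m}"
  then show "A i (p i) = B i (p i)"
    using assms permutes_in_image[of p "{..<m}" i] by simp
qed

lemma dt_sum_rows:
  assumes J: "J \<subseteq> {..<m}" and C: "\<And>i. i \<in> J \<Longrightarrow> finite (C i)"
  shows "dt m (\<lambda>i j. if i \<in> J then \<Sum>c\<in>C i. k i c * B i c j else u i j) =
    (\<Sum>f\<in>PiE J C. (\<Prod>i\<in>J. k i (f i)) * dt m (\<lambda>i. if i \<in> J then B i (f i) else u i))"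
proof -
  \<comment> \<open>Outside \<open>J\<close> the only choice is \<open>undefined\<close>, the value
    that extensional functions take there. Every row is then a sum, and the families of choices are
    still exactly \<open>PiE J C\<close>.\<close>
  let ?C = "\<lambda>i. if i \<in> J then C i else {undefined}"
  have fin: "finite J" using J finite_subset by blast
  have PiE: "PiE {..<m} ?C = PiE J C"
    using J by (auto simp: PiE_def extensional_def Pi_def subset_iff split: if_splits)
  have "(\<Prod>i<m. if i \<in> J then \<Sum>c\<in>C i. k i c * B i c (p i) else u i (p i)) =
     (\<Sum>f\<in>PiE J C. (\<Prod>i\<in>J. k i (f i)) * (\<Prod>i<m. (if i \<in> J then B i (f i) else u i) (p i)))" for p
  proof -
    have "(\<Prod>i<m. if i \<in> J then \<Sum>c\<in>C i. k i c * B i c (p i) else u i (p i)) =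
      (\<Prod>i<m. \<Sum>c\<in>?C i. if i \<in> J then k i c * B i c (p i) else u i (p i))"
      by (intro prod.cong) auto
    also have "\<dots> = (\<Sum>f\<in>PiE J C. \<Prod>i<m. if i \<in> J then k i (f i) * B i (f i) (p i) else u i (p i))"
      unfolding PiE[symmetric] using C by (intro prod_sum_PiE) auto
    also have "\<dots> = (\<Sum>f\<in>PiE J C. (\<Prod>i<m. if i \<in> J then k i (f i) else 1) *
        (\<Prod>i<m. (if i \<in> J then B i (f i) else u i) (p i)))"
      unfolding prod.distrib[symmetric] by (intro sum.cong prod.cong) auto
    finally show ?thesis
      using J by (simp add: prod.If_cases Int_absorb1)
  qed
  then have "dt m (\<lambda>i j. if i \<in> J then \<Sum>c\<in>C i. k i c * B i c j else u i j) =
    (\<Sum>p | p permutes {..<m}. of_int (sign p) * (\<Sum>f\<in>PiE J C. (\<Prod>i\<in>J. k i (f i)) *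
       (\<Prod>i<m. (if i \<in> J then B i (f i) else u i) (p i))))"
    by (simp only: dt_def)
  also have "\<dots> = (\<Sum>f\<in>PiE J C. \<Sum>p | p permutes {..<m}. of_int (sign p) * ((\<Prod>i\<in>J. k i (f i)) *
       (\<Prod>i<m. (if i \<in> J then B i (f i) else u i) (p i))))"
    unfolding sum_distrib_left by (rule sum.swap)
  finally show ?thesis
    by (simp only: dt_def sum_distrib_left mult.left_commute)
qed

lemma dt_row_sum:
  assumes "r < m" "finite C"
  shows "dt m (A(r := \<lambda>j. \<Sum>c\<in>C. k c * B c j)) = (\<Sum>c\<in>C. k c * dt m (A(r := B c)))"
proof -
  have "dt m (A(r := \<lambda>j. \<Sum>c\<in>C. k c * B c j)) =
      dt m (\<lambda>i j. if i \<in> {r} then \<Sum>c\<in>C. k c * B c j else A i j)"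
    by (intro dt_cong) auto
  also have "\<dots> = (\<Sum>f\<in>PiE {r} (\<lambda>_. C). k (f r) * dt m (\<lambda>i. if i \<in> {r} then B (f r) else A i))"
    using assms by (subst dt_sum_rows) (auto intro!: sum.cong dt_cong)
  also have "\<dots> = (\<Sum>c\<in>C. k c * dt m (A(r := B c)))"
    by (rule sum.reindex_bij_witness[of _ "\<lambda>c. \<lambda>x\<in>{r}. c" "\<lambda>f. f r"])
      (auto simp: PiE_def extensional_def fun_upd_def cong: if_cong)
  finally show ?thesis .
qed

lemma dt_row_add:
  assumes "r < m"
  shows "dt m (A(r := \<lambda>j. x j + y j)) = dt m (A(r := x)) + dt m (A(r := y))"
proof -
  have "dt m (A(r := \<lambda>j. \<Sum>c\<in>UNIV. 1 * (if c then x else y) j)) =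
     (\<Sum>c\<in>UNIV. 1 * dt m (A(r := if c then x else y)))"
    by (rule dt_row_sum[OF assms finite])
  then show ?thesis by (simp add: UNIV_bool add.commute)
qed

lemma dt_scale_rows: "dt m (\<lambda>i j. k i * A i j) = (\<Prod>i<m. k i) * dt m A"
  by (simp add: dt_def prod.distrib sum_distrib_left mult_ac)

lemma dt_permute_rows:
  assumes "p permutes {..<m}"
  shows "dt m (\<lambda>i. A (p i)) = of_int (sign p) * dt m A"
proof -
  have "Determinant.det (Matrix.mat m m (\<lambda>(i,j). Matrix.mat m m (\<lambda>(i, j). A i j) $$ (p i, j))) =
     of_int (sign p) * Determinant.det (Matrix.mat m m (\<lambda>(i, j). A i j))"
    using Determinant.det_permute_rows[of "Matrix.mat m m (\<lambda>(i, j). A i j)" m p] assms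
    by (simp add: lessThan_atLeast0)
  moreover have "Matrix.mat m m (\<lambda>(i,j). Matrix.mat m m (\<lambda>(i, j). A i j) $$ (p i, j)) =
      Matrix.mat m m (\<lambda>(i,j). A (p i) j)"
    using permutes_in_image[OF assms] by (intro eq_matI) auto
  ultimately show ?thesis by (simp add: dt_eq_det)
qed

lemma dt_identical_rows:
  assumes "r < m" "r' < m" "r \<noteq> r'" "\<And>j. j < m \<Longrightarrow> A r j = A r' j"
  shows "dt m A = 0"
  unfolding dt_eq_det
  by (rule Determinant.det_identical_rows[of _ m r r']) (use assms in \<open>auto intro!: eq_vecI\<close>)

text \<open>Every permutation with a nonzero contribution is a single cycle, since following it descends until
  \<open>x\<close> is reached.\<close>

lemma sum_cyclic_sign:
  fixes r :: "'a \<Rightarrow> nat"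
  assumes "finite J" "inj_on r J" "x \<in> J" "\<And>y. y \<in> J \<Longrightarrow> r x \<le> r y"
  shows "(\<Sum>p | p permutes J. real_of_int (sign p) * (\<Prod>i\<in>J-{x}. of_bool (r (p i) < r i))) =
    (-1) ^ (card J - 1)"
  using assms
proof (induction J arbitrary: x rule: finite_ranking_induct[where f = r])
  case (insert M J)
  show ?case
  proof (cases "M \<in> J \<or> J = {}")
    case True
    then show ?thesis
    proof
      assume "M \<in> J" then show ?thesis using insert by (simp add: insert_absorb)
    next
      assume "J = {}" then show ?thesis using insert by auto
    qed
  next
    case False
    have "x \<noteq> M"
    proof
      assume "x = M"
      then have "r M \<le> r y" "r y \<le> r M" if "y \<in> J" for y using insert that by auto
      then show False using False insert(4) by (auto simp: inj_on_def) (metis antisym insertCI ex_in_conv)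
    qed
    then have xJ: "x \<in> J" using insert by auto
    have lt: "r y < r M" if "y \<in> J" for y
      using insert(2)[OF that] inj_onD[OF insert(4), of y M] False that by (auto simp: order_less_le)
    have IH: "(\<Sum>p | p permutes J. real_of_int (sign p) * (\<Prod>i\<in>J-{x}. of_bool (r (p i) < r i))) =
        (-1) ^ (card J - 1)"
      using insert.IH insert.prems xJ by (auto simp: inj_on_def)
    \<comment> \<open>A permutation of \<open>insert M J\<close> is
      \<open>transpose M b \<circ> q\<close> and sends \<open>M\<close> to \<open>b\<close>. As
      \<open>M\<close> has the largest rank, it can neither be fixed nor be the image of an
      \<open>i\<close> other than \<open>x\<close>. So \<open>M\<close> is spliced into the cycle of
      \<open>q\<close> between \<open>x\<close> and \<open>q x\<close>: a single \<open>b\<close> is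
      left, and the sign flips.\<close>
    have eq: "real_of_int (sign (Transposition.transpose M b \<circ> q)) *
        (\<Prod>i\<in>insert M J-{x}. of_bool (r ((Transposition.transpose M b \<circ> q) i) < r i)) =
       (if b = q x then - (real_of_int (sign q) * (\<Prod>i\<in>J-{x}. of_bool (r (q i) < r i))) else 0)"
      if q: "q permutes J" and b: "b \<in> insert M J" for b q
    proof -
      have qM: "q M = M" using q False by (auto simp: permutes_def)
      have split: "(\<Prod>i\<in>insert M J-{x}. of_bool (r ((Transposition.transpose M b \<circ> q) i) < r i)) =
          of_bool (r b < r M) * (\<Prod>i\<in>J-{x}. of_bool (r (Transposition.transpose M b (q i)) < r i) :: real)"
        using \<open>x \<noteq> M\<close> False insert(1) by (simp add: insert_Diff_if qM)
      consider "b = M" | "b \<in> J" "b = q x" | "b \<in> J" "b \<noteq> q x" using b by auto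
      then show ?thesis
      proof cases
        case 1
        then show ?thesis using split permutes_in_image[OF q, of x] xJ False by auto
      next
        case 2
        have "Transposition.transpose M b (q i) = q i" if "i \<in> J - {x}" for i
          using that 2 False permutes_in_image[OF q, of i] injD[OF permutes_inj[OF q], of i x]
          by (intro transpose_apply_other) auto
        moreover have "sign (Transposition.transpose M b \<circ> q) = - sign q"
          using 2 False permutes_imp_permutation[OF \<open>finite J\<close> q]
          by (subst sign_compose) (auto simp: permutation_swap_id sign_swap_id)
        ultimately show ?thesis unfolding split using 2 lt[of b] by simp
      next
        case 3
        then obtain i where i: "b = q i" "i \<in> J" "i \<noteq> x"
          using q by (metis permutes_def permutes_in_image)
        have "(\<Prod>i\<in>J-{x}. of_bool (r (Transposition.transpose M b (q i)) < r i) :: real) = 0"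
          using i insert(1) lt[of i] by (intro prod_zero bexI[of _ i]) auto
        then show ?thesis using split 3 by simp
      qed
    qed
    have "(\<Sum>p | p permutes insert M J. real_of_int (sign p) * (\<Prod>i\<in>insert M J-{x}. of_bool (r (p i) < r i))) =
      (\<Sum>b\<in>insert M J. \<Sum>q | q permutes J.
        if b = q x then - (real_of_int (sign q) * (\<Prod>i\<in>J-{x}. of_bool (r (q i) < r i))) else 0)"
      using False insert(1) by (subst sum_over_permutations_insert) (blast, blast, intro sum.cong refl eq, auto)
    also have "\<dots> = (\<Sum>q | q permutes J. \<Sum>b\<in>insert M J.
        if b = q x then - (real_of_int (sign q) * (\<Prod>i\<in>J-{x}. of_bool (r (q i) < r i))) else 0)"
      by (rule sum.swap)
    also have "\<dots> = (\<Sum>q | q permutes J. - (real_of_int (sign q) * (\<Prod>i\<in>J-{x}. of_bool (r (q i) < r i))))"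
      using xJ insert(1) by (intro sum.cong) (auto simp: permutes_in_image)
    also have "\<dots> = - ((-1) ^ (card J - 1))"
      using IH by (simp add: sum_negf)
    also have "\<dots> = (-1) ^ (card (insert M J) - 1)"
      using False insert(1) by (cases "card J") auto
    finally show ?thesis .
  qed
qed auto

section \<open>Averaging over linear orders\<close>

definition position :: "'a list \<Rightarrow> 'a \<Rightarrow> nat" where
  "position xs a = length (takeWhile (\<lambda>x. x \<noteq> a) xs)"

lemma position_less_length: "a \<in> set xs \<Longrightarrow> position xs a < length xs"
  unfolding position_def by (induction xs) auto

lemma nth_position: "a \<in> set xs \<Longrightarrow> xs ! position xs a = a"
  unfolding position_def by (induction xs) auto

lemma position_nth: "distinct xs \<Longrightarrow> i < length xs \<Longrightarrow> position xs (xs ! i) = i"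
  by (metis nth_eq_iff_index_eq nth_mem nth_position position_less_length)

lemma inj_on_position: "inj_on (position xs) (set xs)"
  by (metis inj_onI nth_position)

lemma position_map: "inj t \<Longrightarrow> position (map t xs) (t a) = position xs a"
  unfolding position_def by (simp add: takeWhile_map o_def inj_eq)

text \<open>Invariance of the uniform distribution on linear orders under relabelling; the symmetry
  arguments below rest on it.\<close>

lemma sum_permutations_of_set_relabel:
  assumes "t permutes K"
  shows "(\<Sum>xs\<in>permutations_of_set K. F (map t xs)) = (\<Sum>xs\<in>permutations_of_set K. F xs)"
proof (rule sum.reindex_bij_betw, rule bij_betwI[where g = "map (inv_into UNIV t)"])
  have "map t xs \<in> permutations_of_set K" if "t permutes K" "xs \<in> permutations_of_set K" for t xs
    using that by (simp add: permutations_of_set_def distinct_map permutes_inj_on permutes_image)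
  then show "map t \<in> permutations_of_set K \<rightarrow> permutations_of_set K"
    "map (inv_into UNIV t) \<in> permutations_of_set K \<rightarrow> permutations_of_set K"
    using assms permutes_inv[OF assms] by auto
qed (use permutes_inverses[OF assms] in \<open>simp_all add: o_def\<close>)

text \<open>Transposing two elements of \<open>T\<close> shows that all of them are first equally
  often, and in each order exactly one is first.\<close>

lemma sum_first_element:
  assumes "finite K" "T \<subseteq> K" "a \<in> T"
  shows "(\<Sum>xs\<in>permutations_of_set K. of_bool (\<forall>t\<in>T. position xs a \<le> position xs t)) =
    real (card (permutations_of_set K)) / real (card T)"
proof -
  let ?P = "permutations_of_set K"
  let ?c = "\<lambda>a. \<Sum>xs\<in>?P. of_bool (\<forall>t\<in>T. position xs a \<le> position xs t) :: real"
  have fin: "finite T" using assms finite_subset by blast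
  have "?c a' = ?c a" if "a' \<in> T" for a'
  proof -
    define t where "t = Transposition.transpose a a'"
    have t: "t permutes K" "t permutes T"
      using assms that by (auto simp: t_def intro!: permutes_swap_id)
    have "?c a' = (\<Sum>xs\<in>?P. of_bool (\<forall>s\<in>T. position (map t xs) a' \<le> position (map t xs) s))"
      using sum_permutations_of_set_relabel[OF t(1), of "\<lambda>xs. of_bool (\<forall>s\<in>T. position xs a' \<le> position xs s)"]
      by (rule sym)
    also have "\<dots> = ?c a"
    proof (rule sum.cong)
      fix xs
      have "(\<forall>s\<in>T. position (map t xs) a' \<le> position (map t xs) s) \<longleftrightarrow>
        (\<forall>s\<in>T. position (map t xs) (t a) \<le> position (map t xs) (t s))"
        using permutes_image[OF t(2)] by (auto simp: t_def) (metis imageE)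
      then show "of_bool (\<forall>s\<in>T. position (map t xs) a' \<le> position (map t xs) s) =
          (of_bool (\<forall>t\<in>T. position xs a \<le> position xs t) :: real)"
        using position_map[OF permutes_inj[OF t(1)]] by simp
    qed simp
    finally show ?thesis .
  qed
  then have "real (card T) * ?c a = (\<Sum>a\<in>T. ?c a)" by simp
  also have "\<dots> = (\<Sum>xs\<in>?P. \<Sum>a\<in>T. of_bool (\<forall>t\<in>T. position xs a \<le> position xs t))"
    by (rule sum.swap)
  also have "\<dots> = (\<Sum>xs\<in>?P. 1)"
  proof (rule sum.cong)
    fix xs assume "xs \<in> ?P"
    then have inj: "inj_on (position xs) T"
      using inj_on_position[of xs] assms by (auto simp: permutations_of_set_def intro: inj_on_subset)
    obtain a where a: "a \<in> T" "\<And>t. t \<in> T \<Longrightarrow> position xs a \<le> position xs t"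
      using assms(3) ex_has_least_nat[of "\<lambda>x. x \<in> T" _ "position xs"] by auto
    have "(\<forall>t\<in>T. position xs b \<le> position xs t) \<longleftrightarrow> b = a" if "b \<in> T" for b
      using a that inj_onD[OF inj, of a b] by (auto intro: antisym)
    then have "(\<Sum>b\<in>T. of_bool (\<forall>t\<in>T. position xs b \<le> position xs t)) = (\<Sum>b\<in>T. of_bool (b = a) :: real)"
      by (intro sum.cong) auto
    then show "(\<Sum>b\<in>T. of_bool (\<forall>t\<in>T. position xs b \<le> position xs t)) = (1 :: real)"
      using a fin by simp
  qed simp
  also have "\<dots> = real (card ?P)" by simp
  moreover have "card T > 0" using assms fin by (auto simp: card_gt_0_iff)
  ultimately show ?thesis by (simp add: field_simps)
qed

lemma sum_PiE_insert:
  assumes "x \<notin> S"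
  shows "(\<Sum>f\<in>PiE (insert x S) C. g f) = (\<Sum>a\<in>C x. \<Sum>h\<in>PiE S C. g (h(x := a)))"
proof -
  have "(\<Sum>f\<in>PiE (insert x S) C. g f) = (\<Sum>p\<in>C x \<times> PiE S C. g ((snd p)(x := fst p)))"
    unfolding PiE_insert_eq
    using inj_combinator[OF assms, of C]
    by (subst sum.reindex) (auto simp: case_prod_beta o_def)
  then show ?thesis
    by (simp add: sum.cartesian_product case_prod_beta)
qed

section \<open>Minors with some rows chosen from a family of vectors\<close>

definition rows_on :: "nat \<Rightarrow> nat set \<Rightarrow> (nat \<Rightarrow> nat \<Rightarrow> real) \<Rightarrow> ('a \<Rightarrow> nat \<Rightarrow> real) \<Rightarrow> (nat \<Rightarrow> 'a) \<Rightarrow> real" where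
  "rows_on m J u b f = dt m (\<lambda>i. if i \<in> J then b (f i) else u i)"

lemma rows_on_cong: "(\<And>i. i \<in> J \<Longrightarrow> f i = f' i) \<Longrightarrow> rows_on m J u b f = rows_on m J u b f'"
  unfolding rows_on_def by (intro dt_cong) simp

lemma rows_on_not_inj:
  assumes "J \<subseteq> {..<m}" "\<not> inj_on f J"
  shows "rows_on m J u b f = 0"
proof -
  obtain r r' where "r \<in> J" "r' \<in> J" "r \<noteq> r'" "f r = f r'"
    using assms(2) by (auto simp: inj_on_def)
  then show ?thesis
    unfolding rows_on_def using assms(1) by (intro dt_identical_rows[of r m r']) auto
qed

lemma rows_on_permute:
  assumes "J \<subseteq> {..<m}" "p permutes J"
  shows "rows_on m J u b (f \<circ> p) = of_int (sign p) * rows_on m J u b f"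
proof -
  have "rows_on m J u b (f \<circ> p) = dt m (\<lambda>i. (\<lambda>i. if i \<in> J then b (f i) else u i) (p i))"
    unfolding rows_on_def
    using permutes_in_image[OF assms(2)] permutes_not_in[OF assms(2)] by (intro dt_cong) auto
  then show ?thesis
    unfolding rows_on_def using dt_permute_rows[OF permutes_subset[OF assms(2,1)]] by simp
qed

lemma rows_on_sum_eq_0:
  assumes "J \<subseteq> {..<m}" "finite K" "\<And>l. l < m \<Longrightarrow> (\<Sum>h\<in>K. b h l) = 0" "j \<in> J"
  shows "(\<Sum>a\<in>K. rows_on m J u b (f(j := a))) = 0"
proof -
  let ?A = "\<lambda>i. if i \<in> J then b (f i) else u i"
  have jm: "j < m" using assms by auto
  have "(\<Sum>a\<in>K. rows_on m J u b (f(j := a))) = (\<Sum>a\<in>K. 1 * dt m (?A(j := b a)))"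
    unfolding rows_on_def using assms(4) by (intro sum.cong) (auto intro: dt_cong)
  also have "\<dots> = dt m (?A(j := \<lambda>l. \<Sum>a\<in>K. 1 * b a l))"
    using jm assms by (subst dt_row_sum) auto
  \<comment> \<open>The vanishing row is written as a row scaled by 0, so that the factor can be
    pulled out.\<close>
  also have "\<dots> = dt m (\<lambda>i l. (if i = j then 0 else 1) * (?A(j := \<lambda>l. \<Sum>a\<in>K. b a l)) i l)"
    using assms(3) by (intro dt_cong) auto
  also have "\<dots> = 0"
    using jm by (subst dt_scale_rows) (auto intro!: prod_zero)
  finally show ?thesis .
qed

text \<open>Repeated values give repeated rows, so only injective choices survive. On the finite set
  \<open>J\<close> these are the \<open>\<phi> \<circ> p\<close> with \<open>p\<close> a
  permutation, and each contributes \<open>sign p\<close> times the minor at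
  \<open>\<phi>\<close>.\<close>

lemma sum_rows_on_image:
  assumes J: "J \<subseteq> {..<m}" and \<phi>: "inj_on \<phi> J"
  shows "(\<Sum>f\<in>PiE J (\<lambda>_. \<phi> ` J). w f * rows_on m J u b f) =
    (\<Sum>p | p permutes J. w (restrict (\<phi> \<circ> p) J) * of_int (sign p)) * rows_on m J u b \<phi>"
proof -
  have finJ: "finite J" using J finite_subset by blast
  have fin: "finite (PiE J (\<lambda>_. \<phi> ` J))" using finJ by (intro finite_PiE) auto
  have "(\<Sum>f\<in>PiE J (\<lambda>_. \<phi> ` J). w f * rows_on m J u b f) =
      (\<Sum>f\<in>{f \<in> PiE J (\<lambda>_. \<phi> ` J). inj_on f J}. w f * rows_on m J u b f)"
    using fin rows_on_not_inj[OF J] by (intro sum.mono_neutral_right) auto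
  also have "\<dots> = (\<Sum>p | p permutes J. w (restrict (\<phi> \<circ> p) J) * (of_int (sign p) * rows_on m J u b \<phi>))"
  proof (rule sum.reindex_bij_witness[of _ "\<lambda>p. restrict (\<phi> \<circ> p) J"
        "\<lambda>f i. if i \<in> J then the_inv_into J \<phi> (f i) else i"])
    fix p assume "p \<in> {p. p permutes J}"
    then have p: "p permutes J" by simp
    note pJ = permutes_in_image[OF p]
    show "(\<lambda>i. if i \<in> J then the_inv_into J \<phi> (restrict (\<phi> \<circ> p) J i) else i) = p"
      using p pJ by (auto simp: fun_eq_iff the_inv_into_f_f[OF \<phi>] permutes_not_in)
    show "restrict (\<phi> \<circ> p) J \<in> {f \<in> PiE J (\<lambda>_. \<phi> ` J). inj_on f J}"
      using pJ inj_onD[OF \<phi>] injD[OF permutes_inj[OF p]] by (auto simp: inj_on_def)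
  next
    fix f assume f: "f \<in> {f \<in> PiE J (\<lambda>_. \<phi> ` J). inj_on f J}"
    let ?p = "\<lambda>i. if i \<in> J then the_inv_into J \<phi> (f i) else i"
    have fJ: "f i \<in> \<phi> ` J" if "i \<in> J" for i using f that by auto
    show eq: "restrict (\<phi> \<circ> ?p) J = f"
      using f fJ f_the_inv_into_f[OF \<phi>] by (auto simp: fun_eq_iff PiE_iff extensional_def)
    have p: "?p permutes J"
    proof (rule bij_imp_permutes)
      have "inj_on ?p J"
      proof (rule inj_onI)
        fix x y assume xy: "x \<in> J" "y \<in> J" "?p x = ?p y"
        then have "f x = f y"
          using inj_onD[OF inj_on_the_inv_into[OF \<phi>] _ fJ fJ] by simp
        then show "x = y" using f xy by (auto dest: inj_onD)
      qed
      moreover have "?p ` J \<subseteq> J"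
        using fJ the_inv_into_into[OF \<phi>] by fastforce
      ultimately show "bij_betw ?p J J"
        unfolding bij_betw_def using endo_inj_surj[OF finJ] by blast
    qed auto
    then show "?p \<in> {p. p permutes J}" by simp
    have "rows_on m J u b f = rows_on m J u b (\<phi> \<circ> ?p)"
      using fJ f_the_inv_into_f[OF \<phi>] by (intro rows_on_cong) simp
    then show "w (restrict (\<phi> \<circ> ?p) J) * (of_int (sign ?p) * rows_on m J u b \<phi>) = w f * rows_on m J u b f"
      unfolding eq using rows_on_permute[OF J p, of u b \<phi>] by (simp only:)
  qed
  finally show ?thesis by (simp add: sum_distrib_right mult.assoc)
qed

section \<open>The average over the orders at one vertex, without the diagonal\<close>

context
  fixes K :: "'a set" and b :: "'a \<Rightarrow> nat \<Rightarrow> real" and J :: "nat set" and m :: nat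
    and \<phi> :: "nat \<Rightarrow> 'a" and u :: "nat \<Rightarrow> nat \<Rightarrow> real"
  assumes K: "finite K" and b0: "\<And>l. l < m \<Longrightarrow> (\<Sum>h\<in>K. b h l) = 0"
    and J: "J \<subseteq> {..<m}" and \<phi>: "inj_on \<phi> J" "\<phi> ` J \<subseteq> K"
begin

definition precede :: "nat set \<Rightarrow> (nat \<Rightarrow> 'a) \<Rightarrow> 'a list \<Rightarrow> real" where
  "precede I f xs = (\<Prod>i\<in>I. of_bool (position xs (f i) < position xs (\<phi> i)))"

lemma finJ: "finite J" using J finite_subset by blast

lemma inj_position: "xs \<in> permutations_of_set K \<Longrightarrow> inj_on (\<lambda>i. position xs (\<phi> i)) J"
  using comp_inj_on[OF \<phi>(1), of "position xs"] inj_on_position[of xs] \<phi>(2)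
  by (auto simp: permutations_of_set_def o_def intro: inj_on_subset)

lemma min_position:
  assumes "J \<noteq> {}"
  obtains j where "j \<in> J" "\<And>i. i \<in> J \<Longrightarrow> position xs (\<phi> j) \<le> position xs (\<phi> i)"
  using ex_has_least_nat[of "\<lambda>j. j \<in> J" _ "\<lambda>j. position xs (\<phi> j)"] assms by blast

text \<open>The earliest member of the image of \<open>\<phi>\<close> has no member of that image
  strictly before it.\<close>

lemma sum_precede_inside:
  assumes "J \<noteq> {}" "f ` J \<subseteq> \<phi> ` J"
  shows "precede J f xs = 0"
proof -
  obtain j where j: "j \<in> J" "\<And>i. i \<in> J \<Longrightarrow> position xs (\<phi> j) \<le> position xs (\<phi> i)"
    using min_position[OF assms(1)] by blast
  have "\<not> position xs (f j) < position xs (\<phi> j)"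
    using assms(2) j by (force simp: not_less)
  then show ?thesis
    unfolding precede_def using j(1) finJ by (intro prod_zero) auto
qed

text \<open>Two values of \<open>f\<close> outside \<open>\<phi> ` J\<close> can be exchanged by relabelling the order, which fixes
  the probability but changes the sign of the determinant.\<close>

lemma sum_outside_cancel:
  assumes j: "j \<in> J" "j' \<in> J" "j \<noteq> j'" "j \<in> R" "j' \<in> R"
  shows "(\<Sum>f\<in>{f \<in> PiE J (\<lambda>_. K). {i\<in>J. f i \<notin> \<phi> ` J} = R}.
    (\<Sum>xs\<in>permutations_of_set K. precede J f xs) * rows_on m J u b f) = 0"
    (is "sum ?g ?E = 0")
proof -
  define s where "s = Transposition.transpose j j'"
  have s: "s permutes J" using j by (auto simp: s_def intro!: permutes_swap_id)
  have ss: "s (s i) = i" for i by (simp add: s_def)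
  have g: "?g (f \<circ> s) = - ?g f" if f: "f \<in> ?E" for f
  proof (cases "inj_on f J")
    case False
    moreover have "\<not> inj_on (f \<circ> s) J"
      using False inj_on_imageI[of f s J] permutes_image[OF s] by auto
    ultimately have "rows_on m J u b f = 0" "rows_on m J u b (f \<circ> s) = 0"
      using rows_on_not_inj[OF J] by blast+
    then show ?thesis by simp
  next
    case True
    have fj: "f j \<notin> \<phi> ` J" "f j' \<notin> \<phi> ` J" "f j \<in> K" "f j' \<in> K"
      using f j by auto
    define t where "t = Transposition.transpose (f j) (f j')"
    have t: "t permutes K" using fj by (auto simp: t_def intro!: permutes_swap_id)
    \<comment> \<open>Exchanging two arguments of \<open>f\<close> amounts to exchanging two values
      because, \<open>f\<close> being injective, no third row takes either of them.\<close>
    have t1: "f (s i) = t (f i)" if "i \<in> J" for i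
      using inj_onD[OF True] that j by (auto simp: s_def t_def Transposition.transpose_def)
    have t2: "\<phi> i = t (\<phi> i)" if "i \<in> J" for i
      unfolding t_def using fj that by (metis imageI transpose_apply_other)
    have "(\<Sum>xs\<in>permutations_of_set K. precede J (f \<circ> s) xs) =
      (\<Sum>xs\<in>permutations_of_set K. precede J (f \<circ> s) (map t xs))"
      by (rule sum_permutations_of_set_relabel[OF t, symmetric])
    also have "\<dots> = (\<Sum>xs\<in>permutations_of_set K. precede J f xs)"
      unfolding precede_def
    proof (intro sum.cong refl prod.cong)
      fix xs i assume "i \<in> J"
      then show "of_bool (position (map t xs) ((f \<circ> s) i) < position (map t xs) (\<phi> i)) =
        (of_bool (position xs (f i) < position xs (\<phi> i)) :: real)"
        using position_map[OF permutes_inj[OF t]] t1[of i] t2[of i] by (metis comp_apply)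
    qed
    finally show ?thesis
      using rows_on_permute[OF J s, of u b f] j by (simp add: s_def sign_swap_id)
  qed
  have "sum ?g ?E = (\<Sum>f\<in>?E. ?g (f \<circ> s))"
  proof (rule sum.reindex_bij_betw[symmetric], rule bij_betwI[where g = "\<lambda>f. f \<circ> s"])
    have "f \<circ> s \<in> ?E" if "f \<in> ?E" for f
    proof -
      have "f \<circ> s \<in> PiE J (\<lambda>_. K)"
        using that permutes_in_image[OF s] permutes_not_in[OF s] by (auto simp: PiE_iff extensional_def)
      moreover have "s i \<in> R \<longleftrightarrow> i \<in> R" for i
        using j by (auto simp: s_def Transposition.transpose_def)
      then have "{i\<in>J. (f \<circ> s) i \<notin> \<phi> ` J} = R"
        using that permutes_in_image[OF s] by auto
      ultimately show ?thesis by blast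
    qed
    then show "(\<lambda>f. f \<circ> s) \<in> ?E \<rightarrow> ?E" "(\<lambda>f. f \<circ> s) \<in> ?E \<rightarrow> ?E" by blast+
  qed (auto simp: ss fun_eq_iff)
  also have "\<dots> = - sum ?g ?E"
    using g by (simp only: sum_negf[symmetric]) (rule sum.cong, auto)
  finally show ?thesis by simp
qed

lemma sum_outside_one:
  assumes j: "j \<in> J"
  shows "(\<Sum>f\<in>{f \<in> PiE J (\<lambda>_. K). {i\<in>J. f i \<notin> \<phi> ` J} = {j}}. g f) =
    (\<Sum>a\<in>K - \<phi> ` J. \<Sum>h\<in>PiE (J - {j}) (\<lambda>_. \<phi> ` J). g (h(j := a)))"
proof -
  have ins: "insert j (J - {j}) = J" using j by blast
  have "{f \<in> PiE J (\<lambda>_. K). {i\<in>J. f i \<notin> \<phi> ` J} = {j}} =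
      PiE (insert j (J - {j})) (\<lambda>i. if i = j then K - \<phi> ` J else \<phi> ` J)"
  proof (intro Set.set_eqI iffI)
    fix f assume "f \<in> {f \<in> PiE J (\<lambda>_. K). {i\<in>J. f i \<notin> \<phi> ` J} = {j}}"
    then have f: "f \<in> PiE J (\<lambda>_. K)" "\<And>i. i \<in> J \<Longrightarrow> f i \<notin> \<phi> ` J \<longleftrightarrow> i = j" by blast+
    then show "f \<in> PiE (insert j (J - {j})) (\<lambda>i. if i = j then K - \<phi> ` J else \<phi> ` J)"
      unfolding ins by (intro PiE_I) (auto dest: PiE_mem PiE_arb)
  next
    fix f assume "f \<in> PiE (insert j (J - {j})) (\<lambda>i. if i = j then K - \<phi> ` J else \<phi> ` J)"
    then have f: "f \<in> PiE J (\<lambda>i. if i = j then K - \<phi> ` J else \<phi> ` J)" unfolding ins .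
    have "f \<in> PiE J (\<lambda>_. K)"
      using \<phi>(2) by (intro set_mp[OF PiE_mono f]) auto
    moreover have "f i \<notin> \<phi> ` J \<longleftrightarrow> i = j" if "i \<in> J" for i
      using PiE_mem[OF f that] by (auto split: if_splits)
    ultimately show "f \<in> {f \<in> PiE J (\<lambda>_. K). {i\<in>J. f i \<notin> \<phi> ` J} = {j}}"
      using j by blast
  qed
  moreover have "PiE (J - {j}) (\<lambda>i. if i = j then K - \<phi> ` J else \<phi> ` J) = PiE (J - {j}) (\<lambda>_. \<phi> ` J)"
    by (intro PiE_cong) auto
  ultimately show ?thesis
    using sum_PiE_insert[of j "J - {j}" g "\<lambda>i. if i = j then K - \<phi> ` J else \<phi> ` J"] by simp
qed

text \<open>Only the \<open>j\<close> with \<open>\<phi> j\<close> earliest survives: for any other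
  \<open>j\<close> the earliest element would still need a predecessor inside the image of
  \<open>\<phi>\<close>. For that \<open>j\<close>, \<open>sum_cyclic_sign\<close> evaluates the
  inner sum, and the remaining condition says that \<open>a\<close> comes before all the
  others.\<close>

lemma sum_order_sign:
  assumes "J \<noteq> {}" "a \<in> K" "a \<notin> \<phi> ` J" "xs \<in> permutations_of_set K"
  shows "(\<Sum>j\<in>J. of_bool (position xs a < position xs (\<phi> j)) *
      (\<Sum>p | p permutes J. precede (J - {j}) (\<phi> \<circ> p) xs * of_int (sign p))) =
    (-1) ^ (card J - 1) * of_bool (\<forall>t\<in>insert a (\<phi> ` J). position xs a \<le> position xs t)"
proof -
  obtain j where j: "j \<in> J" "\<And>i. i \<in> J \<Longrightarrow> position xs (\<phi> j) \<le> position xs (\<phi> i)"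
    using min_position[OF assms(1)] by blast
  have "(\<Sum>p | p permutes J. precede (J - {i}) (\<phi> \<circ> p) xs * of_int (sign p)) =
      (if i = j then (-1) ^ (card J - 1) else 0)" if i: "i \<in> J" for i
  proof (cases "i = j")
    case True
    then show ?thesis
      using sum_cyclic_sign[OF finJ inj_position[OF assms(4)] j]
      by (simp add: precede_def mult.commute)
  next
    case False
    have "precede (J - {i}) (\<phi> \<circ> p) xs = 0" if "p permutes J" for p
      unfolding precede_def using False j finJ permutes_in_image[OF that, of j]
      by (intro prod_zero bexI[of _ j]) (auto simp: not_less)
    then show ?thesis using False by simp
  qed
  then have "(\<Sum>i\<in>J. of_bool (position xs a < position xs (\<phi> i)) *
      (\<Sum>p | p permutes J. precede (J - {i}) (\<phi> \<circ> p) xs * of_int (sign p))) =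
      (\<Sum>i\<in>J. if i = j then of_bool (position xs a < position xs (\<phi> i)) * (-1) ^ (card J - 1) else 0)"
    by (intro sum.cong) auto
  also have "\<dots> = of_bool (position xs a < position xs (\<phi> j)) * (-1) ^ (card J - 1)"
    using j finJ by simp
  also have "position xs a < position xs (\<phi> j) \<longleftrightarrow>
      (\<forall>t\<in>insert a (\<phi> ` J). position xs a \<le> position xs t)"
  proof -
    have "position xs a \<noteq> position xs (\<phi> j)"
      using inj_onD[OF inj_on_position[of xs], of a "\<phi> j"] assms \<phi>(2) j(1)
      by (auto simp: permutations_of_set_def)
    then show ?thesis using j by (auto simp: order_less_le intro: order_trans)
  qed
  finally show ?thesis by (simp only: mult.commute)
qed

text \<open>After expanding the rows, only choices \<open>f\<close> with exactly one value outside \<open>\<phi> ` J\<close> survive. As \<open>b\<close> sums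
  to zero, that value can be traded for values inside, and what remains is the probability
  \<open>1 / (card J + 1)\<close> that a fixed outside element precedes all of \<open>\<phi> ` J\<close>.\<close>

lemma average_strict:
  "(\<Sum>xs\<in>permutations_of_set K.
      dt m (\<lambda>i l. if i \<in> J then \<Sum>h\<in>K. of_bool (position xs h < position xs (\<phi> i)) * b h l else u i l)) =
    real (card (permutations_of_set K)) * ((-1) ^ card J / (real (card J) + 1)) * rows_on m J u b \<phi>"
proof (cases "J = {}")
  case True
  then show ?thesis by (simp add: rows_on_def)
next
  case False
  let ?P = "permutations_of_set K" and ?T = "\<phi> ` J" and ?D = "rows_on m J u b"
  define N where "N f = (\<Sum>xs\<in>?P. precede J f xs)" for f
  define R where "R f = {i\<in>J. f i \<notin> ?T}" for f
  have finF: "finite (PiE J (\<lambda>_. K))" using finJ K by (intro finite_PiE) auto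
  have "(\<Sum>xs\<in>?P. dt m (\<lambda>i l. if i \<in> J then \<Sum>h\<in>K. of_bool (position xs h < position xs (\<phi> i)) * b h l else u i l)) =
      (\<Sum>xs\<in>?P. \<Sum>f\<in>PiE J (\<lambda>_. K). precede J f xs * ?D f)"
    using J K by (subst dt_sum_rows) (auto simp: precede_def rows_on_def)
  also have "\<dots> = (\<Sum>f\<in>PiE J (\<lambda>_. K). N f * ?D f)"
    unfolding N_def sum_distrib_right by (rule sum.swap)
  also have "\<dots> = (\<Sum>S\<in>Pow J. \<Sum>f\<in>{f\<in>PiE J (\<lambda>_. K). R f = S}. N f * ?D f)"
    using finF finJ by (intro sum.group[symmetric]) (auto simp: R_def)
  also have "\<dots> = (\<Sum>S\<in>(\<lambda>j. {j}) ` J. \<Sum>f\<in>{f\<in>PiE J (\<lambda>_. K). R f = S}. N f * ?D f)"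
  proof (intro sum.mono_neutral_right ballI)
    fix S assume S: "S \<in> Pow J - (\<lambda>j. {j}) ` J"
    show "(\<Sum>f\<in>{f\<in>PiE J (\<lambda>_. K). R f = S}. N f * ?D f) = 0"
    proof (cases "S = {}")
      case True
      have "N f = 0" if "R f = {}" for f
        unfolding N_def using that sum_precede_inside[OF False, of f]
        by (intro sum.neutral ballI) (force simp: R_def)
      then show ?thesis using True by simp
    next
      case False
      then obtain j where j: "j \<in> S" by blast
      then have "S \<noteq> {j}" using S by auto
      then obtain j' where "j' \<in> S" "j \<noteq> j'" using j by blast
      then show ?thesis
        using sum_outside_cancel[of j j' S] j S unfolding N_def R_def by auto
    qed
  qed (use finJ in auto)
  also have "\<dots> = (\<Sum>j\<in>J. \<Sum>f\<in>{f\<in>PiE J (\<lambda>_. K). R f = {j}}. N f * ?D f)"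
    by (subst sum.reindex) auto
  also have "\<dots> = (\<Sum>j\<in>J. \<Sum>h\<in>PiE (J - {j}) (\<lambda>_. ?T). \<Sum>a\<in>K - ?T. N (h(j := a)) * ?D (h(j := a)))"
    unfolding R_def by (simp add: sum_outside_one) (intro sum.cong refl sum.swap)
  also have "\<dots> = real (card ?P) * ((-1) ^ card J / (real (card J) + 1)) * ?D \<phi>"
  proof (cases "K = ?T")
    case True
    \<comment> \<open>Without outside elements the left side is an empty sum. The minor vanishes
      too: its rows run through all of \<open>K\<close>, and summing the choice in row
      \<open>j\<close> over \<open>K\<close> leaves only the original minor, the other choices
      repeating a row.\<close>
    obtain j where j: "j \<in> J" using False by blast
    have "(\<Sum>a\<in>K. ?D (\<phi>(j := a))) = (\<Sum>a\<in>K. if a = \<phi> j then ?D \<phi> else 0)"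
    proof (intro sum.cong refl)
      fix a assume "a \<in> K"
      then obtain j' where j': "j' \<in> J" "a = \<phi> j'" using True by blast
      show "?D (\<phi>(j := a)) = (if a = \<phi> j then ?D \<phi> else 0)"
      proof (cases "j' = j")
        case False
        then have "\<not> inj_on (\<phi>(j := a)) J"
          using j j' inj_onD[of "\<phi>(j := a)" J j j'] by auto
        moreover have "a \<noteq> \<phi> j" using False j j' inj_onD[OF \<phi>(1)] by blast
        ultimately show ?thesis using rows_on_not_inj[OF J] by simp
      qed (use j' in simp)
    qed
    also have "\<dots> = ?D \<phi>" using K j \<phi>(2) by (simp add: sum.delta image_subset_iff)
    finally have "?D \<phi> = 0" using rows_on_sum_eq_0[OF J K b0 j] by simp
    then show ?thesis using True by simp
  next
    case False
    then obtain a where a: "a \<in> K" "a \<notin> ?T" using \<phi>(2) by blast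
    \<comment> \<open>All outside values are equivalent under relabelling, so the weight can be
      computed with the fixed \<open>a\<close> in place of the actual value \<open>c\<close>. The
      sum over \<open>c\<close> then falls on the minor alone.\<close>
    define n where "n j f = (\<Sum>xs\<in>?P. of_bool (position xs a < position xs (\<phi> j)) * precede (J - {j}) f xs)" for j f
    have n_upd: "n j (h(j := c)) = n j h" for j h c
      unfolding n_def precede_def by (intro sum.cong arg_cong2[where f = "(*)"] prod.cong) auto
    have n_restrict: "n j (restrict f J) = n j f" for j f
      unfolding n_def precede_def by (intro sum.cong arg_cong2[where f = "(*)"] prod.cong) auto
    have N_upd: "N (h(j := c)) = n j h" if j: "j \<in> J" and c: "c \<in> K - ?T" and h: "h \<in> PiE (J - {j}) (\<lambda>_. ?T)" for j c h
    proof -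
      define t where "t = Transposition.transpose a c"
      have t: "t permutes K" using a c by (auto simp: t_def intro!: permutes_swap_id)
      have tT: "t x = x" if "x \<in> ?T" for x
        unfolding t_def using a c that by (intro transpose_apply_other) auto
      have "N (h(j := c)) = (\<Sum>xs\<in>?P. precede J (h(j := c)) (map t xs))"
        unfolding N_def by (rule sum_permutations_of_set_relabel[OF t, symmetric])
      also have "\<dots> = n j h"
        unfolding n_def
      proof (rule sum.cong)
        fix xs
        have "precede J (h(j := c)) (map t xs) =
          of_bool (position (map t xs) c < position (map t xs) (\<phi> j)) * precede (J - {j}) (h(j := c)) (map t xs)"
          unfolding precede_def using j finJ by (simp add: prod.remove)
        also have "position (map t xs) c = position xs a"
          using position_map[OF permutes_inj[OF t], of xs a] by (simp add: t_def)
        also have "position (map t xs) (\<phi> j) = position xs (\<phi> j)"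
          using position_map[OF permutes_inj[OF t], of xs "\<phi> j"] tT j by simp
        also have "precede (J - {j}) (h(j := c)) (map t xs) = precede (J - {j}) h xs"
          unfolding precede_def
        proof (rule prod.cong)
          fix i assume i: "i \<in> J - {j}"
          then have "t (h i) = h i" "t (\<phi> i) = \<phi> i" using h tT by auto
          then show "of_bool (position (map t xs) ((h(j := c)) i) < position (map t xs) (\<phi> i)) =
              (of_bool (position xs (h i) < position xs (\<phi> i)) :: real)"
            using i position_map[OF permutes_inj[OF t], of xs] by (metis DiffD2 fun_upd_other insertI1)
        qed simp
        finally show "precede J (h(j := c)) (map t xs) =
          of_bool (position xs a < position xs (\<phi> j)) * precede (J - {j}) h xs" .
      qed simp
      finally show ?thesis .
    qed
    have "(\<Sum>h\<in>PiE (J - {j}) (\<lambda>_. ?T). \<Sum>c\<in>K - ?T. N (h(j := c)) * ?D (h(j := c))) =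
        - ((\<Sum>p | p permutes J. n j (\<phi> \<circ> p) * of_int (sign p)) * ?D \<phi>)" if j: "j \<in> J" for j
    proof -
      have ins: "insert j (J - {j}) = J" using j by blast
      have "(\<Sum>c\<in>K - ?T. ?D (h(j := c))) = - (\<Sum>c\<in>?T. ?D (h(j := c)))" for h
        using rows_on_sum_eq_0[OF J K b0 j, where u = u and f = h] K \<phi>(2) sum.subset_diff[OF \<phi>(2) K, of "\<lambda>c. ?D (h(j := c))"] by simp
      then have "(\<Sum>h\<in>PiE (J - {j}) (\<lambda>_. ?T). \<Sum>c\<in>K - ?T. N (h(j := c)) * ?D (h(j := c))) =
          (\<Sum>h\<in>PiE (J - {j}) (\<lambda>_. ?T). - (\<Sum>c\<in>?T. n j (h(j := c)) * ?D (h(j := c))))"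
        using N_upd[OF j] by (intro sum.cong) (simp_all add: n_upd sum_distrib_left[symmetric])
      also have "\<dots> = - (\<Sum>c\<in>?T. \<Sum>h\<in>PiE (J - {j}) (\<lambda>_. ?T). n j (h(j := c)) * ?D (h(j := c)))"
        unfolding sum_negf by (subst sum.swap) simp
      also have "\<dots> = - (\<Sum>f\<in>PiE J (\<lambda>_. ?T). n j f * ?D f)"
        using sum_PiE_insert[of j "J - {j}" "\<lambda>f. n j f * ?D f" "\<lambda>_. ?T"] unfolding ins by simp
      also have "\<dots> = - ((\<Sum>p | p permutes J. n j (restrict (\<phi> \<circ> p) J) * of_int (sign p)) * ?D \<phi>)"
        unfolding sum_rows_on_image[OF J \<phi>(1)] ..
      finally show ?thesis by (simp only: n_restrict)
    qed
    then have "(\<Sum>j\<in>J. \<Sum>h\<in>PiE (J - {j}) (\<lambda>_. ?T). \<Sum>c\<in>K - ?T. N (h(j := c)) * ?D (h(j := c))) =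
        - ((\<Sum>j\<in>J. \<Sum>p | p permutes J. n j (\<phi> \<circ> p) * of_int (sign p)) * ?D \<phi>)"
      by (simp add: sum_negf sum_distrib_right)
    also have "(\<Sum>j\<in>J. \<Sum>p | p permutes J. n j (\<phi> \<circ> p) * of_int (sign p)) =
        (\<Sum>xs\<in>?P. \<Sum>j\<in>J. of_bool (position xs a < position xs (\<phi> j)) *
          (\<Sum>p | p permutes J. precede (J - {j}) (\<phi> \<circ> p) xs * of_int (sign p)))"
    proof -
      have "(\<Sum>p | p permutes J. n j (\<phi> \<circ> p) * of_int (sign p)) =
        (\<Sum>xs\<in>?P. of_bool (position xs a < position xs (\<phi> j)) *
          (\<Sum>p | p permutes J. precede (J - {j}) (\<phi> \<circ> p) xs * of_int (sign p)))" for j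
        unfolding n_def sum_distrib_right sum_distrib_left mult.assoc by (rule sum.swap)
      then show ?thesis by (simp only:) (rule sum.swap)
    qed
    also have "\<dots> = (\<Sum>xs\<in>?P. (-1) ^ (card J - 1) * of_bool (\<forall>t\<in>insert a ?T. position xs a \<le> position xs t))"
      using sum_order_sign[OF \<open>J \<noteq> {}\<close> a] by (intro sum.cong) auto
    also have "\<dots> = (-1) ^ (card J - 1) * (real (card ?P) / real (card (insert a ?T)))"
      unfolding sum_distrib_left[symmetric] using K a \<phi>(2) by (subst sum_first_element) auto
    also have "card (insert a ?T) = card J + 1"
      using a finJ card_image[OF \<phi>(1)] by simp
    \<comment> \<open>The minus sign from trading outside values for inside ones turns the exponent
      \<open>card J - 1\<close> into \<open>card J\<close>.\<close>
    also have "- ((-1) ^ (card J - 1) * (real (card ?P) / real (card J + 1)) * ?D \<phi>) =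
        real (card ?P) * ((-1) ^ card J / (real (card J) + 1)) * ?D \<phi>"
      using \<open>J \<noteq> {}\<close> finJ by (cases "card J") (auto simp: field_simps)
    finally show ?thesis .
  qed
  finally show ?thesis .
qed

end

text \<open>The strict average \<open>(-1) ^ k / (k + 1)\<close> is the integral of \<open>x ^ k\<close> over \<open>{-1..0}\<close>; adding half the
  identity in \<open>p\<close> of the rows replaces \<open>p\<close> of the factors \<open>x\<close> by \<open>x + 1/2\<close>.\<close>

definition half_moment :: "nat \<Rightarrow> nat \<Rightarrow> real" where
  "half_moment p q = integral {-1..0} (\<lambda>x. (x + 1/2) ^ p * x ^ q)"

lemma half_moment_Suc: "half_moment (Suc p) q = 1/2 * half_moment p q + half_moment p (Suc q)"
proof -
  have int: "(\<lambda>x::real. (x + 1/2) ^ p * x ^ q) integrable_on {-1..0}" for p q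
    by (intro integrable_continuous_interval continuous_intros)
  have "half_moment (Suc p) q =
      integral {-1..0} (\<lambda>x. 1/2 * ((x + 1/2) ^ p * x ^ q) + (x + 1/2) ^ p * x ^ Suc q)"
    unfolding half_moment_def by (intro arg_cong[where f = "integral {-1..0}"] ext) (simp add: algebra_simps)
  also have "\<dots> = integral {-1..0} (\<lambda>x. 1/2 * ((x + 1/2) ^ p * x ^ q)) + half_moment p (Suc q)"
    unfolding half_moment_def by (intro Henstock_Kurzweil_Integration.integral_add integrable_on_mult_right int)
  finally show ?thesis by (simp add: half_moment_def)
qed

lemma half_moment_shift: "half_moment p 0 = ((1/2) ^ Suc p - (-1/2) ^ Suc p) / real (Suc p)"
proof -
  have "((\<lambda>x. (x + 1/2) ^ p * x ^ 0) has_integral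
      ((0 + 1/2) ^ Suc p / real (Suc p) - (-1 + 1/2) ^ Suc p / real (Suc p))) {-1..0::real}"
    by (rule fundamental_theorem_of_calculus)
      (auto intro!: derivative_eq_intros simp: has_real_derivative_iff_has_vector_derivative[symmetric]
        simp del: of_nat_Suc power_Suc)
  then show ?thesis
    unfolding half_moment_def by (simp add: integral_unique diff_divide_distrib del: power_Suc of_nat_Suc)
qed

lemma half_moment_0: "half_moment 0 q = (-1) ^ q / (real q + 1)"
proof -
  have "((\<lambda>x. (x + 1/2) ^ 0 * x ^ q) has_integral
      (0 ^ Suc q / real (Suc q) - (-1) ^ Suc q / real (Suc q))) {-1..0::real}"
    by (rule fundamental_theorem_of_calculus)
      (auto intro!: derivative_eq_intros simp: has_real_derivative_iff_has_vector_derivative[symmetric]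
        simp del: of_nat_Suc power_Suc)
  then show ?thesis
    unfolding half_moment_def by (subst integral_unique) (auto simp: add.commute)
qed

text \<open>The \<open>k\<close>-th moment of the uniform distribution on
  \<open>[-1/2, 1/2]\<close>.\<close>

definition vertex_weight :: "nat \<Rightarrow> real" where
  "vertex_weight k = (if even k then 1 / (2 ^ k * (real k + 1)) else 0)"

lemma half_moment_eq_vertex_weight: "half_moment k 0 = vertex_weight k"
proof (cases "even k")
  case True
  then have "(1/2) ^ Suc k - (- (1/2)) ^ Suc k = (1/2 :: real) ^ k"
    by (subst power_minus_odd) simp_all
  then show ?thesis
    using True unfolding half_moment_shift vertex_weight_def by (simp add: power_one_over add.commute)
next
  case False
  then have "(- (1/2)) ^ Suc k = (1/2 :: real) ^ Suc k"
    by (intro power_minus_even) simp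
  then show ?thesis
    using False unfolding half_moment_shift vertex_weight_def by simp
qed

text \<open>For members of the list this is 1/2 plus half the sign of the difference of positions.
  The diagonal value 1/2 is what makes the form skew up to a constant.\<close>

definition order_form :: "'a list \<Rightarrow> 'a \<Rightarrow> 'a \<Rightarrow> real" where
  "order_form xs h h' = of_bool (position xs h < position xs h') + of_bool (h = h') / 2"

text \<open>Interpolates between the strict form at \<open>I = {}\<close> and
  \<open>order_form\<close> at \<open>I = J\<close>. By linearity in row \<open>r\<close>, the minor
  splits into half the one in which \<open>r\<close> leaves \<open>J\<close> and its row is frozen
  into \<open>u\<close>, and the one in which \<open>r\<close> stays strict. These are the two terms
  of \<open>half_moment_Suc\<close>; hence \<open>J\<close> and \<open>u\<close> vary in the
  induction.\<close>

lemma average_half: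
  fixes b :: "'a \<Rightarrow> nat \<Rightarrow> real"
  assumes K: "finite K" and b0: "\<And>l. l < m \<Longrightarrow> (\<Sum>h\<in>K. b h l) = 0" and "finite I"
  shows "J \<subseteq> {..<m} \<Longrightarrow> inj_on \<phi> J \<Longrightarrow> \<phi> ` J \<subseteq> K \<Longrightarrow> I \<subseteq> J \<Longrightarrow>
    (\<Sum>xs\<in>permutations_of_set K. dt m (\<lambda>i l.
      if i \<in> I then 1/2 * b (\<phi> i) l + (\<Sum>h\<in>K. of_bool (position xs h < position xs (\<phi> i)) * b h l)
      else if i \<in> J then \<Sum>h\<in>K. of_bool (position xs h < position xs (\<phi> i)) * b h l
      else u i l)) =
    real (card (permutations_of_set K)) * half_moment (card I) (card J - card I) * rows_on m J u b \<phi>"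
  using \<open>finite I\<close>
proof (induction I arbitrary: J u rule: finite_induct)
  case empty
  then show ?case
    using average_strict[OF K b0 empty(1-3), where u = u] by (simp add: half_moment_0)
next
  case (insert r I)
  let ?P = "permutations_of_set K"
  let ?s = "\<lambda>xs i l. \<Sum>h\<in>K. of_bool (position xs h < position xs (\<phi> i)) * b h l"
  let ?A = "\<lambda>I J u xs i l. if i \<in> I then 1/2 * b (\<phi> i) l + ?s xs i l else if i \<in> J then ?s xs i l else u i l"
  let ?u = "u(r := b (\<phi> r))"
  have r: "r \<in> J" "r < m" using insert.prems by auto
  have finJ: "finite J" using insert.prems(1) finite_subset by blast
  have split: "dt m (?A (insert r I) J u xs) = 1/2 * dt m (?A I (J - {r}) ?u xs) + dt m (?A I J u xs)" for xs
  proof -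
    let ?B = "?A I J u xs"
    have "dt m (?A (insert r I) J u xs) = dt m (?B(r := \<lambda>l. 1/2 * b (\<phi> r) l + ?s xs r l))"
      by (intro dt_cong) auto
    also have "\<dots> = dt m (?B(r := \<lambda>l. 1/2 * b (\<phi> r) l)) + dt m (?B(r := ?s xs r))"
      by (rule dt_row_add[OF r(2)])
    also have "?B(r := ?s xs r) = ?B" using insert.hyps r by (auto simp: fun_eq_iff)
    also have "dt m (?B(r := \<lambda>l. 1/2 * b (\<phi> r) l)) = 1/2 * dt m (?B(r := b (\<phi> r)))"
      using dt_row_sum[OF r(2), of "{()}" ?B "\<lambda>_. 1/2" "\<lambda>_. b (\<phi> r)"] by simp
    also have "?B(r := b (\<phi> r)) = ?A I (J - {r}) ?u xs"
      using insert.hyps r by (auto simp: fun_eq_iff)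
    finally show ?thesis .
  qed
  have cards: "card (insert r I) = Suc (card I)" "card (J - {r}) - card I = card J - card (insert r I)"
    "card J - card I = Suc (card J - card (insert r I))"
    using insert r finJ card_mono[OF finJ, of "insert r I"] by auto
  have 1: "(\<Sum>xs\<in>?P. dt m (?A I (J - {r}) ?u xs)) =
      real (card ?P) * half_moment (card I) (card J - card (insert r I)) * rows_on m (J - {r}) ?u b \<phi>"
    using insert.prems insert.hyps
    by (intro insert.IH[of "J - {r}" ?u, unfolded cards(2)]) (auto intro: inj_on_subset)
  have 2: "(\<Sum>xs\<in>?P. dt m (?A I J u xs)) =
      real (card ?P) * half_moment (card I) (Suc (card J - card (insert r I))) * rows_on m J u b \<phi>"
    using insert.IH[of J u] insert.prems unfolding cards(3) by auto
  have 3: "rows_on m (J - {r}) ?u b \<phi> = rows_on m J u b \<phi>"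
    unfolding rows_on_def using r by (intro dt_cong) auto
  show ?case
    unfolding split sum.distrib sum_distrib_left[symmetric] 1 2 3 half_moment_Suc cards(1)
    by (simp add: algebra_simps)
qed

lemma average_vertex:
  fixes b :: "'a \<Rightarrow> nat \<Rightarrow> real"
  assumes K: "finite K" and b0: "\<And>l. l < m \<Longrightarrow> (\<Sum>h\<in>K. b h l) = 0" and J: "J \<subseteq> {..<m}" and \<phi>: "\<phi> ` J \<subseteq> K"
  shows "(\<Sum>xs\<in>permutations_of_set K.
      dt m (\<lambda>i l. if i \<in> J then \<Sum>h\<in>K. order_form xs h (\<phi> i) * b h l else u i l)) =
    real (card (permutations_of_set K)) * vertex_weight (card J) * dt m (\<lambda>i. if i \<in> J then b (\<phi> i) else u i)"
proof (cases "inj_on \<phi> J")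
  case True
  have "(\<Sum>h\<in>K. order_form xs h (\<phi> i) * b h l) =
      1/2 * b (\<phi> i) l + (\<Sum>h\<in>K. of_bool (position xs h < position xs (\<phi> i)) * b h l)"
    if "i \<in> J" for xs i l
  proof -
    have "(\<Sum>h\<in>K. order_form xs h (\<phi> i) * b h l) =
      (\<Sum>h\<in>K. of_bool (position xs h < position xs (\<phi> i)) * b h l) + (\<Sum>h\<in>K. if h = \<phi> i then b h l / 2 else 0)"
      unfolding sum.distrib[symmetric] by (intro sum.cong) (auto simp: order_form_def algebra_simps)
    then show ?thesis using K \<phi> that by auto
  qed
  then show ?thesis
    using average_half[OF K b0 _ J True \<phi> order_refl, where u = u] finite_subset[OF J]
    by (simp add: half_moment_eq_vertex_weight rows_on_def cong: if_cong)
next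
  case False
  then obtain r r' where r: "r \<in> J" "r' \<in> J" "r \<noteq> r'" "\<phi> r = \<phi> r'"
    by (auto simp: inj_on_def)
  then have lt: "r < m" "r' < m" using J by auto
  have "dt m (\<lambda>i l. if i \<in> J then \<Sum>h\<in>K. order_form xs h (\<phi> i) * b h l else u i l) = 0" for xs
    using r lt by (intro dt_identical_rows[of r m r']) auto
  moreover have "dt m (\<lambda>i. if i \<in> J then b (\<phi> i) else u i) = 0"
    using r lt by (intro dt_identical_rows[of r m r']) auto
  ultimately show ?thesis by simp
qed

text \<open>Row \<open>i\<close> depends only on the order at \<open>t i\<close>, so the independent
  orders can be averaged one vertex at a time. In the induction \<open>u\<close> holds the still
  unaveraged rows of the vertex that is added.\<close>

lemma average_vertices:
  fixes b :: "'a \<Rightarrow> nat \<Rightarrow> real" and K :: "'v \<Rightarrow> 'a set" and t :: "nat \<Rightarrow> 'v"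
  assumes "finite V" and K: "\<And>v. v \<in> V \<Longrightarrow> finite (K v)"
    and b0: "\<And>v l. v \<in> V \<Longrightarrow> l < m \<Longrightarrow> (\<Sum>h\<in>K v. b h l) = 0"
    and \<phi>: "\<And>i. i < m \<Longrightarrow> t i \<in> V \<Longrightarrow> \<phi> i \<in> K (t i)"
  shows "(\<Sum>L\<in>PiE V (\<lambda>v. permutations_of_set (K v)).
      dt m (\<lambda>i l. if t i \<in> V then \<Sum>h\<in>K (t i). order_form (L (t i)) h (\<phi> i) * b h l else u i l)) =
    (\<Prod>v\<in>V. real (card (permutations_of_set (K v))) * vertex_weight (card {i\<in>{..<m}. t i = v})) *
    dt m (\<lambda>i. if t i \<in> V then b (\<phi> i) else u i)"
  using assms
proof (induction V arbitrary: u rule: finite_induct)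
  case (insert v V)
  let ?P = "\<lambda>v. permutations_of_set (K v)"
  let ?s = "\<lambda>xs i l. \<Sum>h\<in>K (t i). order_form xs h (\<phi> i) * b h l"
  let ?J = "{i\<in>{..<m}. t i = v}"
  let ?w = "\<Prod>v\<in>V. real (card (?P v)) * vertex_weight (card {i\<in>{..<m}. t i = v})"
  have "(\<Sum>L\<in>PiE (insert v V) ?P. dt m (\<lambda>i l. if t i \<in> insert v V then ?s (L (t i)) i l else u i l)) =
    (\<Sum>xs\<in>?P v. \<Sum>L\<in>PiE V ?P.
      dt m (\<lambda>i l. if t i \<in> V then ?s (L (t i)) i l else if t i = v then ?s xs i l else u i l))"
    using insert.hyps by (subst sum_PiE_insert) (auto intro!: sum.cong dt_cong)
  also have "\<dots> = (\<Sum>xs\<in>?P v. ?w * dt m (\<lambda>i. if t i \<in> V then b (\<phi> i) else (\<lambda>l. if t i = v then ?s xs i l else u i l)))"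
    using insert.prems by (intro sum.cong refl insert.IH) auto
  also have "\<dots> = ?w * (\<Sum>xs\<in>?P v. dt m (\<lambda>i l. if i \<in> ?J then \<Sum>h\<in>K v. order_form xs h (\<phi> i) * b h l
      else (if t i \<in> V then b (\<phi> i) else u i) l))"
    unfolding sum_distrib_left using insert.hyps by (intro sum.cong refl arg_cong2[where f = "(*)"] dt_cong) auto
  also have "\<dots> = ?w * (real (card (?P v)) * vertex_weight (card ?J) *
      dt m (\<lambda>i. if i \<in> ?J then b (\<phi> i) else (if t i \<in> V then b (\<phi> i) else u i)))"
    using insert.prems by (subst average_vertex) auto
  also have "dt m (\<lambda>i. if i \<in> ?J then b (\<phi> i) else (if t i \<in> V then b (\<phi> i) else u i)) =
      dt m (\<lambda>i. if t i \<in> insert v V then b (\<phi> i) else u i)"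
    by (intro dt_cong) auto
  finally show ?case using insert.hyps by simp
qed simp

section \<open>A weighted Cauchy-Binet formula\<close>

lemma dt_transpose: "dt m (\<lambda>i l. A l i) = dt m A"
proof -
  have "transpose_mat (Matrix.mat m m (\<lambda>(i, j). A i j)) = Matrix.mat m m (\<lambda>(i, j). A j i)"
    by (intro eq_matI) auto
  then show ?thesis
    using Determinant.det_transpose[of "Matrix.mat m m (\<lambda>(i, j). A i j)" m] by (simp add: dt_eq_det)
qed

text \<open>The injective choices are grouped by their image \<open>S\<close>. Within a group they
  differ by permutations, whose signs assemble the diagonal products into a second, transposed copy
  of the minor at \<open>S\<close>. The enumeration \<open>e S\<close> is arbitrary because the
  minor is squared.\<close>

lemma sum_choices_eq_sum_minors:
  fixes b :: "'a \<Rightarrow> nat \<Rightarrow> real" and w :: "'a set \<Rightarrow> real"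
  assumes H: "finite H" and e: "\<And>S. S \<subseteq> H \<Longrightarrow> card S = m \<Longrightarrow> bij_betw (e S) {..<m} S"
  shows "(\<Sum>\<phi>\<in>PiE {..<m} (\<lambda>_. H). (\<Prod>i<m. b (\<phi> i) i) * w (\<phi> ` {..<m}) * dt m (\<lambda>i. b (\<phi> i))) =
    (\<Sum>S\<in>{S. S \<subseteq> H \<and> card S = m}. w S * (dt m (\<lambda>i. b (e S i)))\<^sup>2)"
proof -
  let ?J = "{..<m}"
  let ?D = "rows_on m ?J undefined b"
  let ?g = "\<lambda>\<phi>. (\<Prod>i<m. b (\<phi> i) i) * w (\<phi> ` ?J) * ?D \<phi>"
  have D: "dt m (\<lambda>i. b (\<phi> i)) = ?D \<phi>" for \<phi>
    unfolding rows_on_def by (intro dt_cong) simp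
  have "(\<Sum>\<phi>\<in>PiE ?J (\<lambda>_. H). ?g \<phi>) = (\<Sum>\<phi>\<in>{\<phi>\<in>PiE ?J (\<lambda>_. H). inj_on \<phi> ?J}. ?g \<phi>)"
    using H rows_on_not_inj[of ?J m] by (intro sum.mono_neutral_right) (auto intro: finite_PiE)
  also have "\<dots> = (\<Sum>S\<in>{S. S \<subseteq> H \<and> card S = m}.
      \<Sum>\<phi>\<in>{\<phi>\<in>{\<phi>\<in>PiE ?J (\<lambda>_. H). inj_on \<phi> ?J}. \<phi> ` ?J = S}. ?g \<phi>)"
  proof (rule sum.group[symmetric])
    show "finite {\<phi>\<in>PiE ?J (\<lambda>_. H). inj_on \<phi> ?J}" using H by (simp add: finite_PiE)
    show "finite {S. S \<subseteq> H \<and> card S = m}" using H by simp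
    show "(\<lambda>\<phi>. \<phi> ` ?J) ` {\<phi>\<in>PiE ?J (\<lambda>_. H). inj_on \<phi> ?J} \<subseteq> {S. S \<subseteq> H \<and> card S = m}"
    proof (rule image_subsetI)
      fix \<phi> assume "\<phi> \<in> {\<phi>\<in>PiE ?J (\<lambda>_. H). inj_on \<phi> ?J}"
      then have "\<phi> \<in> PiE ?J (\<lambda>_. H)" "inj_on \<phi> ?J" by simp_all
      then show "\<phi> ` ?J \<in> {S. S \<subseteq> H \<and> card S = m}"
        using card_image[of \<phi> ?J] PiE_mem[of \<phi> ?J "\<lambda>_. H"] by (simp add: image_subset_iff)
    qed
  qed
  also have "\<dots> = (\<Sum>S\<in>{S. S \<subseteq> H \<and> card S = m}. w S * (?D (e S))\<^sup>2)"
  proof (rule sum.cong)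
    fix S assume "S \<in> {S. S \<subseteq> H \<and> card S = m}"
    then have S: "S \<subseteq> H" "card S = m" "finite S" using finite_subset[OF _ H] by blast+
    have eS: "inj_on (e S) ?J" "e S ` ?J = S" using e[OF S(1,2)] unfolding bij_betw_def by blast+
    have "(\<Sum>\<phi>\<in>{\<phi>\<in>{\<phi>\<in>PiE ?J (\<lambda>_. H). inj_on \<phi> ?J}. \<phi> ` ?J = S}. ?g \<phi>) =
        (\<Sum>\<phi>\<in>PiE ?J (\<lambda>_. S). ((\<Prod>i<m. b (\<phi> i) i) * w S) * ?D \<phi>)"
    proof -
      have "\<phi> \<in> PiE ?J (\<lambda>_. H) \<and> \<phi> ` ?J = S \<longleftrightarrow> \<phi> \<in> PiE ?J (\<lambda>_. S)" if inj: "inj_on \<phi> ?J" for \<phi>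
      proof
        assume \<phi>: "\<phi> \<in> PiE ?J (\<lambda>_. S)"
        then have "\<phi> ` ?J \<subseteq> S" by auto
        then have "\<phi> ` ?J = S" using S card_image[OF inj] by (intro card_subset_eq) simp_all
        moreover have "\<phi> \<in> PiE ?J (\<lambda>_. H)" using S by (intro set_mp[OF PiE_mono \<phi>]) auto
        ultimately show "\<phi> \<in> PiE ?J (\<lambda>_. H) \<and> \<phi> ` ?J = S" by blast
      next
        assume "\<phi> \<in> PiE ?J (\<lambda>_. H) \<and> \<phi> ` ?J = S"
        then show "\<phi> \<in> PiE ?J (\<lambda>_. S)" unfolding PiE_iff by blast
      qed
      then have "{\<phi>\<in>{\<phi>\<in>PiE ?J (\<lambda>_. H). inj_on \<phi> ?J}. \<phi> ` ?J = S} = {\<phi>\<in>PiE ?J (\<lambda>_. S). inj_on \<phi> ?J}"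
        by blast
      moreover have "(\<Sum>\<phi>\<in>{\<phi>\<in>PiE ?J (\<lambda>_. S). inj_on \<phi> ?J}. ?g \<phi>) =
          (\<Sum>\<phi>\<in>PiE ?J (\<lambda>_. S). ((\<Prod>i<m. b (\<phi> i) i) * w S) * ?D \<phi>)"
      proof (rule sum.mono_neutral_cong_left)
        show "?g \<phi> = (\<Prod>i<m. b (\<phi> i) i) * w S * ?D \<phi>" if "\<phi> \<in> {\<phi>\<in>PiE ?J (\<lambda>_. S). inj_on \<phi> ?J}" for \<phi>
        proof -
          have "\<phi> ` ?J \<subseteq> S" using that by auto
          then have "\<phi> ` ?J = S" using that S by (intro card_subset_eq) (simp_all add: card_image)
          then show ?thesis by simp
        qed
        show "\<forall>\<phi>\<in>PiE ?J (\<lambda>_. S) - {\<phi>\<in>PiE ?J (\<lambda>_. S). inj_on \<phi> ?J}. (\<Prod>i<m. b (\<phi> i) i) * w S * ?D \<phi> = 0"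
          by (auto dest: rows_on_not_inj[OF order_refl])
      qed (use S in \<open>auto intro: finite_PiE\<close>)
      ultimately show ?thesis by simp
    qed
    also have "\<dots> = (\<Sum>p | p permutes ?J. (\<Prod>i<m. b (restrict (e S \<circ> p) ?J i) i) * w S * of_int (sign p)) * ?D (e S)"
      using sum_rows_on_image[OF order_refl eS(1), where w = "\<lambda>\<phi>. (\<Prod>i<m. b (\<phi> i) i) * w S" and b = b] unfolding eS(2) by simp
    also have "(\<Sum>p | p permutes ?J. (\<Prod>i<m. b (restrict (e S \<circ> p) ?J i) i) * w S * of_int (sign p)) =
        w S * dt m (\<lambda>i l. b (e S l) i)"
      unfolding dt_def sum_distrib_left by (intro sum.cong) (auto intro!: prod.cong)
    also have "dt m (\<lambda>i l. b (e S l) i) = ?D (e S)"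
      unfolding D[symmetric] by (rule dt_transpose)
    finally show "(\<Sum>\<phi>\<in>{\<phi>\<in>{\<phi>\<in>PiE ?J (\<lambda>_. H). inj_on \<phi> ?J}. \<phi> ` ?J = S}. ?g \<phi>) = w S * (?D (e S))\<^sup>2"
      by (simp add: power2_eq_square)
  qed simp
  finally show ?thesis unfolding D .
qed

section \<open>Cycles\<close>

locale ribbon_graph = fin_digraph G + bidirected_digraph G \<iota>
  for G :: "('v, 'h) pre_digraph" and \<iota> :: "'h \<Rightarrow> 'h" +
  assumes connected: "Digraph_Component.connected G"
begin

lemma arev_inj [simp]: "\<iota> x = \<iota> y \<longleftrightarrow> x = y"
  by (metis arev_arev)

lemma arev_eq_iff: "\<iota> x = y \<longleftrightarrow> x = \<iota> y"
  by (metis arev_arev)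

lemma tail_in: "h \<in> arcs G \<Longrightarrow> tail G h \<in> verts G"
  by simp

lemma verts_ne: "verts G \<noteq> {}"
  using connected by (simp add: Digraph_Component.connected_def strongly_connected_def)

lemma connected_closed:
  assumes "W \<subseteq> verts G" "W \<noteq> {}" "\<And>h. h \<in> arcs G \<Longrightarrow> tail G h \<in> W \<Longrightarrow> tail G (\<iota> h) \<in> W"
  shows "W = verts G"
proof
  obtain u where u: "u \<in> W" using assms(2) by blast
  show "verts G \<subseteq> W"
  proof
    fix v assume "v \<in> verts G"
    then have "u \<rightarrow>\<^sup>*\<^bsub>with_proj (mk_symmetric G)\<^esub> v"
      using connected u assms(1) by (auto simp: Digraph_Component.connected_def strongly_connected_def)
    then have "(u, v) \<in> rtrancl_on (verts G) (parcs (mk_symmetric G))"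
      by (simp add: reachable_def)
    then show "v \<in> W"
    proof (induction rule: rtrancl_on_induct)
      case (step x y)
      then obtain e where e: "e \<in> arcs G" "(x, y) = (tail G e, head G e) \<or> (x, y) = (head G e, tail G e)"
        by (auto simp: parcs_mk_symmetric)
      then show ?case
        using assms(3)[of e] assms(3)[of "\<iota> e"] step by auto
    qed (rule u)
  qed
qed (rule assms(1))

lemma cycle_outside: "c \<in> one_cycles G \<iota> \<Longrightarrow> h \<notin> arcs G \<Longrightarrow> c h = 0"
  by (simp add: one_cycles_def)

lemma cycle_reverse: "c \<in> one_cycles G \<iota> \<Longrightarrow> c (\<iota> h) = - c h"
  using arev_eq[of h] by (cases "h \<in> arcs G") (auto simp: one_cycles_def)

lemma cycle_vertex: "c \<in> one_cycles G \<iota> \<Longrightarrow> v \<in> verts G \<Longrightarrow> (\<Sum>h\<in>out_arcs G v. c h) = 0"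
  by (simp add: one_cycles_def)

lemma cycle_sum:
  assumes "\<And>i. i \<in> I \<Longrightarrow> z i \<in> one_cycles G \<iota>"
  shows "(\<lambda>h. \<Sum>i\<in>I. k i * z i h) \<in> one_cycles G \<iota>"
proof -
  have "(\<Sum>h\<in>out_arcs G v. \<Sum>i\<in>I. k i * z i h) = 0" if "v \<in> verts G" for v
    using cycle_vertex[OF assms that] by (subst sum.swap) (simp add: sum_distrib_left[symmetric])
  then show ?thesis
    using assms by (auto simp: one_cycles_def sum_negf)
qed

lemma cycle_diff:
  assumes "c \<in> one_cycles G \<iota>" "d \<in> one_cycles G \<iota>"
  shows "(\<lambda>h. c h - d h) \<in> one_cycles G \<iota>"
  using assms by (auto simp: one_cycles_def sum_subtractf)

lemma sum_reverse: "(\<Sum>h\<in>arcs G. f (\<iota> h)) = (\<Sum>h\<in>arcs G. f h)"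
  using sum.permute[OF arev_permutes_arcs, of f] by (simp add: o_def)

lemma sum_arcs_by_tail:
  assumes "W \<subseteq> verts G"
  shows "(\<Sum>v\<in>W. \<Sum>h\<in>out_arcs G v. f h) = (\<Sum>h\<in>{h\<in>arcs G. tail G h \<in> W}. f h)"
proof -
  have "finite W" using assms finite_verts finite_subset by blast
  then have "(\<Sum>v\<in>W. \<Sum>h\<in>{h\<in>{h\<in>arcs G. tail G h \<in> W}. tail G h = v}. f h) = (\<Sum>h\<in>{h\<in>arcs G. tail G h \<in> W}. f h)"
    by (intro sum.group) auto
  moreover have "{h\<in>{h\<in>arcs G. tail G h \<in> W}. tail G h = v} = out_arcs G v" if "v \<in> W" for v
    using that by (auto simp: out_arcs_def)
  ultimately show ?thesis by (metis (no_types, lifting) sum.cong)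
qed

text \<open>Summing the vertex condition over \<open>W\<close> counts each edge inside
  \<open>W\<close> twice, with opposite signs; only the edges leaving \<open>W\<close>
  remain.\<close>

lemma cut_sum:
  assumes c: "c \<in> one_cycles G \<iota>" and W: "W \<subseteq> verts G"
  shows "(\<Sum>h\<in>{h\<in>arcs G. tail G h \<in> W \<and> tail G (\<iota> h) \<notin> W}. c h) = 0"
proof -
  let ?In = "\<lambda>h. tail G h \<in> W" and ?Out = "\<lambda>h. tail G (\<iota> h) \<in> W"
  have "(\<Sum>h\<in>arcs G. if ?In h \<and> ?Out h then c h else 0) = (\<Sum>h\<in>arcs G. if ?In (\<iota> h) \<and> ?Out (\<iota> h) then c (\<iota> h) else 0)"
    by (rule sum_reverse[symmetric])
  also have "\<dots> = - (\<Sum>h\<in>arcs G. if ?In h \<and> ?Out h then c h else 0)"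
    unfolding sum_negf[symmetric] using cycle_reverse[OF c] by (intro sum.cong) auto
  finally have inner: "(\<Sum>h\<in>{h\<in>arcs G. ?In h \<and> ?Out h}. c h) = 0"
    by (simp add: sum.inter_filter)
  have "0 = (\<Sum>v\<in>W. \<Sum>h\<in>out_arcs G v. c h)"
    using cycle_vertex[OF c] W by (intro sum.neutral[symmetric]) auto
  also have "\<dots> = (\<Sum>h\<in>{h\<in>arcs G. ?In h}. c h)"
    by (rule sum_arcs_by_tail[OF W])
  also have "{h\<in>arcs G. ?In h} = {h\<in>arcs G. ?In h \<and> ?Out h} \<union> {h\<in>arcs G. ?In h \<and> \<not> ?Out h}"
    by blast
  also have "(\<Sum>h\<in>\<dots>. c h) = (\<Sum>h\<in>{h\<in>arcs G. ?In h \<and> ?Out h}. c h) + (\<Sum>h\<in>{h\<in>arcs G. ?In h \<and> \<not> ?Out h}. c h)"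
    by (intro sum.union_disjoint) auto
  finally show ?thesis using inner by simp
qed

section \<open>Walks as chains, and bridges\<close>

definition adjacency :: "'h set \<Rightarrow> ('v \<times> 'v) set" where
  "adjacency A = {(tail G h, tail G (\<iota> h)) | h. h \<in> A}"

definition edge_chain :: "'h \<Rightarrow> 'h \<Rightarrow> real" where
  "edge_chain h x = of_bool (x = h) - of_bool (x = \<iota> h)"

lemma sum_edge_chain:
  assumes "h \<in> arcs G"
  shows "(\<Sum>x\<in>out_arcs G v. edge_chain h x) = of_bool (tail G h = v) - of_bool (tail G (\<iota> h) = v)"
proof -
  have "(\<Sum>x\<in>out_arcs G v. of_bool (x = h') :: real) = of_bool (tail G h' = v)" if "h' \<in> arcs G" for h'
    using that finite_out_arcs[of v] by (auto simp: out_arcs_def of_bool_def)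
  then show ?thesis
    unfolding edge_chain_def sum_subtractf using assms by simp
qed

text \<open>Each step of the walk adds its \<open>edge_chain\<close>, and the boundaries telescope.
  The support condition makes it possible to close a walk up to a cycle that avoids prescribed
  edges.\<close>

lemma chain_of_path:
  assumes "(x, y) \<in> (adjacency A)\<^sup>*" "A \<subseteq> arcs G" "\<iota> ` A \<subseteq> A"
  shows "\<exists>c :: 'h \<Rightarrow> real. (\<forall>h. h \<notin> A \<longrightarrow> c h = 0) \<and> (\<forall>h\<in>arcs G. c (\<iota> h) = - c h) \<and>
    (\<forall>v. (\<Sum>h\<in>out_arcs G v. c h) = of_bool (x = v) - of_bool (y = v))"
  using assms(1)
proof (induction rule: rtrancl_induct)
  case base
  show ?case by (intro exI[of _ "\<lambda>_. 0"]) simp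
next
  case (step y w)
  then obtain h where h: "h \<in> A" "y = tail G h" "w = tail G (\<iota> h)"
    by (auto simp: adjacency_def)
  have hG: "h \<in> arcs G" using h assms by blast
  from step.IH obtain c :: "'h \<Rightarrow> real" where c: "\<And>h. h \<notin> A \<Longrightarrow> c h = 0" "\<And>h. h \<in> arcs G \<Longrightarrow> c (\<iota> h) = - c h"
    "\<And>v. (\<Sum>h\<in>out_arcs G v. c h) = of_bool (x = v) - of_bool (y = v)" by metis
  show ?case
  proof (intro exI[of _ "\<lambda>k. c k + edge_chain h k"] conjI allI ballI impI)
    fix k assume "k \<notin> A"
    then show "c k + edge_chain h k = 0"
      using c(1) h assms(3) by (auto simp: edge_chain_def)
  next
    fix k assume "k \<in> arcs G"
    then show "c (\<iota> k) + edge_chain h (\<iota> k) = - (c k + edge_chain h k)"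
      using c(2) by (auto simp: edge_chain_def arev_eq_iff)
  next
    fix v
    show "(\<Sum>k\<in>out_arcs G v. c k + edge_chain h k) = of_bool (x = v) - of_bool (w = v)"
      using c(3)[of v] sum_edge_chain[OF hG, of v] h by (simp add: sum.distrib)
  qed
qed

text \<open>Equivalently, no closed walk avoids the edges of \<open>S\<close>: erasing them leaves a forest.\<close>

definition determines :: "'h set \<Rightarrow> bool" where
  "determines S \<longleftrightarrow> (\<forall>c\<in>one_cycles G \<iota>. (\<forall>h\<in>S. c h = 0) \<longrightarrow> (\<forall>h. c h = 0))"

lemma determinesD:
  assumes "determines S" "c \<in> one_cycles G \<iota>" "\<And>h. h \<in> S \<Longrightarrow> c h = 0"
  shows "c h = 0"
  using assms unfolding determines_def by blast

abbreviation rest :: "'h set \<Rightarrow> 'h set" where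
  "rest S \<equiv> arcs G - (S \<union> \<iota> ` S)"

lemma rest_reverse: "h \<in> rest S \<Longrightarrow> \<iota> h \<in> rest S"
  by (auto simp: image_iff arev_eq_iff)

text \<open>Another walk between the ends of \<open>h\<close>, closed up by \<open>h\<close>, would
  be a cycle that vanishes on \<open>S\<close> but not at \<open>h\<close>.\<close>

lemma bridge:
  assumes S: "determines S" and h: "h \<in> rest S"
  shows "(tail G h, tail G (\<iota> h)) \<notin> (adjacency (rest S - {h, \<iota> h}))\<^sup>*"
proof
  let ?A = "rest S - {h, \<iota> h}"
  assume path: "(tail G h, tail G (\<iota> h)) \<in> (adjacency ?A)\<^sup>*"
  have "\<iota> ` ?A \<subseteq> ?A"
    using rest_reverse[of _ S] by (auto simp: arev_eq_iff simp del: Un_iff)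
  then obtain c :: "'h \<Rightarrow> real" where c: "\<And>k. k \<notin> ?A \<Longrightarrow> c k = 0" "\<And>k. k \<in> arcs G \<Longrightarrow> c (\<iota> k) = - c k"
    "\<And>v. (\<Sum>k\<in>out_arcs G v. c k) = of_bool (tail G h = v) - of_bool (tail G (\<iota> h) = v)"
    using chain_of_path[OF path] by blast
  have hG: "h \<in> arcs G" "\<iota> h \<in> arcs G" "h \<noteq> \<iota> h" using h arev_neq[of h] by auto
  let ?d = "\<lambda>k. c k - edge_chain h k"
  have "?d \<in> one_cycles G \<iota>"
    unfolding one_cycles_def mem_Collect_eq
  proof (intro conjI allI ballI impI)
    fix k assume "k \<notin> arcs G"
    then show "?d k = 0" using c(1)[of k] hG by (auto simp: edge_chain_def)
  next
    fix k assume "k \<in> arcs G"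
    then show "?d (\<iota> k) = - ?d k"
      using c(2) by (auto simp: edge_chain_def arev_eq_iff)
  next
    fix v
    show "(\<Sum>k\<in>out_arcs G v. ?d k) = 0"
      using c(3)[of v] sum_edge_chain[OF hG(1), of v] by (simp add: sum_subtractf)
  qed
  moreover have "?d k = 0" if "k \<in> S" for k
    using that c(1)[of k] h rest_reverse[OF h] by (auto simp: edge_chain_def)
  ultimately have "?d h = 0" using S by (auto simp: determines_def)
  then show False using c(1)[of h] hG by (simp add: edge_chain_def)
qed

text \<open>Every edge that remains after erasing \<open>S\<close> is a bridge of the remaining forest, so \<open>c h\<close> is determined
  by the values on \<open>S\<close> through the cut it defines.\<close>

lemma cycle_integral:
  assumes S: "determines S" and c: "c \<in> one_cycles G \<iota>" and int: "\<And>h. h \<in> S \<Longrightarrow> c h \<in> \<int>"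
  shows "c h \<in> \<int>"
proof (cases "h \<in> rest S")
  case False
  then consider "h \<notin> arcs G" | "h \<in> S" | s where "s \<in> S" "h = \<iota> s" by auto
  then show ?thesis
    using cycle_outside[OF c] int cycle_reverse[OF c] by cases auto
next
  case True
  let ?A = "rest S - {h, \<iota> h}"
  \<comment> \<open>\<open>W\<close> is the side of the bridge at the tail of \<open>h\<close>;
    apart from \<open>h\<close> itself, only edges with a half in \<open>S\<close> leave it.\<close>
  define W where "W = {v\<in>verts G. (tail G h, v) \<in> (adjacency ?A)\<^sup>*}"
  let ?X = "{k\<in>arcs G. tail G k \<in> W \<and> tail G (\<iota> k) \<notin> W}"
  have h: "h \<in> arcs G" "\<iota> h \<in> arcs G" using True by auto
  have "h \<in> ?X"
    using bridge[OF S True] h tail_in by (auto simp: W_def simp del: tail_arev)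
  have "c k \<in> \<int>" if k: "k \<in> ?X - {h}" for k
  proof (cases "k \<in> rest S")
    case False
    then consider "k \<in> S" | s where "s \<in> S" "k = \<iota> s" using k by auto
    then show ?thesis using int cycle_reverse[OF c] by cases auto
  next
    case in_rest: True
    have "k \<notin> ?A"
    proof
      assume "k \<in> ?A"
      then have "(tail G k, tail G (\<iota> k)) \<in> adjacency ?A" by (auto simp: adjacency_def)
      then have "tail G (\<iota> k) \<in> W"
        using k tail_in[of "\<iota> k"] by (auto simp: W_def intro: rtrancl_into_rtrancl simp del: tail_arev)
      then show False using k by blast
    qed
    then have "k = \<iota> h" using k in_rest by blast
    then have "tail G (\<iota> h) \<in> W" using k by blast
    then show ?thesis using \<open>h \<in> ?X\<close> by blast
  qed
  then have "(\<Sum>k\<in>?X - {h}. c k) \<in> \<int>" by (rule Ints_sum)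
  moreover have "c h = - (\<Sum>k\<in>?X - {h}. c k)"
  proof -
    have "W \<subseteq> verts G" by (auto simp: W_def)
    then have "sum c ?X = 0" by (rule cut_sum[OF c])
    moreover have "sum c ?X = c h + sum c (?X - {h})"
      using \<open>h \<in> ?X\<close> by (intro sum.remove) auto
    ultimately show ?thesis by (simp only:)
  qed
  ultimately show ?thesis by (simp only: Ints_minus)
qed

section \<open>Dual bases of the cycle space\<close>

lemma dual_basis_expand:
  assumes S: "determines S" "finite S" and z: "\<And>s. s \<in> S \<Longrightarrow> z s \<in> one_cycles G \<iota>"
    "\<And>s s'. s \<in> S \<Longrightarrow> s' \<in> S \<Longrightarrow> z s s' = of_bool (s = s')" and c: "c \<in> one_cycles G \<iota>"
  shows "c h = (\<Sum>s\<in>S. c s * z s h)"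
proof -
  let ?d = "\<lambda>h. c h - (\<Sum>s\<in>S. c s * z s h)"
  have d: "?d \<in> one_cycles G \<iota>" by (intro cycle_diff c cycle_sum z)
  have "?d h = 0"
  proof (rule determinesD[OF S(1) d])
    fix s' assume s': "s' \<in> S"
    have "(\<Sum>s\<in>S. c s * z s s') = (\<Sum>s\<in>S. if s = s' then c s else 0)"
      using z(2) s' by (intro sum.cong) auto
    then show "?d s' = 0" using S(2) s' by simp
  qed
  then show ?thesis by simp
qed

lemma dual_basis_card:
  assumes S: "determines S" "finite S" and z: "\<And>s. s \<in> S \<Longrightarrow> z s \<in> one_cycles G \<iota>"
    "\<And>s s'. s \<in> S \<Longrightarrow> s' \<in> S \<Longrightarrow> z s s' = of_bool (s = s')"
  shows "first_betti G \<iota> = card S"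
proof -
  interpret vs: vector_space "\<lambda>(a::real) (c :: 'h \<Rightarrow> real) h. a * c h" by (rule vector_space_chains)
  have apply_sum: "(\<Sum>i\<in>I. f i) h = (\<Sum>i\<in>I. f i h)" for I and f :: "'i \<Rightarrow> 'h \<Rightarrow> real" and h
    by (induction I rule: infinite_finite_induct) auto
  have inj: "inj_on z S"
  proof (rule inj_onI)
    fix s s' assume s: "s \<in> S" "s' \<in> S" "z s = z s'"
    have "of_bool (s' = s) = (1 :: real)"
      using z(2)[OF s(1,1)] z(2)[OF s(2,1)] unfolding s(3) by simp
    then show "s = s'" by (simp split: if_splits)
  qed
  have "vs.independent (z ` S)"
  proof (rule vs.independent_if_scalars_zero)
    fix f x assume eq: "(\<Sum>x\<in>z ` S. (\<lambda>h. f x * x h)) = 0" and "x \<in> z ` S"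
    then obtain s' where s': "s' \<in> S" "x = z s'" by blast
    have "0 = (\<Sum>x\<in>z ` S. (\<lambda>h. f x * x h)) s'"
      using fun_cong[OF eq, of s'] by (simp only: zero_fun_apply)
    also have "\<dots> = (\<Sum>s\<in>S. f (z s) * z s s')"
      unfolding apply_sum using inj by (simp add: sum.reindex)
    also have "\<dots> = (\<Sum>s\<in>S. if s = s' then f (z s) else 0)"
      using z(2) s' by (intro sum.cong) auto
    finally show "f x = 0" using S(2) s' by simp
  qed (use S in simp)
  moreover have "one_cycles G \<iota> \<subseteq> vs.span (z ` S)"
  proof
    fix c assume c: "c \<in> one_cycles G \<iota>"
    have "c = (\<Sum>s\<in>S. (\<lambda>h. c s * z s h))"
    proof
      fix h show "c h = (\<Sum>s\<in>S. (\<lambda>h. c s * z s h)) h"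
        unfolding apply_sum by (rule dual_basis_expand[OF S z c])
    qed
    also have "\<dots> \<in> vs.span (z ` S)"
      by (intro vs.span_sum vs.span_scale vs.span_base) auto
    finally show "c \<in> vs.span (z ` S)" .
  qed
  ultimately show ?thesis
    unfolding first_betti_def using z(1) card_image[OF inj] by (intro vs.dim_unique[of "z ` S"]) auto
qed

text \<open>In a minimal determining set every \<open>s\<close> has a nonzero cycle that vanishes on
  the others, hence not at \<open>s\<close>; scaling it to 1 there gives the dual cycle. This
  replaces the fundamental cycles of a spanning tree without choosing a tree.\<close>

lemma minimal_determines:
  assumes "determines S" "finite S"
  obtains S' z where "S' \<subseteq> S" "determines S'" "card S' = first_betti G \<iota>"
    "\<And>s. s \<in> S' \<Longrightarrow> z s \<in> one_cycles G \<iota>"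
    "\<And>s s'. s \<in> S' \<Longrightarrow> s' \<in> S' \<Longrightarrow> z s s' = of_bool (s = s')"
proof -
  obtain S' where S': "S' \<subseteq> S" "determines S'" "\<And>T. T \<subset> S' \<Longrightarrow> \<not> determines T"
  proof -
    have "\<exists>S'\<subseteq>S. determines S' \<and> (\<forall>T\<subset>S'. \<not> determines T)"
      using assms(2,1)
    proof (induction S rule: finite_psubset_induct)
      case (psubset S)
      show ?case
      proof (cases "\<exists>T\<subset>S. determines T")
        case True
        then obtain T where T: "T \<subset> S" "determines T" by blast
        from psubset.IH[OF this] show ?thesis using T(1) by (meson psubset_imp_subset subset_trans)
      next
        case False
        then show ?thesis using psubset.prems by (intro exI[of _ S]) simp
      qed
    qed
    then show ?thesis using that by blast
  qed
  have fin: "finite S'" using S'(1) assms(2) by (rule finite_subset)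
  have "\<exists>c\<in>one_cycles G \<iota>. \<forall>s'\<in>S'. c s' = of_bool (s = s')" if s: "s \<in> S'" for s
  proof -
    have "\<not> determines (S' - {s})" using S'(3) s by blast
    then obtain c where c: "c \<in> one_cycles G \<iota>" "\<And>t. t \<in> S' - {s} \<Longrightarrow> c t = 0" "\<exists>h. c h \<noteq> 0"
      by (auto simp: determines_def)
    then have "c s \<noteq> 0" using S'(2) by (auto simp: determines_def)
    moreover have "(\<lambda>h. \<Sum>i\<in>{()}. 1 / c s * c h) \<in> one_cycles G \<iota>" by (rule cycle_sum) (rule c)
    ultimately show ?thesis using c(2) by (intro bexI[of _ "\<lambda>h. 1 / c s * c h"]) auto
  qed
  then obtain z where z: "\<And>s. s \<in> S' \<Longrightarrow> z s \<in> one_cycles G \<iota>"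
    "\<And>s s'. s \<in> S' \<Longrightarrow> s' \<in> S' \<Longrightarrow> z s s' = of_bool (s = s')" by metis
  show ?thesis
    using that[OF S'(1,2) dual_basis_card[OF S'(2) fin z, symmetric] z] by simp
qed

text \<open>A minimal determining subset has as many elements as \<open>S\<close> itself, so nothing
  was removed.\<close>

lemma determines_dual_basis:
  assumes "determines S" "finite S" "card S = first_betti G \<iota>"
  obtains z where "\<And>s. s \<in> S \<Longrightarrow> z s \<in> one_cycles G \<iota>"
    "\<And>s s'. s \<in> S \<Longrightarrow> s' \<in> S \<Longrightarrow> z s s' = of_bool (s = s')"
proof -
  obtain S' z where *: "S' \<subseteq> S" "card S' = first_betti G \<iota>"
    "\<And>s. s \<in> S' \<Longrightarrow> z s \<in> one_cycles G \<iota>"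
    "\<And>s s'. s \<in> S' \<Longrightarrow> s' \<in> S' \<Longrightarrow> z s s' = of_bool (s = s')"
    using minimal_determines[OF assms(1,2)] by metis
  then have "S' = S" using assms by (intro card_subset_eq) auto
  then show ?thesis using that * by blast
qed

lemma determines_arcs: "determines (arcs G)"
  using cycle_outside by (force simp: determines_def)

end

section \<open>Vanishing, integrality and sign of determinants\<close>

lemma dt_eq_0_iff:
  "dt m A = 0 \<longleftrightarrow> (\<exists>x. (\<exists>j<m. x j \<noteq> 0) \<and> (\<forall>i<m. (\<Sum>j<m. A i j * x j) = 0))"
proof -
  let ?M = "Matrix.mat m m (\<lambda>(i, j). A i j)"
  have mult: "vec_index (?M *\<^sub>v Matrix.vec m x) i = (\<Sum>j<m. A i j * x j)" if "i < m" for x i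
    using that by (simp add: scalar_prod_def lessThan_atLeast0)
  have "dt m A = 0 \<longleftrightarrow> (\<exists>v. v \<in> carrier_vec m \<and> v \<noteq> 0\<^sub>v m \<and> ?M *\<^sub>v v = 0\<^sub>v m)"
    unfolding dt_eq_det by (rule Determinant.det_0_iff_vec_prod_zero_field) simp
  also have "\<dots> \<longleftrightarrow> (\<exists>x. (\<exists>j<m. x j \<noteq> 0) \<and> (\<forall>i<m. (\<Sum>j<m. A i j * x j) = 0))"
  proof
    assume "\<exists>v. v \<in> carrier_vec m \<and> v \<noteq> 0\<^sub>v m \<and> ?M *\<^sub>v v = 0\<^sub>v m"
    then obtain v where v: "v \<in> carrier_vec m" "v \<noteq> 0\<^sub>v m" "?M *\<^sub>v v = 0\<^sub>v m" by blast
    have vec: "Matrix.vec m (vec_index v) = v" using v(1) by (intro eq_vecI) auto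
    have "\<exists>j<m. vec_index v j \<noteq> 0" using v(1,2) by (metis carrier_vecD eq_vecI index_zero_vec)
    moreover have "(\<Sum>j<m. A i j * vec_index v j) = 0" if "i < m" for i
      using mult[OF that, of "vec_index v"] v(3) that unfolding vec by simp
    ultimately show "\<exists>x. (\<exists>j<m. x j \<noteq> 0) \<and> (\<forall>i<m. (\<Sum>j<m. A i j * x j) = 0)" by blast
  next
    assume "\<exists>x. (\<exists>j<m. x j \<noteq> 0) \<and> (\<forall>i<m. (\<Sum>j<m. A i j * x j) = 0)"
    then obtain x j where x: "j < m" "x j \<noteq> 0" "\<And>i. i < m \<Longrightarrow> (\<Sum>j<m. A i j * x j) = 0" by blast
    have "Matrix.vec m x \<noteq> 0\<^sub>v m" using x(1,2) by (metis index_vec index_zero_vec(1))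
    moreover have "?M *\<^sub>v Matrix.vec m x = 0\<^sub>v m"
      using mult[of _ x] x(3) by (intro eq_vecI) auto
    ultimately show "\<exists>v. v \<in> carrier_vec m \<and> v \<noteq> 0\<^sub>v m \<and> ?M *\<^sub>v v = 0\<^sub>v m"
      by (intro exI[of _ "Matrix.vec m x"]) auto
  qed
  finally show ?thesis .
qed

lemma dt_mult: "dt m (\<lambda>i k. \<Sum>j<m. A i j * B j k) = dt m A * dt m B"
proof -
  have "Matrix.mat m m (\<lambda>(i, j). A i j) * Matrix.mat m m (\<lambda>(i, j). B i j) =
      Matrix.mat m m (\<lambda>(i, k). \<Sum>j<m. A i j * B j k)"
    by (intro eq_matI) (auto simp: scalar_prod_def lessThan_atLeast0)
  then show ?thesis
    using Determinant.det_mult[of "Matrix.mat m m (\<lambda>(i, j). A i j)" m "Matrix.mat m m (\<lambda>(i, j). B i j)"]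
    by (simp add: dt_eq_det)
qed

lemma dt_identity: "dt m (\<lambda>i j. of_bool (i = j)) = 1"
proof -
  have "Matrix.mat m m (\<lambda>(i, j). of_bool (i = j)) = (1\<^sub>m m :: real mat)"
    by (intro eq_matI) auto
  then show ?thesis by (simp add: dt_eq_det)
qed

lemma dt_Ints:
  assumes "\<And>i j. i < m \<Longrightarrow> j < m \<Longrightarrow> A i j \<in> \<int>"
  shows "dt m A \<in> \<int>"
  unfolding dt_def
proof (intro Ints_sum Ints_mult Ints_prod)
  fix p i assume "p \<in> {p. p permutes {..<m}}" "i \<in> {..<m}"
  then show "A i (p i) \<in> \<int>"
    using assms permutes_in_image[of p "{..<m}" i] by simp
qed simp

text \<open>Both determinants are integers and their product is 1. The sign remains open, hence the
  square.\<close>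

lemma dt_unimodular:
  assumes "\<And>i j. i < m \<Longrightarrow> j < m \<Longrightarrow> A i j \<in> \<int>" "\<And>i j. i < m \<Longrightarrow> j < m \<Longrightarrow> B i j \<in> \<int>"
    and AB: "\<And>i k. i < m \<Longrightarrow> k < m \<Longrightarrow> (\<Sum>j<m. A i j * B j k) = of_bool (i = k)"
  shows "(dt m A)\<^sup>2 = 1"
proof -
  have "dt m A * dt m B = dt m (\<lambda>i j. of_bool (i = j))"
    unfolding dt_mult[symmetric] by (intro dt_cong AB)
  then have AB1: "dt m A * dt m B = 1" by (simp add: dt_identity)
  obtain a b :: int where ab: "dt m A = of_int a" "dt m B = of_int b"
    using dt_Ints[of m A] dt_Ints[of m B] assms(1,2) by (metis Ints_cases)
  have "a * b = 1" using AB1 unfolding ab by (metis of_int_eq_1_iff of_int_mult)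
  then have "a = 1 \<or> a = -1" by (metis zmult_eq_1_iff)
  then show ?thesis unfolding ab by auto
qed

text \<open>No matrix on the segment from \<open>A\<close> to the identity is singular, except perhaps \<open>A\<close>, because the
  quadratic form of \<open>A\<close> vanishes.\<close>

lemma dt_skew_nonneg:
  assumes skew: "\<And>i j. i < m \<Longrightarrow> j < m \<Longrightarrow> A i j = - A j i"
  shows "dt m A \<ge> 0"
proof (rule ccontr)
  let ?M = "\<lambda>s i j. s * of_bool (i = j) + (1 - s) * A i j"
  assume "\<not> dt m A \<ge> 0"
  then have "dt m (?M 0) \<le> 0" "dt m (?M 0) \<noteq> 0" by auto
  moreover have "dt m (?M 1) \<ge> 0" using dt_identity[of m] by simp
  moreover have "continuous_on {0..1} (\<lambda>s. dt m (?M s))"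
    unfolding dt_def by (intro continuous_intros)
  ultimately obtain s where s: "0 \<le> s" "s \<le> 1" "dt m (?M s) = 0"
    using IVT'[of "\<lambda>s. dt m (?M s)" 0 0 1] by auto
  with \<open>dt m (?M 0) \<noteq> 0\<close> have "s > 0" by (cases "s = 0") auto
  from s(3) obtain x k where x: "k < m" "x k \<noteq> 0" "\<And>i. i < m \<Longrightarrow> (\<Sum>j<m. ?M s i j * x j) = 0"
    unfolding dt_eq_0_iff by blast
  have row: "(\<Sum>j<m. ?M s i j * x j) = s * x i + (1 - s) * (\<Sum>j<m. A i j * x j)" if "i < m" for i
  proof -
    have "(\<Sum>j<m. ?M s i j * x j) = (\<Sum>j<m. (if j = i then s * x j else 0) + (1 - s) * (A i j * x j))"
      by (intro sum.cong) (auto simp: algebra_simps)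
    also have "\<dots> = s * x i + (1 - s) * (\<Sum>j<m. A i j * x j)"
      unfolding sum.distrib sum_distrib_left using that by simp
    finally show ?thesis .
  qed
  define q where "q = (\<Sum>i<m. \<Sum>j<m. x i * (A i j * x j))"
  have "q = (\<Sum>i<m. \<Sum>j<m. - (x j * (A j i * x i)))"
    unfolding q_def
  proof (intro sum.cong refl)
    fix i j assume "i \<in> {..<m}" "j \<in> {..<m}"
    then show "x i * (A i j * x j) = - (x j * (A j i * x i))" using skew[of i j] by simp
  qed
  also have "\<dots> = - q" unfolding q_def sum_negf by (subst sum.swap) simp
  finally have "q = 0" by simp
  have "0 = (\<Sum>i<m. x i * (\<Sum>j<m. ?M s i j * x j))" using x(3) by simp
  also have "\<dots> = (\<Sum>i<m. s * (x i)\<^sup>2 + (1 - s) * (\<Sum>j<m. x i * (A i j * x j)))"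
    using row by (intro sum.cong) (simp_all add: sum_distrib_left algebra_simps power2_eq_square)
  also have "\<dots> = s * (\<Sum>i<m. (x i)\<^sup>2) + (1 - s) * q"
    unfolding q_def by (simp only: sum.distrib sum_distrib_left)
  also have "\<dots> = s * (\<Sum>i<m. (x i)\<^sup>2)" using \<open>q = 0\<close> by simp
  finally have "(\<Sum>i<m. (x i)\<^sup>2) = 0" using \<open>s > 0\<close> by simp
  then have "(x k)\<^sup>2 = 0" using x(1) by (simp add: sum_nonneg_eq_0_iff)
  then show False using x(2) by simp
qed

text \<open>A basis of the lattice of integral cycles whose coordinates are the values at the
  half-edges \<open>e i\<close>. Integral cycles thus have integral coordinates, which makes the
  matrices below unimodular.\<close>

locale cycle_basis = ribbon_graph G \<iota>
  for G :: "('v, 'h) pre_digraph" and \<iota> :: "'h \<Rightarrow> 'h" +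
  fixes m :: nat and z :: "nat \<Rightarrow> 'h \<Rightarrow> real" and e :: "nat \<Rightarrow> 'h"
  assumes betti: "first_betti G \<iota> = m"
    and basis_cycle: "i < m \<Longrightarrow> z i \<in> one_cycles G \<iota>"
    and basis_dual: "i < m \<Longrightarrow> j < m \<Longrightarrow> z i (e j) = of_bool (i = j)"
    and basis_expand: "c \<in> one_cycles G \<iota> \<Longrightarrow> c h = (\<Sum>i<m. c (e i) * z i h)"
    and basis_Ints: "i < m \<Longrightarrow> z i h \<in> \<int>"
    and e_arcs: "i < m \<Longrightarrow> e i \<in> arcs G"

lemma (in ribbon_graph) ex_cycle_basis:
  obtains z e where "cycle_basis G \<iota> (first_betti G \<iota>) z e"
proof -
  let ?m = "first_betti G \<iota>"
  obtain S z where S: "S \<subseteq> arcs G" "determines S" "card S = ?m"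
    and z: "\<And>s. s \<in> S \<Longrightarrow> z s \<in> one_cycles G \<iota>"
    "\<And>s s'. s \<in> S \<Longrightarrow> s' \<in> S \<Longrightarrow> z s s' = of_bool (s = s')"
    using minimal_determines[OF determines_arcs finite_arcs] by metis
  have fin: "finite S" using S(1) finite_arcs by (rule finite_subset)
  obtain e where e: "bij_betw e {..<?m} S"
    using ex_bij_betw_nat_finite[OF fin] S(3) by (auto simp: lessThan_atLeast0)
  have eS: "e i \<in> S" if "i < ?m" for i using bij_betwE[OF e] that by blast
  have "cycle_basis G \<iota> ?m (\<lambda>i. z (e i)) e"
  proof unfold_locales
    fix i j assume ij: "i < ?m" "j < ?m"
    then show "z (e i) (e j) = of_bool (i = j)"
      using z(2)[OF eS eS] bij_betw_imp_inj_on[OF e] by (auto simp: inj_on_eq_iff)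
  next
    fix c h assume "c \<in> one_cycles G \<iota>"
    then have "c h = (\<Sum>s\<in>S. c s * z s h)"
      by (intro dual_basis_expand S fin z)
    then show "c h = (\<Sum>i<?m. c (e i) * z (e i) h)"
      using sum.reindex_bij_betw[OF e, of "\<lambda>s. c s * z s h"] by simp
  next
    fix i h assume i: "i < ?m"
    show "z (e i) h \<in> \<int>"
      by (rule cycle_integral[OF S(2) z(1)[OF eS[OF i]]]) (simp add: z(2)[OF eS[OF i]])
  next
    fix i assume "i < ?m"
    then show "e i \<in> arcs G" using eS S(1) by blast
  next
    fix i assume "i < ?m"
    then show "z (e i) \<in> one_cycles G \<iota>" by (intro z(1) eS)
  qed simp
  then show ?thesis by (rule that)
qed

text \<open>If \<open>S\<close> determines cycles, it carries an integral dual basis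
  \<open>w\<close> of its own, and the values of \<open>z\<close> on \<open>S\<close> and of
  \<open>w\<close> at the \<open>e j\<close> are inverse changes of basis. Otherwise the coordinates
  of a nonzero cycle vanishing on \<open>S\<close> form a kernel vector.\<close>

lemma (in cycle_basis) square_minor:
  assumes S: "S \<subseteq> arcs G" "card S = m" and t: "bij_betw t {..<m} S"
  shows "(dt m (\<lambda>i j. z j (t i)))\<^sup>2 = of_bool (determines S)"
proof (cases "determines S")
  case False
  then obtain c h where c: "c \<in> one_cycles G \<iota>" "\<And>s. s \<in> S \<Longrightarrow> c s = 0" "c h \<noteq> 0"
    unfolding determines_def by blast
  have "\<exists>j<m. c (e j) \<noteq> 0"
  proof (rule ccontr)
    assume "\<not> ?thesis"
    then have "c h = 0" unfolding basis_expand[OF c(1), of h] by (intro sum.neutral) auto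
    then show False using c(3) by simp
  qed
  moreover have "(\<Sum>j<m. z j (t i) * c (e j)) = 0" if "i < m" for i
    using basis_expand[OF c(1), of "t i"] c(2)[of "t i"] bij_betwE[OF t] that
    by (simp add: mult.commute)
  ultimately have "dt m (\<lambda>i j. z j (t i)) = 0"
    unfolding dt_eq_0_iff by (intro exI[of _ "\<lambda>j. c (e j)"]) blast
  then show ?thesis using False by simp
next
  case True
  have "finite S" using S(1) finite_arcs by (rule finite_subset)
  then obtain w where w: "\<And>s. s \<in> S \<Longrightarrow> w s \<in> one_cycles G \<iota>"
    "\<And>s s'. s \<in> S \<Longrightarrow> s' \<in> S \<Longrightarrow> w s s' = of_bool (s = s')"
    using determines_dual_basis[OF True] S(2) betti by metis
  have tS: "t i \<in> S" if "i < m" for i using bij_betwE[OF t] that by blast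
  have "(dt m (\<lambda>i j. z j (t i)))\<^sup>2 = 1"
  proof (rule dt_unimodular[where B = "\<lambda>j k. w (t k) (e j)"])
    show "z j (t i) \<in> \<int>" if "j < m" for i j using basis_Ints[OF that] .
    show "w (t k) (e j) \<in> \<int>" if "k < m" for j k
      by (rule cycle_integral[OF True w(1)[OF tS[OF that]]]) (simp add: w(2)[OF tS[OF that]])
    show "(\<Sum>j<m. z j (t i) * w (t k) (e j)) = of_bool (i = k)" if "i < m" "k < m" for i k
      using basis_expand[OF w(1)[OF tS[OF that(2)]], of "t i"] w(2)[OF tS tS, of k i] that
        bij_betw_imp_inj_on[OF t] by (auto simp: mult.commute inj_on_eq_iff)
  qed
  then show ?thesis using True by simp
qed

section \<open>The intersection form\<close>

definition cyclic_next :: "'a list \<Rightarrow> 'a \<Rightarrow> 'a" where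
  "cyclic_next xs h = xs ! (Suc (position xs h) mod length xs)"

lemma sum_before:
  assumes xs: "distinct xs" "set xs = K" "h \<in> K"
  shows "(\<Sum>h'\<in>K. of_bool (position xs h' < position xs h) * g h') = (\<Sum>i<position xs h. g (xs ! i) :: real)"
proof -
  have pos: "position xs h < length xs" using position_less_length xs by metis
  have "(\<Sum>h'\<in>K. of_bool (position xs h' < position xs h) * g h') =
      (\<Sum>i<length xs. of_bool (position xs (xs ! i) < position xs h) * g (xs ! i))"
    using sum.reindex_bij_betw[OF bij_betw_nth[OF xs(1) refl xs(2)[symmetric]]] by (rule sym)
  also have "\<dots> = (\<Sum>i<length xs. if i < position xs h then g (xs ! i) else 0)"
    using xs(1) by (intro sum.cong) (auto simp: position_nth)
  also have "\<dots> = (\<Sum>i\<in>{..<length xs} \<inter> {i. i < position xs h}. g (xs ! i))"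
    by (simp add: sum.If_cases)
  also have "{..<length xs} \<inter> {i. i < position xs h} = {..<position xs h}" using pos by auto
  finally show ?thesis .
qed

text \<open>The terms before \<open>h\<close> telescope, and the diagonal half averages the values
  of \<open>f\<close> on the two sides of \<open>h\<close>. The value at the first element is a
  constant of integration.\<close>

lemma order_form_telescope:
  assumes xs: "distinct xs" "set xs = K" "h \<in> K"
  shows "(\<Sum>h'\<in>K. order_form xs h' h * (f h' - f (cyclic_next xs h'))) = f (xs ! 0) - (f h + f (cyclic_next xs h)) / 2"
proof -
  let ?g = "\<lambda>h. f h - f (cyclic_next xs h)"
  have pos: "position xs h < length xs" using position_less_length xs by metis
  have fin: "finite K" using xs(2) by blast
  have "(\<Sum>h'\<in>K. order_form xs h' h * ?g h') =
      (\<Sum>h'\<in>K. of_bool (position xs h' < position xs h) * ?g h') + (\<Sum>h'\<in>K. if h' = h then ?g h' / 2 else 0)"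
    unfolding sum.distrib[symmetric] by (intro sum.cong) (auto simp: order_form_def)
  also have "(\<Sum>h'\<in>K. if h' = h then ?g h' / 2 else 0) = ?g h / 2"
    using fin xs(3) by simp
  also have "(\<Sum>h'\<in>K. of_bool (position xs h' < position xs h) * ?g h') = (\<Sum>i<position xs h. ?g (xs ! i))"
    by (rule sum_before[OF xs])
  also have "\<dots> = (\<Sum>i<position xs h. f (xs ! i) - f (xs ! Suc i))"
    using pos xs(1) by (intro sum.cong) (auto simp: cyclic_next_def position_nth)
  also have "\<dots> = f (xs ! 0) - f h"
    using sum_lessThan_telescope'[of "\<lambda>i. f (xs ! i)"] nth_position xs by metis
  finally show ?thesis by (simp add: field_simps)
qed

text \<open>The potential is minus the sum of the earlier values. It closes up when the order wraps
  around from the last element to the first because the total is zero.\<close>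

lemma potential_exists:
  assumes xs: "distinct xs" "set xs = K" and d: "(\<Sum>h\<in>K. d h) = 0" and h: "h \<in> K"
  shows "d h = - (\<Sum>i<position xs h. d (xs ! i)) - - (\<Sum>i<position xs (cyclic_next xs h). d (xs ! i) :: real)"
proof -
  have pos: "position xs h < length xs" using position_less_length xs h by metis
  have nth: "xs ! position xs h = h" using nth_position xs h by metis
  show ?thesis
  proof (cases "Suc (position xs h) < length xs")
    case True
    then have "position xs (cyclic_next xs h) = Suc (position xs h)"
      using xs(1) by (simp add: cyclic_next_def position_nth)
    then show ?thesis using nth by simp
  next
    case False
    then have last: "length xs = Suc (position xs h)" using pos by simp
    have "(\<Sum>i<length xs. d (xs ! i)) = 0"
      using sum.reindex_bij_betw[OF bij_betw_nth[OF xs(1) refl xs(2)[symmetric]], of d] d by simp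
    then have "(\<Sum>i<position xs h. d (xs ! i)) + d h = 0" using nth unfolding last by simp
    moreover have "position xs (cyclic_next xs h) = 0"
      using xs(1) position_nth[of xs 0] pos by (simp add: cyclic_next_def last)
    ultimately show ?thesis by simp
  qed
qed

section \<open>The form attached to an embedding\<close>

context ribbon_graph
begin

definition vertex_orders :: "('v \<Rightarrow> 'h list) set" where
  "vertex_orders = PiE (verts G) (\<lambda>v. permutations_of_set (out_arcs G v))"

definition flow :: "('v \<Rightarrow> 'h list) \<Rightarrow> ('h \<Rightarrow> real) \<Rightarrow> 'h \<Rightarrow> real" where
  "flow L c h = (\<Sum>h'\<in>out_arcs G (tail G h). order_form (L (tail G h)) h' h * c h')"

text \<open>The intersection form of the surface: each vertex contributes the crossings of the two cycles
  at that vertex, read off a linear order that refines the cyclic order there. On cycles the choice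
  of the refinement is irrelevant.\<close>

definition intersection :: "('v \<Rightarrow> 'h list) \<Rightarrow> ('h \<Rightarrow> real) \<Rightarrow> ('h \<Rightarrow> real) \<Rightarrow> real" where
  "intersection L c d = (\<Sum>h\<in>arcs G. c h * flow L d h)"

definition refines :: "('v \<Rightarrow> 'h list) \<Rightarrow> ('h \<Rightarrow> 'h) \<Rightarrow> bool" where
  "refines L \<rho> \<longleftrightarrow> L \<in> vertex_orders \<and> \<rho> \<in> embeddings G \<and>
    (\<forall>h\<in>arcs G. \<rho> h = cyclic_next (L (tail G h)) h)"

lemma vertex_order:
  assumes "L \<in> vertex_orders" "v \<in> verts G"
  shows "distinct (L v)" "set (L v) = out_arcs G v"
  using PiE_mem[OF assms(1)[unfolded vertex_orders_def] assms(2)]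
  by (auto simp: permutations_of_set_def)

lemma sum_arcs: "(\<Sum>h\<in>arcs G. g h) = (\<Sum>v\<in>verts G. \<Sum>h\<in>out_arcs G v. g h)"
proof -
  have "{h\<in>arcs G. tail G h \<in> verts G} = arcs G" by auto
  then show ?thesis using sum_arcs_by_tail[OF order_refl, of g] by simp
qed

lemma intersection_sum_right:
  "intersection L c (\<lambda>h. \<Sum>j\<in>J. k j * d j h) = (\<Sum>j\<in>J. k j * intersection L c (d j))"
proof -
  have "flow L (\<lambda>h. \<Sum>j\<in>J. k j * d j h) h = (\<Sum>j\<in>J. k j * flow L (d j) h)" for h
    unfolding flow_def sum_distrib_left by (subst sum.swap) (simp add: mult_ac)
  then show ?thesis
    by (simp only: intersection_def sum_distrib_left) (subst sum.swap, simp only: mult.left_commute)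
qed

text \<open>\<open>order_form\<close> plus its transpose is constantly 1, so the symmetric part
  contributes at each vertex a product of two sums that vanish for cycles.\<close>

lemma intersection_skew:
  assumes L: "L \<in> vertex_orders" and c: "c \<in> one_cycles G \<iota>" and d: "d \<in> one_cycles G \<iota>"
  shows "intersection L c d = - intersection L d c"
proof -
  have form: "order_form xs h h' + order_form xs h' h = 1" if "h \<in> set xs" "h' \<in> set xs" for xs and h h' :: 'h
  proof (cases "h = h'")
    case False
    then have "position xs h \<noteq> position xs h'" using inj_onD[OF inj_on_position, of xs h h'] that by blast
    then show ?thesis using False by (cases "position xs h < position xs h'") (simp_all add: order_form_def)
  qed (simp add: order_form_def)
  have eq: "intersection L c d =
      (\<Sum>v\<in>verts G. \<Sum>h\<in>out_arcs G v. \<Sum>h'\<in>out_arcs G v. order_form (L v) h' h * (c h * d h'))" for c d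
    unfolding intersection_def sum_arcs flow_def
    by (intro sum.cong refl) (auto simp: sum_distrib_left mult_ac)
  have "intersection L c d + intersection L d c = 0"
    unfolding eq
  proof (subst sum.distrib[symmetric], rule sum.neutral, rule ballI)
    fix v assume v: "v \<in> verts G"
    let ?K = "out_arcs G v"
    have "(\<Sum>h\<in>?K. \<Sum>h'\<in>?K. order_form (L v) h' h * (d h * c h')) =
        (\<Sum>h\<in>?K. \<Sum>h'\<in>?K. order_form (L v) h h' * (c h * d h'))"
      by (subst sum.swap) (simp add: mult_ac)
    then have "(\<Sum>h\<in>?K. \<Sum>h'\<in>?K. order_form (L v) h' h * (c h * d h')) +
        (\<Sum>h\<in>?K. \<Sum>h'\<in>?K. order_form (L v) h' h * (d h * c h')) =
        (\<Sum>h\<in>?K. \<Sum>h'\<in>?K. (order_form (L v) h' h + order_form (L v) h h') * (c h * d h'))"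
      by (simp add: sum.distrib distrib_right)
    also have "\<dots> = (\<Sum>h\<in>?K. \<Sum>h'\<in>?K. c h * d h')"
      using form vertex_order(2)[OF L v] by (intro sum.cong) auto
    also have "\<dots> = (\<Sum>h\<in>?K. c h) * (\<Sum>h'\<in>?K. d h')"
      by (rule sum_product[symmetric])
    also have "\<dots> = 0" using cycle_vertex[OF c v] by simp
    finally show "(\<Sum>h\<in>?K. \<Sum>h'\<in>?K. order_form (L v) h' h * (c h * d h')) +
        (\<Sum>h\<in>?K. \<Sum>h'\<in>?K. order_form (L v) h' h * (d h * c h')) = 0" .
  qed
  then show ?thesis by simp
qed

lemma embedding_permutes: "\<rho> \<in> embeddings G \<Longrightarrow> \<rho> permutes arcs G"
  by (simp add: embeddings_def)

lemma embedding_cyclic: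
  assumes "\<rho> \<in> embeddings G" "h \<in> arcs G"
  shows "cyclic_on \<rho> (out_arcs G (tail G h))"
proof -
  have "h \<in> out_arcs G (tail G h)" using assms(2) by simp
  then show ?thesis using assms tail_in unfolding embeddings_def by blast
qed

lemma tail_embedding:
  assumes "\<rho> \<in> embeddings G" "h \<in> arcs G"
  shows "tail G (\<rho> h) = tail G h"
  using cyclic_on_inI[OF embedding_cyclic[OF assms], of h] assms(2) by simp

lemma sum_out_arcs_embedding:
  assumes "\<rho> \<in> embeddings G"
  shows "(\<Sum>h\<in>out_arcs G v. f (\<rho> h)) = (\<Sum>h\<in>out_arcs G v. f h)"
proof (rule sum.reindex_bij_betw)
  have "inj_on \<rho> (out_arcs G v)"
    using permutes_inj[OF embedding_permutes[OF assms]] by (rule inj_on_subset) simp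
  moreover have "\<rho> ` out_arcs G v \<subseteq> out_arcs G v"
    using tail_embedding[OF assms] permutes_in_image[OF embedding_permutes[OF assms]]
    by (auto simp: out_arcs_def)
  ultimately show "bij_betw \<rho> (out_arcs G v) (out_arcs G v)"
    unfolding bij_betw_def using endo_inj_surj[OF finite_out_arcs] by blast
qed

text \<open>Here \<open>f h\<close> is a value on the corner before \<open>h\<close>, and
  \<open>d h\<close> is its jump across \<open>h\<close>. By \<open>order_form_telescope\<close>
  each vertex contributes the value at its first corner minus the mean of the two corners at
  \<open>h\<close>. The first is constant at the vertex and drops out against a cycle, and with it
  the choice of the refinement.\<close>

lemma intersection_boundary:
  assumes L: "refines L \<rho>" and c: "c \<in> one_cycles G \<iota>" and d: "\<And>h. h \<in> arcs G \<Longrightarrow> d h = f h - f (\<rho> h)"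
  shows "intersection L c d = - (\<Sum>h\<in>arcs G. c h * (f h + f (\<rho> h))) / 2"
proof -
  have L': "L \<in> vertex_orders" "\<And>h. h \<in> arcs G \<Longrightarrow> \<rho> h = cyclic_next (L (tail G h)) h"
    using L by (auto simp: refines_def)
  have "intersection L c d = (\<Sum>v\<in>verts G. \<Sum>h\<in>out_arcs G v. c h * f (L v ! 0) - c h * (f h + f (\<rho> h)) / 2)"
    unfolding intersection_def sum_arcs
  proof (intro sum.cong refl)
    fix v h assume v: "v \<in> verts G" and h: "h \<in> out_arcs G v"
    then have t: "tail G h = v" "h \<in> arcs G" by auto
    have "flow L d h = (\<Sum>h'\<in>out_arcs G v. order_form (L v) h' h * (f h' - f (cyclic_next (L v) h')))"
      unfolding flow_def t(1) using d L'(2) by (intro sum.cong) auto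
    also have "\<dots> = f (L v ! 0) - (f h + f (cyclic_next (L v) h)) / 2"
      by (rule order_form_telescope[OF vertex_order[OF L'(1) v] h])
    also have "cyclic_next (L v) h = \<rho> h" using L'(2)[OF t(2)] t(1) by simp
    finally show "c h * flow L d h = c h * f (L v ! 0) - c h * (f h + f (\<rho> h)) / 2"
      by (simp only: right_diff_distrib times_divide_eq_right)
  qed
  also have "\<dots> = (\<Sum>v\<in>verts G. \<Sum>h\<in>out_arcs G v. - (c h * (f h + f (\<rho> h)) / 2))"
    unfolding sum_subtractf sum_distrib_right[symmetric] using cycle_vertex[OF c]
    by (simp add: sum_negf)
  also have "\<dots> = - (\<Sum>h\<in>arcs G. c h * (f h + f (\<rho> h))) / 2"
    unfolding sum_arcs[symmetric] by (simp add: sum_negf sum_divide_distrib)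
  finally show ?thesis .
qed

text \<open>The two halves of an edge contribute equally, so half the sum is a sum over
  edges.\<close>

lemma sum_symmetric_Ints:
  assumes "\<And>h. h \<in> arcs G \<Longrightarrow> g h \<in> \<int>" "\<And>h. h \<in> arcs G \<Longrightarrow> g (\<iota> h) = (g h :: real)"
  shows "(\<Sum>h\<in>arcs G. g h) / 2 \<in> \<int>"
proof -
  let ?E = "\<lambda>h. {h, \<iota> h}"
  have "(\<Sum>h\<in>{x\<in>arcs G. ?E x = ?E h}. g h) / 2 = g h" if h: "h \<in> arcs G" for h
  proof -
    have "{x\<in>arcs G. ?E x = ?E h} = {h, \<iota> h}" using h by (auto simp: doubleton_eq_iff arev_eq_iff)
    then show ?thesis using assms(2)[OF h] arev_neq[OF h] by simp
  qed
  then have "(\<Sum>h\<in>{x\<in>arcs G. ?E x = E}. g h) / 2 \<in> \<int>" if "E \<in> ?E ` arcs G" for E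
    using that assms(1) by auto
  moreover have "(\<Sum>h\<in>arcs G. g h) / 2 = (\<Sum>E\<in>?E ` arcs G. (\<Sum>h\<in>{x\<in>arcs G. ?E x = E}. g h) / 2)"
    unfolding sum_divide_distrib[symmetric] by (subst sum.image_gen[OF finite_arcs, of g ?E]) simp
  ultimately show ?thesis by (simp add: Ints_sum)
qed

text \<open>Despite the halves in \<open>order_form\<close>: with an integral potential
  \<open>f\<close> the form is half the sum of \<open>c h * d h\<close> minus the sum of
  \<open>c h * f h\<close>. The product \<open>c h * d h\<close> is even under
  \<open>\<iota>\<close>, so its half sum is integral too.\<close>

lemma intersection_Ints:
  assumes L: "refines L \<rho>" and c: "c \<in> one_cycles G \<iota>" "\<And>h. c h \<in> \<int>" and d: "d \<in> one_cycles G \<iota>" "\<And>h. d h \<in> \<int>"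
  shows "intersection L c d \<in> \<int>"
proof -
  define f where "f h = - (\<Sum>i<position (L (tail G h)) h. d (L (tail G h) ! i))" for h
  have L': "L \<in> vertex_orders" "\<And>h. h \<in> arcs G \<Longrightarrow> \<rho> h = cyclic_next (L (tail G h)) h" "\<rho> \<in> embeddings G"
    using L by (auto simp: refines_def)
  have fd: "d h = f h - f (\<rho> h)" if h: "h \<in> arcs G" for h
    using potential_exists[OF vertex_order[OF L'(1) tail_in[OF h]] cycle_vertex[OF d(1) tail_in[OF h]], of h] h
    unfolding f_def tail_embedding[OF L'(3) h] L'(2)[OF h, symmetric] by simp
  have f: "f h \<in> \<int>" for h unfolding f_def by (intro Ints_minus Ints_sum d(2))
  have "intersection L c d = - (\<Sum>h\<in>arcs G. c h * (f h + f (\<rho> h))) / 2"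
    by (rule intersection_boundary[where f = f, OF L c(1)]) (rule fd)
  also have "(\<Sum>h\<in>arcs G. c h * (f h + f (\<rho> h))) = (\<Sum>h\<in>arcs G. 2 * (c h * f h) - c h * d h)"
  proof (rule sum.cong)
    fix h assume "h \<in> arcs G"
    then have eq: "f (\<rho> h) = f h - d h" using fd[of h] by simp
    show "c h * (f h + f (\<rho> h)) = 2 * (c h * f h) - c h * d h"
      unfolding eq by (simp add: algebra_simps)
  qed simp
  also have "- \<dots> / 2 = (\<Sum>h\<in>arcs G. c h * d h) / 2 - (\<Sum>h\<in>arcs G. c h * f h)"
    by (simp add: sum_subtractf sum_distrib_left[symmetric])
  also have "\<dots> \<in> \<int>"
    using c d f cycle_reverse[OF c(1)] cycle_reverse[OF d(1)] by (intro Ints_diff sum_symmetric_Ints Ints_sum Ints_mult) auto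
  finally show ?thesis .
qed

section \<open>Faces and the determinant of the form\<close>

lemma face_permutes: "\<rho> \<in> embeddings G \<Longrightarrow> (\<rho> \<circ> \<iota>) permutes arcs G"
  by (rule permutes_compose[OF arev_permutes_arcs embedding_permutes])

lemma one_faced_iff:
  assumes \<rho>: "\<rho> \<in> embeddings G" and "arcs G \<noteq> {}"
  shows "one_faced G \<iota> \<rho> \<longleftrightarrow> (\<forall>h\<in>arcs G. orbit (\<rho> \<circ> \<iota>) h = arcs G)"
proof
  let ?s = "\<rho> \<circ> \<iota>"
  assume "one_faced G \<iota> \<rho>"
  then obtain O' where O': "orbit ?s ` arcs G = {O'}"
    using assms(2) by (auto simp: one_faced_def faces_def card_1_singleton_iff)
  have eq: "orbit ?s h = O'" if "h \<in> arcs G" for h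
    using that O' by (metis imageI singletonD)
  have sub: "orbit ?s h \<subseteq> arcs G" if "h \<in> arcs G" for h
    by (rule permutes_orbit_subset[OF face_permutes[OF \<rho>] that])
  have self: "h \<in> orbit ?s h" for h
    by (rule permutation_self_in_orbit[OF permutes_imp_permutation[OF finite_arcs face_permutes[OF \<rho>]]])
  show "\<forall>h\<in>arcs G. orbit ?s h = arcs G"
  proof
    fix h assume h: "h \<in> arcs G"
    have "arcs G \<subseteq> orbit ?s h"
    proof
      fix x assume "x \<in> arcs G"
      then show "x \<in> orbit ?s h" using self[of x] unfolding eq[OF h] by (simp only: eq)
    qed
    then show "orbit ?s h = arcs G" using sub[OF h] by (rule subset_antisym[rotated])
  qed
next
  assume "\<forall>h\<in>arcs G. orbit (\<rho> \<circ> \<iota>) h = arcs G"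
  then have "orbit (\<rho> \<circ> \<iota>) ` arcs G = {arcs G}" using assms(2) by auto
  then show "one_faced G \<iota> \<rho>" using assms(2) by (simp add: one_faced_def faces_def)
qed

text \<open>The indicator function of one of several faces is a potential whose boundary is a nonzero
  cycle in the radical of the intersection form.\<close>

lemma radical_of_many_faces:
  assumes L: "refines L \<rho>" and "\<not> one_faced G \<iota> \<rho>"
  obtains d where "d \<in> one_cycles G \<iota>" "\<exists>h. d h \<noteq> 0"
    "\<And>c. c \<in> one_cycles G \<iota> \<Longrightarrow> intersection L c d = 0"
proof -
  let ?s = "\<rho> \<circ> \<iota>"
  have \<rho>: "\<rho> \<in> embeddings G" using L by (simp add: refines_def)
  have ne: "arcs G \<noteq> {}" using assms(2) by (auto simp: one_faced_def faces_def)
  obtain h0 where h0: "h0 \<in> arcs G" "orbit ?s h0 \<noteq> arcs G"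
    using assms(2) one_faced_iff[OF \<rho> ne] by blast
  define F where "F = orbit ?s h0"
  have F: "F \<subseteq> arcs G" "F \<noteq> arcs G"
    using permutes_orbit_subset[OF face_permutes[OF \<rho>] h0(1)] h0(2) by (auto simp: F_def)
  have cyc: "cyclic_on ?s F"
    unfolding F_def by (rule cyclic_on_orbit[OF face_permutes[OF \<rho>] finite_arcs])
  have sF: "?s y \<in> F \<longleftrightarrow> y \<in> F" for y
    using cyclic_on_f_in[OF face_permutes[OF \<rho>] cyc] cyclic_on_inI[OF cyc] by blast
  define f where "f h = (of_bool (h \<in> F) :: real)" for h
  \<comment> \<open>The face permutation sends \<open>\<iota> h\<close> to \<open>\<rho> h\<close>,
    so both lie in \<open>F\<close> or neither does. The jump of \<open>f\<close> across
    \<open>h\<close> is therefore odd under \<open>\<iota>\<close> as well.\<close>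
  have f\<rho>: "f (\<rho> h) = f (\<iota> h)" for h
    using sF[of "\<iota> h"] by (simp add: f_def)
  define d where "d h = f h - f (\<iota> h)" for h
  have fd: "d h = f h - f (\<rho> h)" for h by (simp add: d_def f\<rho>)
  have "d h = 0" if "h \<notin> arcs G" for h using arev_eq[OF that] by (simp add: d_def)
  moreover have "(\<Sum>h\<in>out_arcs G v. d h) = 0" for v
    unfolding fd sum_subtractf by (simp add: sum_out_arcs_embedding[OF \<rho>, of f])
  ultimately have d: "d \<in> one_cycles G \<iota>" by (simp add: one_cycles_def) (simp add: d_def)
  have "intersection L c d = 0" if c: "c \<in> one_cycles G \<iota>" for c
  proof -
    have "(\<Sum>h\<in>arcs G. c h * f (\<iota> h)) = (\<Sum>h\<in>arcs G. c (\<iota> h) * f (\<iota> (\<iota> h)))"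
      by (rule sum_reverse[symmetric])
    also have "\<dots> = - (\<Sum>h\<in>arcs G. c h * f h)"
      using cycle_reverse[OF c] by (simp add: sum_negf)
    finally have "(\<Sum>h\<in>arcs G. c h * (f h + f (\<rho> h))) = 0"
      by (simp add: f\<rho> distrib_left sum.distrib)
    then show ?thesis using intersection_boundary[where f = f, OF L c fd] by simp
  qed
  \<comment> \<open>If \<open>d\<close> were zero, \<open>F\<close> would be invariant under both
    \<open>\<iota>\<close> and \<open>\<rho>\<close>: it would contain all half-edges at each vertex
    it meets and, by connectedness, all of them.\<close>
  moreover have "\<exists>h. d h \<noteq> 0"
  proof (rule ccontr)
    assume "\<nexists>h. d h \<noteq> 0"
    then have d0: "d h = 0" for h by blast
    have "f (\<iota> h) = f h" "f (\<rho> h) = f h" for h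
      using d0[of h] fd[of h] unfolding d_def by simp_all
    then have inv: "\<iota> h \<in> F \<longleftrightarrow> h \<in> F" "\<rho> h \<in> F \<longleftrightarrow> h \<in> F" for h
      unfolding f_def of_bool_eq_iff by blast+
    have vertex: "x \<in> F" if h: "h \<in> F" and x: "x \<in> arcs G" "tail G x = tail G h" for h x
    proof -
      have "orbit \<rho> h = out_arcs G (tail G h)"
        using orbit_cyclic_eq3[OF embedding_cyclic[OF \<rho>, of h], of h] h F(1) by auto
      then have "x \<in> orbit \<rho> h" using x by simp
      then show "x \<in> F" by induction (use inv h in auto)
    qed
    have W: "tail G ` F = verts G"
    proof (rule connected_closed)
      show "tail G ` F \<subseteq> verts G" using F(1) tail_in by blast
      show "tail G ` F \<noteq> {}" unfolding F_def using orbit_nonempty[of ?s h0] by simp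
      fix h assume h: "h \<in> arcs G" "tail G h \<in> tail G ` F"
      then have "h \<in> F" using vertex by force
      then show "tail G (\<iota> h) \<in> tail G ` F" using inv(1) by blast
    qed
    have "arcs G \<subseteq> F"
    proof
      fix h assume h: "h \<in> arcs G"
      then have "tail G h \<in> tail G ` F" using W tail_in by simp
      then show "h \<in> F" using vertex h by force
    qed
    then show False using F by blast
  qed
  ultimately show ?thesis using that[OF d] by blast
qed

text \<open>If there is only one face, the face walk from a half-edge to its reverse is a potential
  whose boundary is Poincare dual to that half-edge.\<close>

lemma dual_cycle_of_one_face:
  assumes L: "refines L \<rho>" and one: "one_faced G \<iota> \<rho>" and h: "h \<in> arcs G"
  obtains d where "d \<in> one_cycles G \<iota>" "\<And>x. d x \<in> \<int>"
    "\<And>c. c \<in> one_cycles G \<iota> \<Longrightarrow> intersection L c d = c h"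
proof -
  let ?s = "\<rho> \<circ> \<iota>"
  have \<rho>: "\<rho> \<in> embeddings G" using L by (simp add: refines_def)
  have inj: "inj ?s" by (rule permutes_inj[OF face_permutes[OF \<rho>]])
  have "arcs G \<noteq> {}" using h by blast
  then have "orbit ?s h = arcs G" using one_faced_iff[OF \<rho>] one h by blast
  then have "\<iota> h \<in> orbit ?s h" using arev_in_arcs[OF h] by simp
  then have "\<exists>n. (?s ^^ n) h = \<iota> h" unfolding orbit_altdef by auto
  define p where "p = (LEAST n. (?s ^^ n) h = \<iota> h)"
  have p: "(?s ^^ p) h = \<iota> h" "\<And>n. n < p \<Longrightarrow> (?s ^^ n) h \<noteq> \<iota> h"
    unfolding p_def by (rule LeastI_ex, fact) (rule not_less_Least)
  \<comment> \<open>The half-edges met on the face walk after leaving \<open>h\<close>, up to and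
    including \<open>\<iota> h\<close>. Since \<open>p\<close> is least, the walk does not pass
    \<open>h\<close> again in between.\<close>
  define A where "A = (\<lambda>i. (?s ^^ i) h) ` {1..p}"
  have "p \<noteq> 0" using p(1) arev_neq[OF h] by (metis funpow_0)
  have hA: "h \<notin> A"
  proof
    assume "h \<in> A"
    then obtain i where i: "1 \<le> i" "i \<le> p" "(?s ^^ i) h = h" by (auto simp: A_def)
    have "(?s ^^ p) h = (?s ^^ (p - i + i)) h" using i by simp
    also have "\<dots> = (?s ^^ (p - i)) ((?s ^^ i) h)" by (simp only: funpow_add o_apply)
    finally show False using p(1) p(2)[of "p - i"] i by simp
  qed
  have shA: "?s h \<in> A" using \<open>p \<noteq> 0\<close> by (auto simp: A_def intro!: image_eqI[of _ _ 1])
  have rA: "\<iota> h \<in> A" using \<open>p \<noteq> 0\<close> p(1) by (auto simp: A_def intro!: image_eqI[of _ _ p])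
  have srA: "?s (\<iota> h) \<notin> A"
  proof
    assume "?s (\<iota> h) \<in> A"
    then obtain i where i: "1 \<le> i" "i \<le> p" "?s (\<iota> h) = (?s ^^ i) h" by (auto simp: A_def)
    then obtain k where k: "i = Suc k" by (cases i) auto
    have "?s (\<iota> h) = ?s ((?s ^^ k) h)" using i(3) k by simp
    then have "\<iota> h = (?s ^^ k) h" by (rule injD[OF inj])
    then show False using p(2)[of k] k i by simp
  qed
  have sA: "?s y \<in> A \<longleftrightarrow> y \<in> A" if y: "y \<noteq> h" "y \<noteq> \<iota> h" for y
  proof
    assume "y \<in> A"
    then obtain i where i: "1 \<le> i" "i \<le> p" "y = (?s ^^ i) h" by (auto simp: A_def)
    then have "i \<noteq> p" using y(2) p(1) by auto
    then show "?s y \<in> A" using i by (auto simp: A_def intro!: image_eqI[of _ _ "Suc i"])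
  next
    assume "?s y \<in> A"
    then obtain i where i: "1 \<le> i" "i \<le> p" "?s y = (?s ^^ i) h" by (auto simp: A_def)
    then obtain k where k: "i = Suc k" by (cases i) auto
    have "?s y = ?s ((?s ^^ k) h)" using i(3) k by simp
    then have "y = (?s ^^ k) h" by (rule injD[OF inj])
    moreover from this have "k \<noteq> 0" using y(1) by (metis funpow_0)
    ultimately show "y \<in> A" using i k by (auto simp: A_def)
  qed
  define f where "f x = (of_bool (x \<in> A) :: real)" for x
  \<comment> \<open>One step of the face permutation enters \<open>A\<close> only from
    \<open>h\<close> and leaves it only from \<open>\<iota> h\<close>.\<close>
  have fs: "f (?s y) - f y = edge_chain h y" for y
    using hA shA rA srA sA[of y] arev_neq[OF h] by (cases "y = h"; cases "y = \<iota> h") (auto simp: f_def edge_chain_def)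
  have f\<rho>: "f (\<rho> x) = f (\<iota> x) - edge_chain h x" for x
    using fs[of "\<iota> x"] by (auto simp: edge_chain_def arev_eq_iff)
  \<comment> \<open>Written in this way \<open>d\<close> is odd under \<open>\<iota>\<close>; by the
    formula for \<open>f (\<rho> x)\<close> it is also the jump \<open>f x - f (\<rho> x)\<close>,
    whose sum at every vertex is zero. Being both, it is a cycle.\<close>
  define d where "d x = f x - f (\<iota> x) + edge_chain h x" for x
  have fd: "d x = f x - f (\<rho> x)" for x by (simp add: d_def f\<rho>)
  have "d x = 0" if "x \<notin> arcs G" for x
    using arev_eq[OF that] h arev_in_arcs[OF h] that by (auto simp: d_def edge_chain_def)
  moreover have "d (\<iota> x) = - d x" for x by (simp add: d_def edge_chain_def arev_eq_iff)
  moreover have "(\<Sum>x\<in>out_arcs G v. d x) = 0" for v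
    unfolding fd sum_subtractf by (simp add: sum_out_arcs_embedding[OF \<rho>, of f])
  ultimately have d: "d \<in> one_cycles G \<iota>" by (simp add: one_cycles_def)
  have "d x \<in> \<int>" for x by (simp add: d_def f_def edge_chain_def)
  moreover have "intersection L c d = c h" if c: "c \<in> one_cycles G \<iota>" for c
  proof -
    have "(\<Sum>x\<in>arcs G. c x * f (\<iota> x)) = (\<Sum>x\<in>arcs G. c (\<iota> x) * f (\<iota> (\<iota> x)))"
      by (rule sum_reverse[symmetric])
    also have "\<dots> = - (\<Sum>x\<in>arcs G. c x * f x)"
      using cycle_reverse[OF c] by (simp add: sum_negf)
    finally have 1: "(\<Sum>x\<in>arcs G. c x * f x) + (\<Sum>x\<in>arcs G. c x * f (\<iota> x)) = 0" by simp
    have "(\<Sum>x\<in>arcs G. c x * edge_chain h x) = (\<Sum>x\<in>arcs G. (if x = h then c x else 0) - (if x = \<iota> h then c x else 0))"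
      by (intro sum.cong) (auto simp: edge_chain_def)
    also have "\<dots> = c h - c (\<iota> h)" unfolding sum_subtractf using h arev_in_arcs[OF h] by simp
    also have "\<dots> = 2 * c h" using cycle_reverse[OF c, of h] by simp
    finally have 2: "(\<Sum>x\<in>arcs G. c x * edge_chain h x) = 2 * c h" .
    have "(\<Sum>x\<in>arcs G. c x * (f x + f (\<rho> x))) = - (2 * c h)"
      unfolding f\<rho> distrib_left right_diff_distrib sum.distrib sum_subtractf using 1 2 by simp
    then show ?thesis using intersection_boundary[where f = f, OF L c fd] by simp
  qed
  ultimately show ?thesis using that[OF d] by blast
qed

end

lemma (in cycle_basis) det_intersection:
  assumes L: "refines L \<rho>"
  shows "dt m (\<lambda>i j. intersection L (z i) (z j)) = of_bool (one_faced G \<iota> \<rho>)"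
proof (cases "one_faced G \<iota> \<rho>")
  case False
  then obtain d x where d: "d \<in> one_cycles G \<iota>" "d x \<noteq> 0"
    "\<And>c. c \<in> one_cycles G \<iota> \<Longrightarrow> intersection L c d = 0"
    using radical_of_many_faces[OF L] by metis
  have "\<exists>j<m. d (e j) \<noteq> 0"
  proof (rule ccontr)
    assume "\<not> ?thesis"
    then have "d x = 0" unfolding basis_expand[OF d(1), of x] by (intro sum.neutral) auto
    then show False using d(2) by simp
  qed
  moreover have "(\<Sum>j<m. intersection L (z i) (z j) * d (e j)) = 0" if "i < m" for i
  proof -
    have "(\<Sum>j<m. intersection L (z i) (z j) * d (e j)) = intersection L (z i) (\<lambda>h. \<Sum>j<m. d (e j) * z j h)"
      unfolding intersection_sum_right by (simp add: mult.commute)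
    also have "(\<lambda>h. \<Sum>j<m. d (e j) * z j h) = d"
      using basis_expand[OF d(1)] by (intro ext) (rule sym)
    finally show ?thesis using d(3)[OF basis_cycle[OF that]] by simp
  qed
  ultimately have "dt m (\<lambda>i j. intersection L (z i) (z j)) = 0"
    unfolding dt_eq_0_iff by (intro exI[of _ "\<lambda>j. d (e j)"]) blast
  then show ?thesis using False by simp
next
  case True
  have "\<forall>k\<in>{..<m}. \<exists>d. d \<in> one_cycles G \<iota> \<and> (\<forall>x. d x \<in> \<int>) \<and>
      (\<forall>c\<in>one_cycles G \<iota>. intersection L c d = c (e k))"
    using dual_cycle_of_one_face[OF L True e_arcs] by (metis lessThan_iff)
  then obtain d where d: "\<And>k. k < m \<Longrightarrow> d k \<in> one_cycles G \<iota>" "\<And>k x. k < m \<Longrightarrow> d k x \<in> \<int>"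
    "\<And>k c. k < m \<Longrightarrow> c \<in> one_cycles G \<iota> \<Longrightarrow> intersection L c (d k) = c (e k)"
    by (metis lessThan_iff)
  let ?D = "dt m (\<lambda>i j. intersection L (z i) (z j))"
  have "?D\<^sup>2 = 1"
  \<comment> \<open>The coordinates of the dual cycles form an integral inverse of the matrix of the
    form.\<close>
  proof (rule dt_unimodular[where B = "\<lambda>j k. d k (e j)"])
    show "intersection L (z i) (z j) \<in> \<int>" if "i < m" "j < m" for i j
      using that basis_cycle basis_Ints by (intro intersection_Ints[OF L])
    show "d k (e j) \<in> \<int>" if "k < m" for j k by (rule d(2)[OF that])
    fix i k assume ik: "i < m" "k < m"
    have "(\<Sum>j<m. intersection L (z i) (z j) * d k (e j)) = intersection L (z i) (\<lambda>h. \<Sum>j<m. d k (e j) * z j h)"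
      unfolding intersection_sum_right by (simp add: mult.commute)
    also have "(\<lambda>h. \<Sum>j<m. d k (e j) * z j h) = d k"
      using basis_expand[OF d(1)[OF ik(2)]] by (intro ext) (rule sym)
    also have "intersection L (z i) (d k) = z i (e k)" by (rule d(3)[OF ik(2) basis_cycle[OF ik(1)]])
    also have "\<dots> = of_bool (i = k)" by (rule basis_dual[OF ik])
    finally show "(\<Sum>j<m. intersection L (z i) (z j) * d k (e j)) = of_bool (i = k)" .
  qed
  moreover have "?D \<ge> 0"
  proof (rule dt_skew_nonneg)
    have "L \<in> vertex_orders" using L by (simp add: refines_def)
    then show "intersection L (z i) (z j) = - intersection L (z j) (z i)" if "i < m" "j < m" for i j
      using that basis_cycle by (intro intersection_skew)
  qed
  ultimately show ?thesis using True by (simp add: power2_eq_1_iff)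
qed

section \<open>Contractibility\<close>

text \<open>Two logarithms of one function differ by integer multiples of
  \<open>2 * pi * \<i>\<close>. Distinct multiples are at least \<open>2 * pi\<close> apart, so the
  continuous difference is constant.\<close>

lemma log_change_unique:
  fixes g g' :: "real \<Rightarrow> complex"
  assumes "continuous_on {0..1} g" "continuous_on {0..1} g'"
    and eq: "\<And>t. t \<in> {0..1} \<Longrightarrow> exp (g t) = exp (g' t)"
  shows "g 1 - g 0 = g' 1 - g' 0"
proof -
  let ?d = "\<lambda>t. g t - g' t"
  have "?d constant_on {0..1}"
  proof (rule continuous_discrete_range_constant)
    show "continuous_on {0..1} ?d" by (intro continuous_intros assms)
    fix x :: real assume x: "x \<in> {0..1}"
    show "\<exists>e>0. \<forall>y. y \<in> {0..1} \<and> ?d y \<noteq> ?d x \<longrightarrow> e \<le> norm (?d y - ?d x)"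
    proof (intro exI[of _ "2 * pi"] conjI allI impI)
      fix y assume y: "y \<in> {0..1} \<and> ?d y \<noteq> ?d x"
      have "exp (?d y) = 1" "exp (?d x) = 1" using eq[of x] eq[of y] x y by (simp_all add: exp_diff)
      then have "exp (?d y - ?d x) = 1" by (simp only: exp_diff) simp
      then obtain n :: int where n: "Re (?d y - ?d x) = 0" "Im (?d y - ?d x) = of_int (2 * n) * pi"
        unfolding exp_eq_1 by blast
      have "n \<noteq> 0"
      proof
        assume "n = 0"
        then have "?d y - ?d x = 0" using n by (intro complex_eqI) simp_all
        then show False using y by simp
      qed
      then have "1 \<le> \<bar>real_of_int n\<bar>" by linarith
      then have "2 * pi \<le> \<bar>Im (?d y - ?d x)\<bar>"
        unfolding n(2) by (simp add: abs_mult)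
      also have "\<dots> \<le> norm (?d y - ?d x)" by (rule abs_Im_le_cmod)
      finally show "2 * pi \<le> norm (?d y - ?d x)" .
    qed simp
  qed simp
  then obtain c where c: "\<And>t. t \<in> {0..1} \<Longrightarrow> ?d t = c" by (auto simp: constant_on_def)
  have "?d 1 = ?d 0" using c[of 0] c[of 1] by simp
  then show ?thesis by (simp add: algebra_simps)
qed

text \<open>On a contractible space the change of argument of a nowhere vanishing function along a path
  depends only on the endpoints: lift along the contraction.\<close>

lemma contractible_log_change:
  fixes f :: "'a \<Rightarrow> complex"
  assumes R: "contractible_space R" and f: "continuous_map R euclidean f" and nz: "\<And>x. x \<in> topspace R \<Longrightarrow> f x \<noteq> 0"
  obtains N where "\<And>q g. pathin R q \<Longrightarrow> continuous_on {0..1} g \<Longrightarrow>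
    (\<And>t. t \<in> {0..1} \<Longrightarrow> f (q t) = exp (g t)) \<Longrightarrow> g 1 - g 0 = N (q 1) - N (q 0)"
proof -
  let ?I = "top_of_set {0..1::real}"
  obtain a where "homotopic_with (\<lambda>x. True) R R id (\<lambda>x. a)"
    using R unfolding contractible_space_def by blast
  then obtain H where H: "continuous_map (prod_topology ?I R) R H" "\<And>x. H (0, x) = x" "\<And>x. H (1, x) = a"
    unfolding homotopic_with_def by auto
  \<comment> \<open>\<open>N x\<close> is the change of the logarithm of \<open>f\<close> along the
    track of \<open>x\<close> under the contraction, travelled from \<open>a\<close> back to
    \<open>x\<close>; by \<open>log_change_unique\<close> it does not depend on the logarithm
    used.\<close>
  define N where "N x = (SOME w. \<exists>g. continuous_on {0..1} g \<and> (\<forall>s\<in>{0..1}. f (H (s, x)) = exp (g s)) \<and> w = g 0 - g 1)" for x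
  have N: "N x = g 0 - g 1" if "continuous_on {0..1} g" "\<And>s. s \<in> {0..1} \<Longrightarrow> f (H (s, x)) = exp (g s)" for x g
    unfolding N_def
  proof (rule some_equality)
    fix w assume "\<exists>g. continuous_on {0..1} g \<and> (\<forall>s\<in>{0..1}. f (H (s, x)) = exp (g s)) \<and> w = g 0 - g 1"
    then obtain g' where g': "continuous_on {0..1} g'" "\<And>s. s \<in> {0..1} \<Longrightarrow> f (H (s, x)) = exp (g' s)" "w = g' 0 - g' 1"
      by blast
    have "g' 1 - g' 0 = g 1 - g 0"
      using g'(2) that(2) by (intro log_change_unique g'(1) that(1)) (metis)
    then show "w = g 0 - g 1" unfolding g'(3) by (metis minus_diff_eq)
  qed (use that in blast)
  show ?thesis
  proof (rule that)
    fix q g assume q: "pathin R q" and g: "continuous_on {0..1} g" "\<And>t. t \<in> {0..1} \<Longrightarrow> f (q t) = exp (g t)"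
    have qc: "continuous_map ?I R q" using q by (simp add: pathin_def)
    have "continuous_map (prod_topology ?I ?I) (prod_topology ?I R) (\<lambda>p. (fst p, q (snd p)))"
      unfolding continuous_map_pairwise o_def
      using continuous_map_compose[OF continuous_map_snd qc, of ?I] continuous_map_fst[of ?I ?I]
      by (simp add: o_def)
    from continuous_map_compose[OF this continuous_map_compose[OF H(1) f]]
    have "continuous_map (prod_topology ?I ?I) euclidean (\<lambda>p. f (H (fst p, q (snd p))))"
      by (simp add: o_def)
    then have cont: "continuous_on ({0..1} \<times> {0..1}) (\<lambda>p. f (H (fst p, q (snd p))))"
      unfolding prod_topology_subtopology_eu by simp
    have nz': "f (H (fst p, q (snd p))) \<noteq> 0" if p: "p \<in> {0..1} \<times> {0..1}" for p
    proof (rule nz)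
      have "q (snd p) \<in> topspace R" using continuous_map_funspace[OF qc] p by auto
      then show "H (fst p, q (snd p)) \<in> topspace R"
        using continuous_map_funspace[OF H(1)] p by (auto simp: Pi_iff)
    qed
    have "contractible ({0..1::real} \<times> {0..1::real})"
      by (intro convex_imp_contractible convex_Times) simp_all
    then obtain l where l: "continuous_on ({0..1} \<times> {0..1}) l"
      "\<And>p. p \<in> {0..1} \<times> {0..1} \<Longrightarrow> f (H (fst p, q (snd p))) = exp (l p)"
      using continuous_logarithm_on_contractible[OF cont _ nz'] by blast
    have lt: "continuous_on {0..1} (\<lambda>t. l (s, t))" if "s \<in> {0..1}" for s
      by (rule continuous_on_compose2[OF l(1)]) (use that in \<open>auto intro!: continuous_intros\<close>)
    have ls: "continuous_on {0..1} (\<lambda>s. l (s, t))" if "t \<in> {0..1}" for t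
      by (rule continuous_on_compose2[OF l(1)]) (use that in \<open>auto intro!: continuous_intros\<close>)
    \<comment> \<open>The changes of \<open>l\<close> along the sides of the square are compared:
      the side at 0 carries the path \<open>q\<close>, the two sides joining it to the opposite one
      carry the tracks of its endpoints, and the side at 1 is constantly \<open>a\<close>.\<close>
    have 1: "g 1 - g 0 = l (0, 1) - l (0, 0)"
    proof (rule log_change_unique[OF g(1) lt])
      fix t :: real assume "t \<in> {0..1}"
      then show "exp (g t) = exp (l (0, t))" using g(2)[of t] l(2)[of "(0, t)"] H(2) by simp
    qed simp
    have 2: "N (q t) = l (0, t) - l (1, t)" if t: "t \<in> {0..1}" for t
    proof (rule N[OF ls[OF t]])
      fix s :: real assume "s \<in> {0..1}"
      then show "f (H (s, q t)) = exp (l (s, t))" using l(2)[of "(s, t)"] t by simp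
    qed
    have 3: "l (1, 1) - l (1, 0) = l (1, 0) - l (1, 0)"
    proof (rule log_change_unique[OF lt])
      fix t :: real assume t: "t \<in> {0..1}"
      show "exp (l (1, t)) = exp (l (1, 0))"
        using l(2)[of "(1, t)"] l(2)[of "(1, 0)"] t H(3) by simp
    qed auto
    show "g 1 - g 0 = N (q 1) - N (q 0)"
      unfolding 1 using 2[of 0] 2[of 1] 3 by simp
  qed
qed

section \<open>Winding along an edge that carries a cycle\<close>

context ribbon_graph
begin

abbreviation half :: "'h \<Rightarrow> real \<Rightarrow> ('v, 'h) point" where
  "half \<equiv> half_edge_point G \<iota>"

abbreviation remaining_points :: "'h set \<Rightarrow> ('v, 'h) point set" where
  "remaining_points S \<equiv> graph_points G \<iota> - (\<Union>h\<in>S. half h ` {0<..1})"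

lemma half_eq_iff:
  assumes "t \<in> {0..1}" "u \<in> {0<..1}"
  shows "half h t = half k u \<longleftrightarrow> t = u \<and> (h = k \<or> (u = 1 \<and> h = \<iota> k))"
  using assms by (auto simp: half_edge_point_def doubleton_eq_iff)

lemma half_in_graph_points: "h \<in> arcs G \<Longrightarrow> t \<in> {0..1} \<Longrightarrow> half h t \<in> graph_points G \<iota>"
  unfolding graph_points_def by blast

lemma half_0: "half h 0 = Vertex (tail G h)"
  by (simp add: half_edge_point_def)

lemma half_1_reverse: "half (\<iota> h) 1 = half h 1"
  by (auto simp: half_edge_point_def)

lemma graph_points_cases:
  assumes "x \<in> graph_points G \<iota>"
  obtains v where "v \<in> verts G" "x = Vertex v" | h t where "h \<in> arcs G" "t \<in> {0<..1}" "x = half h t"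
proof -
  from assms consider v where "v \<in> verts G" "x = Vertex v" | h t where "h \<in> arcs G" "t \<in> {0..1}" "x = half h t"
    by (auto simp: graph_points_def)
  then show ?thesis
  proof cases
    case (2 h t)
    then show ?thesis
      using that(1)[of "tail G h"] that(2)[of h t] tail_in half_0 by (cases "t = 0") auto
  qed (use that in blast)
qed

lemma continuous_half: "h \<in> arcs G \<Longrightarrow> continuous_map (top_of_set {0..1}) (graph_space G \<iota>) (half h)"
  unfolding continuous_map_def openin_graph_space topspace_graph_space
  by (auto simp: half_in_graph_points)

text \<open>The universal property of the quotient topology.\<close>

lemma continuous_map_from_graph_space:
  fixes f :: "('v, 'h) point \<Rightarrow> 'c :: topological_space"
  assumes "\<And>h. h \<in> arcs G \<Longrightarrow> continuous_on {0..1} (\<lambda>t. f (half h t))"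
  shows "continuous_map (graph_space G \<iota>) euclidean f"
  unfolding continuous_map_def
proof (intro conjI allI impI)
  fix U :: "'c set" assume U: "openin euclidean U"
  show "openin (graph_space G \<iota>) {x \<in> topspace (graph_space G \<iota>). f x \<in> U}"
    unfolding openin_graph_space topspace_graph_space
  proof (intro conjI ballI)
    fix h assume h: "h \<in> arcs G"
    have "{t \<in> {0..1}. half h t \<in> {x \<in> graph_points G \<iota>. f x \<in> U}} = {t \<in> {0..1}. f (half h t) \<in> U}"
      using half_in_graph_points[OF h] by auto
    moreover have "openin (top_of_set {0..1}) {t \<in> topspace (top_of_set {0..1}). f (half h t) \<in> U}"
      using assms[OF h] U by (intro openin_continuous_map_preimage[where Y = euclidean]) simp_all
    ultimately show "openin (top_of_set {0..1}) {t \<in> {0..1}. half h t \<in> {x \<in> graph_points G \<iota>. f x \<in> U}}"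
      by simp
  qed auto
qed simp

lemma path_half:
  assumes h: "h \<in> arcs G" "h \<notin> S" "\<iota> h \<notin> S"
  shows "pathin (remaining_space G \<iota> S) (half h)"
  unfolding pathin_def remaining_space_def
proof (rule continuous_map_into_subtopology[OF continuous_half[OF h(1)]])
  show "half h \<in> topspace (top_of_set {0..1}) \<rightarrow> remaining_points S"
  proof
    fix t assume "t \<in> topspace (top_of_set {0..1::real})"
    then have t: "t \<in> {0..1}" by simp
    have "half h t \<noteq> half k u" if "k \<in> S" "u \<in> {0<..1}" for k u
      using half_eq_iff[OF t that(2)] h that arev_arev by metis
    then show "half h t \<in> remaining_points S"
      using half_in_graph_points[OF h(1) t] by blast
  qed
qed

text \<open>Winds once around the circle along the edge of \<open>h0\<close> and is constant elsewhere.\<close>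

definition circle_map :: "'h \<Rightarrow> ('v, 'h) point \<Rightarrow> complex" where
  "circle_map h0 x = (case x of Vertex v \<Rightarrow> 1
     | Interior h t \<Rightarrow> if h = h0 then exp (\<i> * (pi * t)) else if h = \<iota> h0 then exp (- (\<i> * (pi * t))) else 1
     | Midpoint E \<Rightarrow> if E = {h0, \<iota> h0} then -1 else 1)"

lemma circle_map_half:
  assumes "h0 \<in> arcs G" "t \<in> {0..1}"
  shows "circle_map h0 (half h t) =
    (if h = h0 then exp (\<i> * (pi * t)) else if h = \<iota> h0 then exp (- (\<i> * (pi * t))) else 1)"
proof -
  have "exp (- (\<i> * complex_of_real pi)) = -1"
    by (simp add: exp_minus)
  then show ?thesis
    using arev_neq[OF assms(1)]
    by (auto simp: circle_map_def half_edge_point_def doubleton_eq_iff)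
qed

text \<open>If a nonzero cycle \<open>c\<close> vanishes on \<open>S\<close>, an edge with
  \<open>c h0 \<noteq> 0\<close> lies on a closed walk of the remaining space; otherwise there would
  be a cut on which \<open>c\<close> is nonzero at \<open>h0\<close> alone, against
  \<open>cut_sum\<close>. Around that walk the argument of \<open>circle_map h0\<close> changes by
  \<open>2 * pi\<close>, which contradicts path independence.\<close>

lemma contractible_imp_determines:
  assumes con: "contractible_space (remaining_space G \<iota> S)"
  shows "determines S"
proof (rule ccontr)
  assume "\<not> determines S"
  then obtain c h0 where c: "c \<in> one_cycles G \<iota>" "\<And>h. h \<in> S \<Longrightarrow> c h = 0" "c h0 \<noteq> 0"
    unfolding determines_def by blast
  have h0: "h0 \<in> arcs G" "h0 \<notin> S" "\<iota> h0 \<notin> S" "\<iota> h0 \<in> arcs G"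
    using c(2,3) cycle_outside[OF c(1)] cycle_reverse[OF c(1), of h0] by force+
  let ?R = "remaining_space G \<iota> S" and ?S' = "S \<union> {h0, \<iota> h0}"
  let ?R' = "remaining_space G \<iota> ?S'"
  have top: "topspace (remaining_space G \<iota> T) = remaining_points T" for T
    by (simp add: remaining_space_def topspace_graph_space Int_absorb1)
  \<comment> \<open>The vertices still reachable from the tail of \<open>h0\<close> when the edge of
    \<open>h0\<close> is erased as well.\<close>
  define K where "K = {v\<in>verts G. path_component_of ?R' (Vertex (tail G h0)) (Vertex v)}"
  let ?X = "{k\<in>arcs G. tail G k \<in> K \<and> tail G (\<iota> k) \<notin> K}"
  have h0K: "tail G h0 \<in> K"
  proof -
    have "Vertex (tail G h0) \<in> remaining_points ?S'"
      using tail_in[OF h0(1)] by (auto simp: graph_points_def half_edge_point_def)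
    then show ?thesis using tail_in[OF h0(1)] by (simp add: K_def path_component_of_refl top)
  qed
  have zero: "c k = 0" if k: "k \<in> ?X" "k \<noteq> h0" for k
  proof (rule ccontr)
    assume ck: "c k \<noteq> 0"
    then have k': "k \<notin> S" "\<iota> k \<notin> S" using c(2) cycle_reverse[OF c(1), of k] by force+
    have "k \<noteq> \<iota> h0" using k h0K by auto
    then have "k \<notin> ?S'" "\<iota> k \<notin> ?S'" using k k' by (auto simp: arev_eq_iff)
    moreover from this have "\<iota> k \<notin> ?S'" "\<iota> (\<iota> k) \<notin> ?S'" by auto
    ultimately have "pathin ?R' (half k)" "pathin ?R' (half (\<iota> k))"
      using k(1) by (auto intro!: path_half)
    then have "path_component_of ?R' (half k 0) (half k 1)" "path_component_of ?R' (half (\<iota> k) 0) (half (\<iota> k) 1)"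
      unfolding path_component_of_def by blast+
    then have edge: "path_component_of ?R' (Vertex (tail G k)) (Vertex (tail G (\<iota> k)))"
      unfolding half_0 half_1_reverse by (rule path_component_of_trans[OF _ path_component_of_sym])
    have "path_component_of ?R' (Vertex (tail G h0)) (Vertex (tail G k))" "tail G (\<iota> k) \<in> verts G"
      using k(1) tail_in[of "\<iota> k"] arev_in_arcs[of k] unfolding K_def by blast+
    then have "tail G (\<iota> k) \<in> K"
      unfolding K_def using path_component_of_trans[OF _ edge] by blast
    then show False using k(1) by blast
  qed
  have rK: "tail G (\<iota> h0) \<in> K"
  proof (rule ccontr)
    assume "tail G (\<iota> h0) \<notin> K"
    then have "h0 \<in> ?X" using h0 h0K by blast
    then have "sum c ?X = c h0 + sum c (?X - {h0})" by (intro sum.remove) auto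
    also have "sum c (?X - {h0}) = 0" using zero by (intro sum.neutral) blast
    also have "sum c ?X = 0" by (rule cut_sum[OF c(1)]) (auto simp: K_def)
    finally show False using c(3) by simp
  qed
  then obtain q where q: "pathin ?R' q" "q 0 = Vertex (tail G h0)" "q 1 = Vertex (tail G (\<iota> h0))"
    unfolding K_def path_component_of_def by auto
  let ?f = "circle_map h0"
  have fR: "continuous_map ?R euclidean ?f"
    unfolding remaining_space_def
  proof (intro continuous_map_from_subtopology continuous_map_from_graph_space)
    fix h assume "h \<in> arcs G"
    have "continuous_on {0..1} (\<lambda>t. if h = h0 then exp (\<i> * (pi * t)) else if h = \<iota> h0 then exp (- (\<i> * (pi * t))) else 1)"
      by (cases "h = h0"; cases "h = \<iota> h0") (auto intro!: continuous_intros)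
    then show "continuous_on {0..1} (\<lambda>t. ?f (half h t))"
      by (rule continuous_on_eq) (simp add: circle_map_half[OF h0(1)])
  qed
  have f0: "?f x \<noteq> 0" for x
    by (cases x) (auto simp: circle_map_def)
  obtain N where N: "\<And>q g. pathin ?R q \<Longrightarrow> continuous_on {0..1} g \<Longrightarrow>
    (\<And>t. t \<in> {0..1} \<Longrightarrow> ?f (q t) = exp (g t)) \<Longrightarrow> g 1 - g 0 = N (q 1) - N (q 0)"
    using contractible_log_change[OF con fR f0] by metis
  \<comment> \<open>The two halves of the edge run from its ends to the common midpoint and turn the
    argument by \<open>pi\<close> in opposite directions; along the detour \<open>q\<close> the map
    is constantly 1.\<close>
  have 1: "\<i> * pi = N (half h0 1) - N (Vertex (tail G h0))"
    using N[OF path_half[of h0 S], of "\<lambda>t. \<i> * (pi * t)"] h0 circle_map_half[OF h0(1)]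
    by (simp add: half_0 continuous_intros)
  have 2: "- (\<i> * pi) = N (half h0 1) - N (Vertex (tail G (\<iota> h0)))"
    using N[OF path_half[of "\<iota> h0" S], of "\<lambda>t. - (\<i> * (pi * t))"] h0 circle_map_half[OF h0(1)] arev_neq[OF h0(1)]
    by (simp add: half_0 half_1_reverse continuous_intros)
  have 3: "0 = N (Vertex (tail G (\<iota> h0))) - N (Vertex (tail G h0))"
  proof -
    have qc: "continuous_map (top_of_set {0..1}) ?R' q" using q(1) by (simp add: pathin_def)
    have q': "q t \<in> remaining_points ?S'" if t: "t \<in> {0..1}" for t
    proof -
      have "q t \<in> topspace ?R'"
        using t by (intro Pi_mem[OF continuous_map_funspace[OF qc]]) simp
      then show ?thesis unfolding top .
    qed
    have "pathin ?R q"
      unfolding pathin_def remaining_space_def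
    proof (rule continuous_map_into_subtopology)
      show "continuous_map (top_of_set {0..1}) (graph_space G \<iota>) q"
        using qc unfolding remaining_space_def by (rule continuous_map_into_fulltopology)
      show "q \<in> topspace (top_of_set {0..1}) \<rightarrow> remaining_points S" using q' by auto
    qed
    moreover have "?f (q t) = exp 0" if t: "t \<in> {0..1}" for t
    proof -
      have "q t \<in> graph_points G \<iota>" using q'[OF t] by blast
      then show ?thesis
      proof (cases rule: graph_points_cases)
        case (1 v)
        then show ?thesis by (simp add: circle_map_def)
      next
        case (2 h u)
        then have "h \<noteq> h0" "h \<noteq> \<iota> h0" using q'[OF t] by blast+
        then show ?thesis using 2 circle_map_half[OF h0(1), of u h] by simp
      qed
    qed
    ultimately show ?thesis using N[of q "\<lambda>_. 0"] q(2,3) by simp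
  qed
  have "2 * (\<i> * complex_of_real pi) = 0"
    using 1 2 3 by (simp add: algebra_simps)
  then show False by simp
qed

end

section \<open>Gluing half-edges onto contractible pieces\<close>

lemma contractible_space_homotopic_retraction:
  assumes C: "contractible_space (subtopology X C)" and X: "topspace X = C \<union> P"
    and hom: "homotopic_with (\<lambda>_. True) X X id r" and r: "\<And>x. x \<in> topspace X \<Longrightarrow> r x \<in> C"
  shows "contractible_space X"
proof -
  obtain a where a: "homotopic_with (\<lambda>_. True) (subtopology X C) (subtopology X C) id (\<lambda>_. a)"
    using C unfolding contractible_space_def by blast
  have rX: "continuous_map X (subtopology X C) r"
    using homotopic_with_imp_continuous_maps[OF hom] r by (auto intro: continuous_map_into_subtopology)
  have "homotopic_with (\<lambda>_. True) (subtopology X C) X (id \<circ> id) (id \<circ> (\<lambda>_. a))"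
    by (rule homotopic_with_compose_continuous_map_left[OF a]) (simp_all add: continuous_map_from_subtopology)
  then have "homotopic_with (\<lambda>_. True) X X (id \<circ> id \<circ> r) (id \<circ> (\<lambda>_. a) \<circ> r)"
    by (rule homotopic_with_compose_continuous_map_right[OF _ rX]) simp
  then have "homotopic_with (\<lambda>_. True) X X r (\<lambda>_. a)" by (simp add: o_def)
  then have "homotopic_with (\<lambda>_. True) X X id (\<lambda>_. a)" by (rule homotopic_with_trans[OF hom])
  then show ?thesis unfolding contractible_space_def by blast
qed

context ribbon_graph
begin

text \<open>The parameter is well defined on points because gluing only identifies points of equal
  parameter. The retraction of a half-edge can thus be written as a function of points.\<close>

definition height :: "('v, 'h) point \<Rightarrow> real" where
  "height x = (case x of Vertex v \<Rightarrow> 0 | Interior h t \<Rightarrow> t | Midpoint E \<Rightarrow> 1)"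

lemma height_half: "height (half h t) = t"
  by (simp add: height_def half_edge_point_def)

lemma continuous_height: "continuous_map (graph_space G \<iota>) euclideanreal height"
  by (rule continuous_map_from_graph_space) (simp add: height_half)

text \<open>A half-edge attached at one point deformation retracts to that point.\<close>

lemma attach_half_edge:
  assumes h: "h \<in> arcs G" and I: "I \<subseteq> {0..1}" "convex I" "a \<in> I"
    and C: "C \<subseteq> graph_points G \<iota>" "contractible_space (subtopology (graph_space G \<iota>) C)"
    and CP: "C \<inter> half h ` I = {half h a}"
    and closed: "closedin (subtopology (graph_space G \<iota>) (C \<union> half h ` I)) C"
      "closedin (subtopology (graph_space G \<iota>) (C \<union> half h ` I)) (half h ` I)"
  shows "contractible_space (subtopology (graph_space G \<iota>) (C \<union> half h ` I))"
proof -
  let ?P = "half h ` I"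
  define X where "X = subtopology (graph_space G \<iota>) (C \<union> ?P)"
  let ?T = "top_of_set {0..1::real}"
  have P: "?P \<subseteq> graph_points G \<iota>" using half_in_graph_points[OF h] I(1) by blast
  have top: "topspace X = C \<union> ?P"
    unfolding X_def topspace_subtopology topspace_graph_space using C(1) P by blast
  define k where "k p = (if snd p \<in> C then snd p else half h ((1 - fst p) * height (snd p) + fst p * a))" for p
  have kP: "k (t, half h u) = half h ((1 - t) * u + t * a)" if "u \<in> I" for t u
  proof (cases "half h u \<in> C")
    case True
    then have "half h u = half h a" using CP that by blast
    then have "u = a" by (metis height_half)
    then show ?thesis using True by (simp add: k_def algebra_simps)
  qed (simp add: k_def height_half)
  have comb: "(1 - t) * u + t * a \<in> I" if "t \<in> {0..1}" "u \<in> I" for t u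
    using convexD[OF I(2) that(2) I(3), of "1 - t" t] that(1) by simp
  \<comment> \<open>Pasting requires the two pieces to be closed in \<open>X\<close> only. This
    matters for a half-open interval, whose image is not closed in the whole graph.\<close>
  have kX: "continuous_map (prod_topology ?T X) X k"
  proof (rule pasting_lemma_closed[where I = UNIV and T = "\<lambda>b. {0..1} \<times> (if b then C else ?P)" and
        f = "\<lambda>b. if b then snd else (\<lambda>p. half h ((1 - fst p) * height (snd p) + fst p * a))"])
    show "finite (UNIV :: bool set)" by simp
    show "closedin (prod_topology ?T X) ({0..1} \<times> (if b then C else ?P))" for b
      using closed unfolding X_def[symmetric] closedin_prod_Times_iff by (auto simp: closedin_topspace[of ?T, simplified])
    show "continuous_map (subtopology (prod_topology ?T X) ({0..1} \<times> (if b then C else ?P))) X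
        (if b then snd else (\<lambda>p. half h ((1 - fst p) * height (snd p) + fst p * a)))" for b
    proof (cases b)
      case True
      then show ?thesis by (simp add: continuous_map_from_subtopology continuous_map_snd)
    next
      case False
      let ?Q = "subtopology (prod_topology ?T X) ({0..1} \<times> ?P)"
      have "continuous_map X euclideanreal height"
        unfolding X_def by (intro continuous_map_from_subtopology continuous_height)
      then have "continuous_map ?Q euclideanreal (height \<circ> snd)"
        by (intro continuous_map_from_subtopology continuous_map_compose[OF continuous_map_snd])
      moreover have "continuous_map ?T euclideanreal (\<lambda>x. x)" by simp
      then have "continuous_map ?Q euclideanreal ((\<lambda>x. x) \<circ> fst)"
        by (rule continuous_map_from_subtopology[OF continuous_map_compose[OF continuous_map_fst]])
      ultimately have "continuous_map ?Q euclideanreal (\<lambda>p. (1 - fst p) * height (snd p) + fst p * a)"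
        unfolding o_def by (intro continuous_intros)
      moreover have inI: "(1 - fst p) * height (snd p) + fst p * a \<in> I" if "p \<in> topspace ?Q" for p
        using that comb by (auto simp: height_half)
      ultimately have "continuous_map ?Q ?T (\<lambda>p. (1 - fst p) * height (snd p) + fst p * a)"
        using I(1) by (intro continuous_map_into_subtopology) (auto simp del: topspace_prod_topology topspace_subtopology)
      from continuous_map_compose[OF this continuous_half[OF h]]
      have "continuous_map ?Q X (\<lambda>p. half h ((1 - fst p) * height (snd p) + fst p * a))"
        unfolding X_def[of] o_def
        by (rule continuous_map_into_subtopology) (use inI in \<open>unfold X_def, blast\<close>)
      then show ?thesis using False by simp
    qed
    show "(if b then snd else (\<lambda>p. half h ((1 - fst p) * height (snd p) + fst p * a))) p =
        (if b' then snd else (\<lambda>p. half h ((1 - fst p) * height (snd p) + fst p * a))) p"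
      if "p \<in> topspace (prod_topology ?T X) \<inter> {0..1} \<times> (if b then C else ?P) \<inter> {0..1} \<times> (if b' then C else ?P)"
      for b b' p
    proof (cases "b = b'")
      case False
      then have "snd p \<in> C \<inter> ?P" using that by (cases b; cases b') auto
      then have "snd p = half h a" unfolding CP by simp
      then have "half h ((1 - fst p) * height (snd p) + fst p * a) = snd p"
        by (simp add: height_half algebra_simps)
      then show ?thesis using False by (cases b; cases b') auto
    qed simp
    show "\<exists>b. b \<in> UNIV \<and> p \<in> {0..1} \<times> (if b then C else ?P) \<and>
        k p = (if b then snd else (\<lambda>p. half h ((1 - fst p) * height (snd p) + fst p * a))) p"
      if "p \<in> topspace (prod_topology ?T X)" for p
    proof -
      have "fst p \<in> {0..1}" "snd p \<in> C \<union> ?P" using that by (simp_all add: mem_Times_iff top)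
      then show ?thesis
        by (cases "snd p \<in> C") (rule exI[of _ True], simp add: k_def mem_Times_iff,
          rule exI[of _ False], simp add: k_def mem_Times_iff)
    qed
  qed
  define r where "r x = (if x \<in> C then x else half h a)" for x
  have ends: "k (0, x) = x" "k (1, x) = r x" if "x \<in> topspace X" for x
  proof -
    have "x \<in> C \<union> ?P" using that unfolding top .
    then consider "x \<in> C" | u where "u \<in> I" "x = half h u" "x \<notin> C" by blast
    then have "k (0, x) = x \<and> k (1, x) = r x"
    proof cases
      case (2 u)
      then show ?thesis using kP[OF 2(1)] by (simp add: r_def)
    qed (simp add: k_def r_def)
    then show "k (0, x) = x" "k (1, x) = r x" by blast+
  qed
  have "homotopic_with (\<lambda>_. True) X X id r"
    by (subst homotopic_with, simp) (intro exI[of _ k] conjI ballI kX; simp add: ends)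
  moreover have "r x \<in> C" if "x \<in> topspace X" for x using CP by (auto simp: r_def)
  moreover have "subtopology X C = subtopology (graph_space G \<iota>) C"
    unfolding X_def subtopology_subtopology by (simp add: Int_absorb1)
  ultimately show ?thesis
    unfolding X_def[symmetric] using C(2) top by (intro contractible_space_homotopic_retraction[of X C ?P r]) auto
qed

definition closed_region :: "'v set \<Rightarrow> 'h set \<Rightarrow> ('v, 'h) point set" where
  "closed_region V A = Vertex ` V \<union> (\<Union>h\<in>A. half h ` {0..1})"

lemma closed_region_subset:
  "V \<subseteq> verts G \<Longrightarrow> A \<subseteq> arcs G \<Longrightarrow> closed_region V A \<subseteq> graph_points G \<iota>"
  unfolding closed_region_def graph_points_def by blast

text \<open>Along each half-edge the region fills either everything or at most the two
  endpoints.\<close>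

lemma closedin_region:
  assumes "V \<subseteq> verts G" "A \<subseteq> arcs G"
  shows "closedin (graph_space G \<iota>) (closed_region V A)"
  unfolding closedin_def openin_graph_space topspace_graph_space
proof (intro conjI ballI)
  fix k assume k: "k \<in> arcs G"
  let ?T = "{t\<in>{0..1}. half k t \<in> closed_region V A}"
  have "closed ?T"
  proof (cases "k \<in> A")
    case True
    then have "?T = {0..1}" unfolding closed_region_def by blast
    then show ?thesis by simp
  next
    case False
    have "?T \<subseteq> {0, 1}"
      using False by (auto simp: closed_region_def half_edge_point_def split: if_splits)
    then show ?thesis by (intro finite_imp_closed) (rule finite_subset, auto)
  qed
  then have "openin (top_of_set {0..1}) ({0..1} - ?T)"
    by (intro openin_diff) (auto intro: closed_subset)
  moreover have "{t\<in>{0..1}. half k t \<in> graph_points G \<iota> - closed_region V A} = {0..1} - ?T"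
    using half_in_graph_points[OF k] by blast
  ultimately show "openin (top_of_set {0..1}) {t\<in>{0..1}. half k t \<in> graph_points G \<iota> - closed_region V A}"
    by simp
qed (use closed_region_subset[OF assms] in auto)

lemma half_in_closed_region:
  assumes "t \<in> {0..1}"
  shows "half h t \<in> closed_region V A \<longleftrightarrow>
    h \<in> A \<or> (t = 0 \<and> tail G h \<in> V \<union> tail G ` A) \<or> (t = 1 \<and> \<iota> h \<in> A)"
proof
  assume "half h t \<in> closed_region V A"
  then consider v where "v \<in> V" "half h t = Vertex v" | k u where "k \<in> A" "u \<in> {0..1}" "half h t = half k u"
    unfolding closed_region_def by blast
  then show "h \<in> A \<or> (t = 0 \<and> tail G h \<in> V \<union> tail G ` A) \<or> (t = 1 \<and> \<iota> h \<in> A)"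
  proof cases
    case 1
    then show ?thesis by (auto simp: half_edge_point_def split: if_splits)
  next
    case (2 k u)
    then show ?thesis
      by (auto simp: half_edge_point_def doubleton_eq_iff split: if_splits)
  qed
next
  assume "h \<in> A \<or> (t = 0 \<and> tail G h \<in> V \<union> tail G ` A) \<or> (t = 1 \<and> \<iota> h \<in> A)"
  then consider "h \<in> A" | "t = 0" "tail G h \<in> V" | k where "t = 0" "k \<in> A" "tail G h = tail G k" | "t = 1" "\<iota> h \<in> A"
    by blast
  then show "half h t \<in> closed_region V A"
  proof cases
    case 1
    then show ?thesis using assms unfolding closed_region_def by blast
  next
    case 2
    then show ?thesis by (simp add: closed_region_def half_0)
  next
    case (3 k)
    then have "half h t = half k 0" by (simp add: half_0)
    then show ?thesis using 3 unfolding closed_region_def by fastforce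
  next
    case 4
    then have "half h t = half (\<iota> h) 1" by (simp add: half_1_reverse)
    then show ?thesis using 4 unfolding closed_region_def by fastforce
  qed
qed

text \<open>The new half-edge has to meet the region in a single point. Either it is glued at its
  vertex and the other half of its edge is absent, or it is glued at the midpoint and its vertex is
  new.\<close>

lemma attach_closed:
  fixes a :: real
  assumes V: "V \<subseteq> verts G" and A: "A \<subseteq> arcs G" and h: "h \<in> arcs G" "h \<notin> A"
    and con: "contractible_space (subtopology (graph_space G \<iota>) (closed_region V A))"
    and a: "a = 0 \<and> tail G h \<in> V \<union> tail G ` A \<and> \<iota> h \<notin> A \<or> a = 1 \<and> tail G h \<notin> V \<union> tail G ` A \<and> \<iota> h \<in> A"
  shows "contractible_space (subtopology (graph_space G \<iota>) (closed_region V (insert h A)))"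
proof -
  have eq: "closed_region V (insert h A) = closed_region V A \<union> half h ` {0..1}"
    unfolding closed_region_def by blast
  have sing: "half h ` {0..1} = closed_region {} {h}" unfolding closed_region_def by simp
  have clo: "closedin (subtopology (graph_space G \<iota>) U) (closed_region V' A')"
    if "V' \<subseteq> verts G" "A' \<subseteq> arcs G" "closed_region V' A' \<subseteq> U" for U V' A'
    using closedin_region[OF that(1,2)] that(3) by (simp add: closedin_closed_subtopology closedin_subset_topspace)
  have "closed_region V A \<inter> half h ` {0..1} = {half h a}"
    using a h(2) half_in_closed_region[of _ h V A] by auto
  then show ?thesis
    unfolding eq using closed_region_subset[OF V A] con h(1) a V A
    by (intro attach_half_edge[where a = a] clo) (auto simp: sing intro!: clo)
qed

section \<open>The tree left after erasing a determining set\<close>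

lemma determines_disjoint:
  assumes "determines S" "S \<subseteq> arcs G" "card S = first_betti G \<iota>"
  shows "S \<inter> \<iota> ` S = {}"
proof (rule ccontr)
  assume "S \<inter> \<iota> ` S \<noteq> {}"
  then obtain s where s: "s \<in> S" "\<iota> s \<in> S" by auto
  have "finite S" using assms(2) finite_arcs by (rule finite_subset)
  then obtain z where z: "\<And>s. s \<in> S \<Longrightarrow> z s \<in> one_cycles G \<iota>"
    "\<And>s s'. s \<in> S \<Longrightarrow> s' \<in> S \<Longrightarrow> z s s' = of_bool (s = s')"
    using determines_dual_basis[OF assms(1) _ assms(3)] by metis
  \<comment> \<open>The cycle dual to \<open>s\<close> would be 1 at \<open>s\<close> and 0 at
    \<open>\<iota> s\<close>, although it changes sign under \<open>\<iota>\<close>.\<close>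
  have "s \<noteq> \<iota> s" using arev_neq s(1) assms(2) by fastforce
  then show False
    using z(2)[OF s(1,1)] z(2)[OF s] cycle_reverse[OF z(1)[OF s(1)], of s] by simp
qed

text \<open>Otherwise some edge with a half \<open>s\<close> in \<open>S\<close> leaves
  \<open>W\<close>. The other edges of the cut also have a half in \<open>S\<close>, so the cycle
  dual to \<open>s\<close> vanishes on them, and its sum over the cut cannot be zero.\<close>

lemma rest_connected:
  assumes S: "determines S" "S \<subseteq> arcs G" "card S = first_betti G \<iota>"
    and W: "W \<subseteq> verts G" "W \<noteq> {}" "\<And>h. h \<in> rest S \<Longrightarrow> tail G h \<in> W \<Longrightarrow> tail G (\<iota> h) \<in> W"
  shows "W = verts G"
proof (rule ccontr)
  assume "W \<noteq> verts G"
  then obtain h where h: "h \<in> arcs G" "tail G h \<in> W" "tail G (\<iota> h) \<notin> W"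
    using connected_closed[OF W(1,2)] by blast
  then have "h \<notin> rest S" using W(3) by blast
  then obtain s where s: "s \<in> S" "h = s \<or> h = \<iota> s" using h(1) by blast
  have "finite S" using S(2) finite_arcs by (rule finite_subset)
  then obtain z where z: "\<And>s. s \<in> S \<Longrightarrow> z s \<in> one_cycles G \<iota>"
    "\<And>s s'. s \<in> S \<Longrightarrow> s' \<in> S \<Longrightarrow> z s s' = of_bool (s = s')"
    using determines_dual_basis[OF S(1) _ S(3)] by metis
  let ?X = "{k\<in>arcs G. tail G k \<in> W \<and> tail G (\<iota> k) \<notin> W}"
  have zero: "z s k = 0" if k: "k \<in> ?X - {h}" for k
  proof -
    have "k \<notin> rest S" using k W(3) by blast
    then obtain s' where s': "s' \<in> S" "k = s' \<or> k = \<iota> s'" using k by blast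
    have "k \<noteq> \<iota> h" using k h(2) by auto
    then have "s' \<noteq> s" using s(2) s'(2) k by (auto simp: arev_eq_iff)
    then show ?thesis
      using s'(2) z(2)[OF s(1) s'(1)] cycle_reverse[OF z(1)[OF s(1)], of s'] by auto
  qed
  have "sum (z s) ?X = z s h + sum (z s) (?X - {h})" using h by (intro sum.remove) auto
  also have "sum (z s) (?X - {h}) = 0" using zero by (intro sum.neutral) blast
  also have "sum (z s) ?X = 0" by (rule cut_sum[OF z(1)[OF s(1)] W(1)])
  finally show False
    using s(2) z(2)[OF s(1,1)] cycle_reverse[OF z(1)[OF s(1)], of s] by auto
qed

text \<open>The edge comes as two half-edges: one glued at its old vertex, then the other glued at
  the midpoint, which brings the new vertex with it.\<close>

lemma contractible_grow:
  assumes V: "V \<subseteq> verts G" and A: "A \<subseteq> arcs G" "\<iota> ` A \<subseteq> A" "tail G ` A \<subseteq> V"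
    and h: "h \<in> arcs G" "tail G h \<in> V" "tail G (\<iota> h) \<notin> V"
    and con: "contractible_space (subtopology (graph_space G \<iota>) (closed_region V A))"
  shows "contractible_space (subtopology (graph_space G \<iota>)
    (closed_region (insert (tail G (\<iota> h)) V) (insert h (insert (\<iota> h) A))))"
proof -
  have hA: "h \<notin> A" "\<iota> h \<notin> A" using A h(3) by blast+
  have 1: "contractible_space (subtopology (graph_space G \<iota>) (closed_region V (insert h A)))"
    using V A h hA con by (intro attach_closed[where a = 0]) auto
  have "contractible_space (subtopology (graph_space G \<iota>) (closed_region V (insert (\<iota> h) (insert h A))))"
  proof (rule attach_closed[where a = 1])
    show "\<iota> h \<notin> insert h A" using hA arev_neq[OF h(1)] by simp
    have "tail G (\<iota> h) \<notin> tail G ` insert h A" using h A(3) by auto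
    then show "(1::real) = 0 \<and> tail G (\<iota> h) \<in> V \<union> tail G ` insert h A \<and> \<iota> (\<iota> h) \<notin> insert h A \<or>
        (1::real) = 1 \<and> tail G (\<iota> h) \<notin> V \<union> tail G ` insert h A \<and> \<iota> (\<iota> h) \<in> insert h A"
      using h(3) by simp
  qed (use V A h 1 in auto)
  moreover have "Vertex (tail G (\<iota> h)) \<in> half (\<iota> h) ` {0..1}"
    unfolding half_0[symmetric] by simp
  then have "closed_region (insert (tail G (\<iota> h)) V) (insert h (insert (\<iota> h) A)) =
      closed_region V (insert (\<iota> h) (insert h A))"
    unfolding closed_region_def by blast
  ultimately show ?thesis by simp
qed

text \<open>A spanning tree is grown inside \<open>rest S\<close>, one leaf at a time. An edge of
  \<open>rest S\<close> outside the tree would have its ends joined by a walk in the tree, against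
  \<open>bridge\<close>, so the tree is all of \<open>rest S\<close>.\<close>

lemma contractible_rest:
  assumes S: "determines S" "S \<subseteq> arcs G" "card S = first_betti G \<iota>"
  shows "contractible_space (subtopology (graph_space G \<iota>) (closed_region (verts G) (rest S)))"
proof -
  obtain r where r: "r \<in> verts G" using verts_ne by blast
  \<comment> \<open>The walks from \<open>r\<close> are recorded for the end of the argument, where
    they join the ends of a supposed further edge.\<close>
  define good where "good V A \<longleftrightarrow> r \<in> V \<and> V \<subseteq> verts G \<and> A \<subseteq> rest S \<and> \<iota> ` A \<subseteq> A \<and> tail G ` A \<subseteq> V \<and>
    (\<forall>x\<in>V. (r, x) \<in> (adjacency A)\<^sup>*) \<and>
    contractible_space (subtopology (graph_space G \<iota>) (closed_region V A))" for V A
  have "good V A \<Longrightarrow> \<exists>A'. good (verts G) A'" for V A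
  proof (induction "card (verts G - V)" arbitrary: V A rule: less_induct)
    case less
    show ?case
    proof (cases "V = verts G")
      case True
      then show ?thesis using less.prems by blast
    next
      case False
      have V: "r \<in> V" "V \<subseteq> verts G" and A: "A \<subseteq> rest S" "\<iota> ` A \<subseteq> A" "tail G ` A \<subseteq> V"
        and path: "\<And>x. x \<in> V \<Longrightarrow> (r, x) \<in> (adjacency A)\<^sup>*"
        and con: "contractible_space (subtopology (graph_space G \<iota>) (closed_region V A))"
        using less.prems by (auto simp: good_def)
      obtain h where h: "h \<in> rest S" "tail G h \<in> V" "tail G (\<iota> h) \<notin> V"
        using rest_connected[OF S V(2)] False V(1) by blast
      let ?v = "tail G (\<iota> h)" and ?A = "insert h (insert (\<iota> h) A)"
      have v: "?v \<in> verts G" using h(1) by (intro tail_in arev_in_arcs) blast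
      have mono: "adjacency A \<subseteq> adjacency ?A" unfolding adjacency_def by blast
      have "(r, tail G h) \<in> (adjacency ?A)\<^sup>*" using path[OF h(2)] rtrancl_mono[OF mono] by blast
      moreover have "(tail G h, ?v) \<in> adjacency ?A" unfolding adjacency_def by blast
      ultimately have rv: "(r, ?v) \<in> (adjacency ?A)\<^sup>*" by (rule rtrancl_into_rtrancl)
      have con': "contractible_space (subtopology (graph_space G \<iota>) (closed_region (insert ?v V) ?A))"
        using h A by (intro contractible_grow[OF V(2) _ A(2,3) _ _ _ con]) blast+
      have "good (insert ?v V) ?A"
        unfolding good_def
      proof (intro conjI ballI con')
        show "?A \<subseteq> rest S" using A(1) h(1) rest_reverse[OF h(1)] by (metis insert_subset)
        show "\<iota> ` ?A \<subseteq> ?A" using A(2) by auto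
        show "tail G ` ?A \<subseteq> insert ?v V" using A(3) h(2) by blast
        show "(r, x) \<in> (adjacency ?A)\<^sup>*" if "x \<in> insert ?v V" for x
          using that rv path rtrancl_mono[OF mono] by blast
      qed (use V v in auto)
      moreover have "card (verts G - insert ?v V) < card (verts G - V)"
        using h(3) v by (intro psubset_card_mono) auto
      ultimately show ?thesis using less.hyps by blast
    qed
  qed
  moreover have "good {r} {}"
    using r by (simp add: good_def closed_region_def contractible_space_subtopology_singleton)
  ultimately obtain A where "good (verts G) A" by blast
  then have A: "A \<subseteq> rest S" "\<iota> ` A \<subseteq> A" "\<And>x. x \<in> verts G \<Longrightarrow> (r, x) \<in> (adjacency A)\<^sup>*"
    and con: "contractible_space (subtopology (graph_space G \<iota>) (closed_region (verts G) A))"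
    by (auto simp: good_def)
  have "h \<in> A" if h: "h \<in> rest S" for h
  proof (rule ccontr)
    assume hA: "h \<notin> A"
    then have "\<iota> h \<notin> A" using A(2) by (metis arev_arev imageI subsetD)
    then have sub: "A \<subseteq> rest S - {h, \<iota> h}" using A(1) hA by blast
    have "sym (adjacency A)"
    proof (rule symI)
      fix x y assume "(x, y) \<in> adjacency A"
      then obtain k where "k \<in> A" "x = tail G k" "y = tail G (\<iota> k)" by (auto simp: adjacency_def)
      then have "\<iota> k \<in> A" "y = tail G (\<iota> k)" "x = tail G (\<iota> (\<iota> k))" using A(2) by auto
      then show "(y, x) \<in> adjacency A" unfolding adjacency_def by blast
    qed
    then have "sym ((adjacency A)\<^sup>*)" by (rule sym_rtrancl)
    have hG: "h \<in> arcs G" using h by blast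
    have "(r, tail G h) \<in> (adjacency A)\<^sup>*" "(r, tail G (\<iota> h)) \<in> (adjacency A)\<^sup>*"
      using A(3)[OF tail_in] hG arev_in_arcs[OF hG] by blast+
    then have "(tail G h, tail G (\<iota> h)) \<in> (adjacency A)\<^sup>*"
      using \<open>sym ((adjacency A)\<^sup>*)\<close> by (meson rtrancl_trans symD)
    moreover have "adjacency A \<subseteq> adjacency (rest S - {h, \<iota> h})" using sub unfolding adjacency_def by blast
    ultimately show False using bridge[OF S(1) h] rtrancl_mono by blast
  qed
  then have "A = rest S" using A(1) by blast
  then show ?thesis using con by simp
qed

text \<open>The other half of an edge with a chosen half-edge remains as a half-open interval, without the
  midpoint; it is attached to the tree at its vertex.\<close>

lemma determines_imp_contractible:
  assumes S: "determines S" "S \<subseteq> arcs G" "card S = first_betti G \<iota>"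
  shows "contractible_space (remaining_space G \<iota> S)"
proof -
  have disj: "S \<inter> \<iota> ` S = {}" by (rule determines_disjoint[OF S])
  have finS: "finite S" using S(2) finite_arcs by (rule finite_subset)
  let ?C = "closed_region (verts G) (rest S)"
  define U where "U B = ?C \<union> (\<Union>h\<in>B. half h ` {0..<1})" for B
  have halfU: "half h t \<in> U B \<longleftrightarrow> half h t \<in> ?C \<or> (h \<in> B \<and> t \<noteq> 1) \<or> (t = 0 \<and> tail G h \<in> tail G ` B)"
    if t: "t \<in> {0..1}" for h t B
  proof
    assume "half h t \<in> U B"
    then consider "half h t \<in> ?C" | k u where "k \<in> B" "u \<in> {0..<1}" "half h t = half k u"
      unfolding U_def by blast
    then show "half h t \<in> ?C \<or> (h \<in> B \<and> t \<noteq> 1) \<or> (t = 0 \<and> tail G h \<in> tail G ` B)"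
    proof cases
      case (2 k u)
      then show ?thesis by (auto simp: half_edge_point_def split: if_splits)
    qed blast
  next
    assume *: "half h t \<in> ?C \<or> (h \<in> B \<and> t \<noteq> 1) \<or> (t = 0 \<and> tail G h \<in> tail G ` B)"
    have "half h t \<in> half h ` {0..<1}" if "t \<noteq> 1" using t that by simp
    moreover have "half h t = half k 0" if "t = 0" "tail G h = tail G k" for k using that by (simp add: half_0)
    ultimately show "half h t \<in> U B" using * unfolding U_def by fastforce
  qed
  have restG: "rest S \<subseteq> arcs G" by blast
  have "B \<subseteq> \<iota> ` S \<Longrightarrow> contractible_space (subtopology (graph_space G \<iota>) (U B))" if "finite B" for B
    using that
  proof (induction B rule: finite_induct)
    case empty
    then show ?case using contractible_rest[OF S] by (simp add: U_def)
  next
    case (insert h B)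
    let ?X = "graph_space G \<iota>" and ?P = "half h ` {0..<1}"
    have h: "h \<in> arcs G" "h \<notin> rest S" "\<iota> h \<notin> rest S" "\<iota> h \<in> S"
      using insert.prems S(2) by auto
    have B: "B \<subseteq> arcs G" using insert.prems S(2) arev_in_arcs by blast
    have BS: "B \<inter> S = {}" using insert.prems disj by blast
    have eq: "U (insert h B) = U B \<union> ?P" unfolding U_def by blast
    have UG: "U B \<subseteq> graph_points G \<iota>"
    proof -
      have "half k u \<in> graph_points G \<iota>" if "k \<in> B" "u \<in> {0..<1}" for k u
        using that B by (intro half_in_graph_points) auto
      then show ?thesis unfolding U_def using closed_region_subset[OF order_refl restG] by blast
    qed
    have tl: "tail G h \<in> verts G" using tail_in[OF h(1)] .
    have int: "U B \<inter> ?P = {half h 0}"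
    proof -
      have "half h t \<in> U B \<longleftrightarrow> t = 0" if "t \<in> {0..<1}" for t
        using halfU[of t h B] half_in_closed_region[of t h "verts G" "rest S"] that insert.hyps h tl by auto
      then show ?thesis by auto
    qed
    \<comment> \<open>\<open>U B\<close> need not be closed in the whole graph, but it is closed in
      the union: the closed region adds only midpoints of edges with a half in \<open>S\<close>, and
      the union contains none of these.\<close>
    have "U B = (U B \<union> ?P) \<inter> closed_region (verts G) (rest S \<union> B)"
    proof -
      have "U B \<subseteq> closed_region (verts G) (rest S \<union> B)"
        unfolding U_def
      proof (intro Un_least UN_least image_subsetI)
        show "?C \<subseteq> closed_region (verts G) (rest S \<union> B)" unfolding closed_region_def by blast
        show "half k u \<in> closed_region (verts G) (rest S \<union> B)" if "k \<in> B" "u \<in> {0..<1}" for k u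
          using half_in_closed_region[of u k "verts G" "rest S \<union> B"] that by simp
      qed
      moreover have "half h t \<in> U B" if t: "t \<in> {0..<1}" "half h t \<in> closed_region (verts G) (rest S \<union> B)" for t
      proof -
        have "t = 0"
          using half_in_closed_region[of t h "verts G" "rest S \<union> B"] t insert.hyps h by auto
        then show ?thesis using int by blast
      qed
      ultimately show ?thesis by blast
    qed
    then have clU: "closedin (subtopology ?X (U B \<union> ?P)) (U B)"
      unfolding closedin_subtopology
      using closedin_region[OF order_refl, of "rest S \<union> B"] restG B by blast
    have "?P = closed_region {} {h} \<inter> (U B \<union> ?P)"
    proof -
      have "half h 1 \<notin> U B"
        using halfU[of 1 h B] half_in_closed_region[of 1 h "verts G" "rest S"] h by auto
      moreover have region: "closed_region {} {h} = insert (half h 1) ?P"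
      proof -
        have eq: "insert 1 {0..<1} = {0..1::real}" by auto
        show ?thesis
          unfolding image_insert[symmetric] eq by (simp add: closed_region_def)
      qed
      moreover have "half h 1 \<notin> ?P" by (auto simp: half_edge_point_def)
      ultimately show ?thesis unfolding region by auto
    qed
    then have clP: "closedin (subtopology ?X (U B \<union> ?P)) ?P"
      unfolding closedin_subtopology using closedin_region[of "{}" "{h}"] h(1)
      by (intro exI[of _ "closed_region {} {h}"] conjI) simp_all
    show ?case
      unfolding eq
    proof (rule attach_half_edge[OF h(1) _ _ _ UG _ int clU clP])
      show "contractible_space (subtopology ?X (U B))" using insert.IH insert.prems by simp
    qed auto
  qed
  then have "contractible_space (subtopology (graph_space G \<iota>) (U (\<iota> ` S)))" using finS by blast
  moreover have "U (\<iota> ` S) = remaining_points S"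
  proof (intro Set.set_eqI)
    fix x
    show "x \<in> U (\<iota> ` S) \<longleftrightarrow> x \<in> remaining_points S"
    proof (cases "x \<in> graph_points G \<iota>")
      case True
      then show ?thesis
      proof (cases rule: graph_points_cases)
        case (1 v)
        then have "x \<in> ?C" unfolding closed_region_def by blast
        then have "x \<in> U (\<iota> ` S)" unfolding U_def by (rule UnI1)
        moreover have "x \<notin> (\<Union>h\<in>S. half h ` {0<..1})"
        proof
          assume "x \<in> (\<Union>h\<in>S. half h ` {0<..1})"
          then obtain k u where "u \<in> {0<..1}" "x = half k u" by blast
          then show False using 1(2) by (simp add: half_edge_point_def split: if_splits)
        qed
        ultimately show ?thesis using True by blast
      next
        case (2 h t)
        have t: "t \<in> {0..1}" "t \<noteq> 0" using 2(2) by simp_all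
        have mem: "x \<in> half k ` {0<..1} \<longleftrightarrow> h = k \<or> (t = 1 \<and> h = \<iota> k)" for k
        proof
          assume "x \<in> half k ` {0<..1}"
          then obtain u where u: "u \<in> {0<..1}" "half h t = half k u" unfolding 2(3) by (rule imageE)
          then show "h = k \<or> (t = 1 \<and> h = \<iota> k)" using half_eq_iff[OF t(1) u(1)] by blast
        next
          assume "h = k \<or> (t = 1 \<and> h = \<iota> k)"
          then have "half h t = half k t" using half_eq_iff[OF t(1) 2(2), of h k] by blast
          then show "x \<in> half k ` {0<..1}" using 2(2,3) by blast
        qed
        have "x \<in> remaining_points S \<longleftrightarrow> (\<forall>k\<in>S. x \<notin> half k ` {0<..1})" by (simp add: True)
        then have "x \<in> remaining_points S \<longleftrightarrow> h \<notin> S \<and> \<not> (t = 1 \<and> h \<in> \<iota> ` S)" unfolding mem by blast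
        moreover have "\<iota> h \<in> rest S \<longleftrightarrow> h \<in> rest S"
          using rest_reverse[of h S] rest_reverse[of "\<iota> h" S] by (metis arev_arev)
        then have "x \<in> ?C \<longleftrightarrow> h \<in> rest S"
          unfolding 2(3) half_in_closed_region[OF t(1)] using t(2) by blast
        then have "x \<in> U (\<iota> ` S) \<longleftrightarrow> h \<in> rest S \<or> (h \<in> \<iota> ` S \<and> t \<noteq> 1)"
          using halfU[OF t(1), of h "\<iota> ` S"] t(2) 2(3) by simp
        ultimately show ?thesis using 2(1) disj by blast
      qed
    next
      case False
      have "half k u \<in> graph_points G \<iota>" if "k \<in> \<iota> ` S" "u \<in> {0..<1}" for k u
        using that S(2) by (intro half_in_graph_points) auto
      then have "U (\<iota> ` S) \<subseteq> graph_points G \<iota>"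
        unfolding U_def using closed_region_subset[OF order_refl restG] by blast
      then show ?thesis using False by blast
    qed
  qed
  ultimately show ?thesis unfolding remaining_space_def by simp
qed

lemma contractible_iff_determines:
  assumes "S \<subseteq> arcs G" "card S = first_betti G \<iota>"
  shows "contractible_space (remaining_space G \<iota> S) \<longleftrightarrow> determines S"
  using assms contractible_imp_determines determines_imp_contractible by blast

end

section \<open>Counting embeddings and decorations\<close>

lemma cyclic_next_nth: "distinct xs \<Longrightarrow> i < length xs \<Longrightarrow> cyclic_next xs (xs ! i) = xs ! (Suc i mod length xs)"
  by (simp add: cyclic_next_def position_nth)

lemma cyclic_next_orbit:
  assumes xs: "distinct xs" "set xs = K" "K \<noteq> {}" and f: "\<And>h. h \<in> K \<Longrightarrow> f h = cyclic_next xs h"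
  shows "cyclic_on f K"
proof -
  have len: "length xs > 0" using xs(2,3) by auto
  have pow: "(f ^^ k) (xs ! 0) = xs ! (k mod length xs)" for k
  proof (induction k)
    case (Suc k)
    have "k mod length xs < length xs" using len by simp
    then have "xs ! (k mod length xs) \<in> K" using xs(2) nth_mem by blast
    then show ?case using Suc f cyclic_next_nth[OF xs(1), of "k mod length xs"] len by (simp add: mod_Suc_eq)
  qed (use len in simp)
  have "K = orbit f (xs ! 0)"
  proof
    show "K \<subseteq> orbit f (xs ! 0)"
    proof
      fix h assume "h \<in> K"
      then obtain i where i: "i < length xs" "h = xs ! i" using xs(2) by (metis in_set_conv_nth)
      then have "h = (f ^^ (i + length xs)) (xs ! 0)" unfolding pow by simp
      then show "h \<in> orbit f (xs ! 0)" unfolding orbit_altdef using len by blast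
    qed
    show "orbit f (xs ! 0) \<subseteq> K"
      unfolding orbit_altdef pow using xs(2) len by (auto intro!: nth_mem)
  qed
  moreover have "xs ! 0 \<in> K" using xs(2) len by auto
  ultimately show ?thesis by (rule cyclic_on_singleI[rotated])
qed

text \<open>A cyclic order is cut open into a linear one by choosing the first element. The empty
  set still has the empty list, hence the maximum with 1.\<close>

lemma card_cyclic_orders:
  assumes cyc: "K \<noteq> {} \<Longrightarrow> cyclic_on f K" and K: "finite K"
  shows "card {xs\<in>permutations_of_set K. \<forall>h\<in>K. f h = cyclic_next xs h} = max 1 (card K)"
proof (cases "K = {}")
  case True
  then have "{xs\<in>permutations_of_set K. \<forall>h\<in>K. f h = cyclic_next xs h} = {[]}" by auto
  then show ?thesis using True by simp
next
  case False
  let ?F = "{xs\<in>permutations_of_set K. \<forall>h\<in>K. f h = cyclic_next xs h}"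
  let ?n = "card K"
  have n: "?n > 0" using False K by (simp add: card_gt_0_iff)
  have pow: "xs ! i = (f ^^ i) (xs ! 0)" if xs: "xs \<in> ?F" "i < ?n" for xs i
    using xs(2)
  proof (induction i)
    case (Suc i)
    have d: "distinct xs" "set xs = K" "length xs = ?n"
      using xs(1) by (auto simp: permutations_of_set_def distinct_card)
    have "xs ! i \<in> K" using d Suc.prems nth_mem[of i xs] by simp
    then have "f (xs ! i) = xs ! Suc i" using xs(1) cyclic_next_nth[OF d(1), of i] d(3) Suc.prems by simp
    then show ?case using Suc by simp
  qed simp
  have "bij_betw (\<lambda>xs. xs ! 0) ?F K"
    unfolding bij_betw_def
  proof
    show "inj_on (\<lambda>xs. xs ! 0) ?F"
    proof (rule inj_onI)
      fix xs ys assume xs: "xs \<in> ?F" and ys: "ys \<in> ?F" and eq: "xs ! 0 = ys ! 0"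
      have "length xs = ?n" if "xs \<in> ?F" for xs
      proof -
        have "set xs = K" "distinct xs" using that by (simp_all add: permutations_of_set_def)
        then show ?thesis by (metis distinct_card)
      qed
      from this[OF xs] this[OF ys] have len: "length xs = ?n" "length ys = ?n" .
      show "xs = ys"
      proof (rule nth_equalityI)
        fix i assume "i < length xs"
        then have i: "i < ?n" using len by simp
        show "xs ! i = ys ! i" by (simp only: pow[OF xs i] pow[OF ys i] eq)
      qed (use len in simp)
    qed
    show "(\<lambda>xs. xs ! 0) ` ?F = K"
    proof
      show "(\<lambda>xs. xs ! 0) ` ?F \<subseteq> K"
      proof (rule image_subsetI)
        fix xs assume "xs \<in> ?F"
        then have "set xs = K" by (simp add: permutations_of_set_def)
        then show "xs ! 0 \<in> K" using False by (metis length_greater_0_conv nth_mem set_empty)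
      qed
      show "K \<subseteq> (\<lambda>xs. xs ! 0) ` ?F"
      proof
        fix a assume a: "a \<in> K"
        have orb: "orbit f a = K" using orbit_cyclic_eq3[OF cyc[OF False] a] .
        \<comment> \<open>The period of \<open>f\<close> at \<open>a\<close>; the wanted list reads
          the orbit from \<open>a\<close> for one period.\<close>
        define p where "p = funpow_dist1 f a a"
        have aorb: "a \<in> orbit f a" using a orb by simp
        have p: "(f ^^ p) a = a" "p > 0" unfolding p_def using funpow_dist1_prop[OF aorb] by simp_all
        have inj: "inj_on (\<lambda>i. (f ^^ i) a) {0..<p}" unfolding p_def by (rule inj_on_funpow_dist1[OF aorb])
        have Kp: "K = (\<lambda>i. (f ^^ i) a) ` {0..<p}"
          unfolding orb[symmetric] orbit_altdef_bounded[OF p] by auto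
        have "?n = p" unfolding Kp by (simp add: card_image[OF inj])
        let ?xs = "map (\<lambda>i. (f ^^ i) a) [0..<p]"
        have xs: "distinct ?xs" "set ?xs = K" using inj Kp by (auto simp: distinct_map)
        have "f h = cyclic_next ?xs h" if "h \<in> K" for h
        proof -
          obtain i where i: "i < p" "h = (f ^^ i) a" using \<open>h \<in> K\<close> Kp by auto
          have "cyclic_next ?xs (?xs ! i) = ?xs ! (Suc i mod p)"
            using cyclic_next_nth[OF xs(1), of i] i by simp
          also have "\<dots> = (f ^^ (Suc i mod p)) a" using p(2) by simp
          also have "\<dots> = (f ^^ Suc i) a"
          proof (cases "Suc i = p")
            case True
            then show ?thesis using p(1) by (metis mod_self funpow_0)
          next
            case False
            then show ?thesis using i by simp
          qed
          finally show ?thesis using i by simp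
        qed
        then have "?xs \<in> ?F" using xs by (simp add: permutations_of_set_def)
        moreover have "?xs ! 0 = a" using p(2) by simp
        ultimately show "a \<in> (\<lambda>xs. xs ! 0) ` ?F" by (metis (no_types, lifting) image_eqI)
      qed
    qed
  qed
  then have "card ?F = ?n" by (rule bij_betw_same_card)
  then show ?thesis using n by simp
qed

section \<open>Linear orders refining an embedding\<close>

context ribbon_graph
begin

definition embedding_of :: "('v \<Rightarrow> 'h list) \<Rightarrow> 'h \<Rightarrow> 'h" where
  "embedding_of L h = (if h \<in> arcs G then cyclic_next (L (tail G h)) h else h)"

lemma embedding_of_embeddings:
  assumes L: "L \<in> vertex_orders"
  shows "embedding_of L \<in> embeddings G"
proof -
  let ?f = "embedding_of L"
  have cyc: "cyclic_on ?f (out_arcs G v)" if v: "v \<in> verts G" "out_arcs G v \<noteq> {}" for v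
    by (rule cyclic_next_orbit[OF vertex_order[OF L v(1)] v(2)]) (auto simp: embedding_of_def)
  have arc: "h \<in> out_arcs G (tail G h)" if "h \<in> arcs G" for h using that by simp
  have "?f ` arcs G = arcs G"
  proof
    show "?f ` arcs G \<subseteq> arcs G"
    proof (rule image_subsetI)
      fix h assume h: "h \<in> arcs G"
      then have "cyclic_on ?f (out_arcs G (tail G h))" using cyc tail_in arc by blast
      from cyclic_on_inI[OF this arc[OF h]] show "?f h \<in> arcs G" by simp
    qed
    show "arcs G \<subseteq> ?f ` arcs G"
    proof
      fix h assume h: "h \<in> arcs G"
      have c: "cyclic_on ?f (out_arcs G (tail G h))" using cyc[OF tail_in[OF h]] arc[OF h] by blast
      have "h \<in> orbit ?f h" using orbit_cyclic_eq3[OF c arc[OF h]] arc[OF h] by simp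
      then obtain k where k: "0 < k" "h = (?f ^^ k) h" unfolding orbit_altdef by blast
      then obtain j where j: "k = Suc j" by (cases k) auto
      have "(?f ^^ j) h \<in> out_arcs G (tail G h)" by (rule cyclic_on_funpow_in[OF c arc[OF h]])
      then have "(?f ^^ j) h \<in> arcs G" by simp
      moreover have "h = ?f ((?f ^^ j) h)" using k(2) unfolding j by simp
      ultimately show "h \<in> ?f ` arcs G" by (rule rev_image_eqI)
    qed
  qed
  then have "bij_betw ?f (arcs G) (arcs G)"
    using finite_surj_inj[OF finite_arcs, of ?f] by (simp add: bij_betw_def)
  then have "?f permutes arcs G" by (rule bij_imp_permutes) (simp add: embedding_of_def)
  then show ?thesis using cyc by (simp add: embeddings_def)
qed

lemma refines_embedding_of: "L \<in> vertex_orders \<Longrightarrow> refines L (embedding_of L)"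
  by (simp add: refines_def embedding_of_embeddings) (simp add: embedding_of_def)

lemma finite_vertex_orders: "finite vertex_orders"
  unfolding vertex_orders_def by (intro finite_PiE) auto

text \<open>The count is the same for every embedding, so uniformly random linear orders induce a
  uniformly random embedding.\<close>

lemma card_refinements:
  assumes \<rho>: "\<rho> \<in> embeddings G"
  shows "card {L\<in>vertex_orders. embedding_of L = \<rho>} = (\<Prod>v\<in>verts G. max 1 (card (out_arcs G v)))"
proof -
  let ?F = "\<lambda>v. {xs\<in>permutations_of_set (out_arcs G v). \<forall>h\<in>out_arcs G v. \<rho> h = cyclic_next xs h}"
  have "{L\<in>vertex_orders. embedding_of L = \<rho>} = PiE (verts G) ?F"
  proof (intro Set.set_eqI iffI)
    fix L assume "L \<in> {L\<in>vertex_orders. embedding_of L = \<rho>}"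
    then have L: "L \<in> PiE (verts G) (\<lambda>v. permutations_of_set (out_arcs G v))" "\<rho> = embedding_of L"
      by (simp_all add: vertex_orders_def)
    show "L \<in> PiE (verts G) ?F"
    proof (rule PiE_I)
      fix v assume "v \<in> verts G"
      then show "L v \<in> ?F v" using PiE_mem[OF L(1)] by (simp add: L(2) embedding_of_def)
    qed (rule PiE_arb[OF L(1)])
  next
    fix L assume L: "L \<in> PiE (verts G) ?F"
    have "L \<in> vertex_orders"
      unfolding vertex_orders_def by (rule set_mp[OF PiE_mono L]) simp
    moreover have "embedding_of L h = \<rho> h" for h
    proof (cases "h \<in> arcs G")
      case True
      then show ?thesis using PiE_mem[OF L tail_in[OF True]] by (simp add: embedding_of_def)
    next
      case False
      then show ?thesis using permutes_not_in[OF embedding_permutes[OF \<rho>]] by (simp add: embedding_of_def)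
    qed
    ultimately show "L \<in> {L\<in>vertex_orders. embedding_of L = \<rho>}" by blast
  qed
  then have "card {L\<in>vertex_orders. embedding_of L = \<rho>} = (\<Prod>v\<in>verts G. card (?F v))"
    by (simp only: card_PiE[OF finite_verts])
  also have "\<dots> = (\<Prod>v\<in>verts G. max 1 (card (out_arcs G v)))"
  proof (rule prod.cong)
    fix v assume "v \<in> verts G"
    then show "card (?F v) = max 1 (card (out_arcs G v))"
      using \<rho> by (intro card_cyclic_orders) (auto simp: embeddings_def)
  qed simp
  finally show ?thesis .
qed

lemma sum_vertex_orders:
  fixes F :: "('h \<Rightarrow> 'h) \<Rightarrow> real"
  shows "(\<Sum>L\<in>vertex_orders. F (embedding_of L)) =
    real (\<Prod>v\<in>verts G. max 1 (card (out_arcs G v))) * (\<Sum>\<rho>\<in>embeddings G. F \<rho>)"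
proof -
  have fin: "finite (embeddings G)"
    by (rule finite_subset[OF _ finite_permutations[OF finite_arcs]]) (auto simp: embeddings_def)
  have "(\<Sum>L\<in>vertex_orders. F (embedding_of L)) =
      (\<Sum>\<rho>\<in>embeddings G. \<Sum>L\<in>{L\<in>vertex_orders. embedding_of L = \<rho>}. F (embedding_of L))"
    by (intro sum.group[symmetric] finite_vertex_orders fin image_subsetI embedding_of_embeddings)
  also have "\<dots> = (\<Sum>\<rho>\<in>embeddings G. real (\<Prod>v\<in>verts G. max 1 (card (out_arcs G v))) * F \<rho>)"
  proof (rule sum.cong)
    fix \<rho> assume "\<rho> \<in> embeddings G"
    have "(\<Sum>L\<in>{L\<in>vertex_orders. embedding_of L = \<rho>}. F (embedding_of L)) =
        real (card {L\<in>vertex_orders. embedding_of L = \<rho>}) * F \<rho>" by simp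
    then show "(\<Sum>L\<in>{L\<in>vertex_orders. embedding_of L = \<rho>}. F (embedding_of L)) =
        real (\<Prod>v\<in>verts G. max 1 (card (out_arcs G v))) * F \<rho>"
      unfolding card_refinements[OF \<open>\<rho> \<in> embeddings G\<close>] .
  qed simp
  finally show ?thesis by (simp only: sum_distrib_left)
qed

definition set_weight :: "'h set \<Rightarrow> real" where
  "set_weight S = (\<Prod>v\<in>verts G. vertex_weight (card (S \<inter> out_arcs G v)))"

end

section \<open>The expected determinant\<close>

context cycle_basis
begin

lemma sum_det_intersection:
  "(\<Sum>L\<in>vertex_orders. dt m (\<lambda>i j. intersection L (z i) (z j))) =
    real (card vertex_orders) * (\<Sum>S\<in>{S. S \<subseteq> arcs G \<and> card S = m}. set_weight S * of_bool (determines S))"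
proof -
  let ?\<Phi> = "PiE {..<m} (\<lambda>_. arcs G)"
  let ?b = "\<lambda>h l. z l h"
  have expand: "dt m (\<lambda>i j. intersection L (z i) (z j)) =
      (\<Sum>\<phi>\<in>?\<Phi>. (\<Prod>i<m. z i (\<phi> i)) * dt m (\<lambda>i l. flow L (z l) (\<phi> i)))" for L
  proof -
    have "dt m (\<lambda>i j. intersection L (z i) (z j)) =
        dt m (\<lambda>i j. if i \<in> {..<m} then \<Sum>h\<in>arcs G. z i h * flow L (z j) h else 0)"
      by (intro dt_cong) (simp add: intersection_def)
    also have "\<dots> = (\<Sum>\<phi>\<in>?\<Phi>. (\<Prod>i<m. z i (\<phi> i)) *
        dt m (\<lambda>i. if i \<in> {..<m} then (\<lambda>l. flow L (z l) (\<phi> i)) else (\<lambda>_. 0)))"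
      using dt_sum_rows[of "{..<m}" m "\<lambda>_. arcs G" z "\<lambda>_ h l. flow L (z l) h" "\<lambda>_ _. 0"] by simp
    also have "\<dots> = (\<Sum>\<phi>\<in>?\<Phi>. (\<Prod>i<m. z i (\<phi> i)) * dt m (\<lambda>i l. flow L (z l) (\<phi> i)))"
      by (intro sum.cong refl arg_cong2[where f = "(*)"] dt_cong) simp
    finally show ?thesis .
  qed
  have card_orders: "real (card vertex_orders) = (\<Prod>v\<in>verts G. real (card (permutations_of_set (out_arcs G v))))"
    unfolding vertex_orders_def by (simp add: card_PiE)
  have average: "(\<Sum>L\<in>vertex_orders. dt m (\<lambda>i l. flow L (z l) (\<phi> i))) =
      real (card vertex_orders) * (set_weight (\<phi> ` {..<m}) * dt m (\<lambda>i. ?b (\<phi> i)))" if \<phi>: "\<phi> \<in> ?\<Phi>" for \<phi>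
  proof -
    have \<phi>G: "\<phi> i \<in> arcs G" if "i < m" for i using PiE_mem[OF \<phi>, of i] that by simp
    have tV: "tail G (\<phi> i) \<in> verts G" if "i < m" for i by (rule tail_in[OF \<phi>G[OF that]])
    let ?c = "\<lambda>v. card {i\<in>{..<m}. tail G (\<phi> i) = v}"
    have "(\<Sum>L\<in>vertex_orders. dt m (\<lambda>i l. flow L (z l) (\<phi> i))) =
      (\<Sum>L\<in>vertex_orders. dt m (\<lambda>i l. if tail G (\<phi> i) \<in> verts G
        then \<Sum>h\<in>out_arcs G (tail G (\<phi> i)). order_form (L (tail G (\<phi> i))) h (\<phi> i) * z l h else 0))"
      using tV by (intro sum.cong refl dt_cong) (simp add: flow_def)
    also have "\<dots> = (\<Prod>v\<in>verts G. real (card (permutations_of_set (out_arcs G v))) * vertex_weight (?c v)) *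
        dt m (\<lambda>i. if tail G (\<phi> i) \<in> verts G then ?b (\<phi> i) else (\<lambda>_. 0))"
      unfolding vertex_orders_def
    proof (rule average_vertices[where b = ?b and u = "\<lambda>_ _. 0"])
      show "(\<Sum>h\<in>out_arcs G v. z l h) = 0" if "v \<in> verts G" "l < m" for v l
        by (rule cycle_vertex[OF basis_cycle[OF that(2)] that(1)])
      show "\<phi> i \<in> out_arcs G (tail G (\<phi> i))" if "i < m" for i using \<phi>G[OF that] by simp
      show "finite (out_arcs G v)" for v by (rule finite_out_arcs)
    qed simp
    also have "dt m (\<lambda>i. if tail G (\<phi> i) \<in> verts G then ?b (\<phi> i) else (\<lambda>_. 0)) = dt m (\<lambda>i. ?b (\<phi> i))"
      using tV by (intro dt_cong) simp
    finally have eq: "(\<Sum>L\<in>vertex_orders. dt m (\<lambda>i l. flow L (z l) (\<phi> i))) =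
        real (card vertex_orders) * (\<Prod>v\<in>verts G. vertex_weight (?c v)) * dt m (\<lambda>i. ?b (\<phi> i))"
      by (simp add: prod.distrib card_orders)
    \<comment> \<open>\<open>?c v\<close> counts rows, whereas \<open>set_weight\<close> counts
      half-edges. The two agree if \<open>\<phi>\<close> is injective; otherwise the minor has a
      repeated row and vanishes.\<close>
    show ?thesis
    proof (cases "inj_on \<phi> {..<m}")
      case True
      have "?c v = card (\<phi> ` {..<m} \<inter> out_arcs G v)" for v
      proof -
        have "\<phi> ` {..<m} \<inter> out_arcs G v = \<phi> ` {i\<in>{..<m}. tail G (\<phi> i) = v}" using \<phi>G by auto
        moreover have "inj_on \<phi> {i\<in>{..<m}. tail G (\<phi> i) = v}" by (rule inj_on_subset[OF True]) blast
        ultimately show ?thesis by (simp add: card_image)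
      qed
      then show ?thesis unfolding eq set_weight_def by simp
    next
      case False
      then obtain r r' where "r < m" "r' < m" "r \<noteq> r'" "\<phi> r = \<phi> r'" by (auto simp: inj_on_def)
      then have "dt m (\<lambda>i. ?b (\<phi> i)) = 0" by (intro dt_identical_rows[of r m r']) simp_all
      then show ?thesis unfolding eq by simp
    qed
  qed
  define t where "t S = (SOME t. bij_betw t {..<m} S)" for S :: "'h set"
  have t: "bij_betw (t S) {..<m} S" if S: "S \<subseteq> arcs G" "card S = m" for S
  proof -
    have "finite S" using S(1) finite_arcs by (rule finite_subset)
    then have "\<exists>t. bij_betw t {..<m} S"
      using ex_bij_betw_nat_finite[of S] S(2) by (simp add: lessThan_atLeast0)
    then show ?thesis unfolding t_def by (rule someI_ex)
  qed
  have "(\<Sum>L\<in>vertex_orders. dt m (\<lambda>i j. intersection L (z i) (z j))) =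
      (\<Sum>\<phi>\<in>?\<Phi>. (\<Prod>i<m. z i (\<phi> i)) * (\<Sum>L\<in>vertex_orders. dt m (\<lambda>i l. flow L (z l) (\<phi> i))))"
    unfolding expand sum_distrib_left by (rule sum.swap)
  also have "\<dots> = (\<Sum>\<phi>\<in>?\<Phi>. real (card vertex_orders) *
      ((\<Prod>i<m. ?b (\<phi> i) i) * set_weight (\<phi> ` {..<m}) * dt m (\<lambda>i. ?b (\<phi> i))))"
    by (intro sum.cong refl) (simp add: average)
  also have "\<dots> = real (card vertex_orders) *
      (\<Sum>\<phi>\<in>?\<Phi>. (\<Prod>i<m. ?b (\<phi> i) i) * set_weight (\<phi> ` {..<m}) * dt m (\<lambda>i. ?b (\<phi> i)))"
    by (rule sum_distrib_left[symmetric])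
  also have "(\<Sum>\<phi>\<in>?\<Phi>. (\<Prod>i<m. ?b (\<phi> i) i) * set_weight (\<phi> ` {..<m}) * dt m (\<lambda>i. ?b (\<phi> i))) =
      (\<Sum>S\<in>{S. S \<subseteq> arcs G \<and> card S = m}. set_weight S * (dt m (\<lambda>i. ?b (t S i)))\<^sup>2)"
    by (rule sum_choices_eq_sum_minors[OF finite_arcs t])
  also have "\<dots> = (\<Sum>S\<in>{S. S \<subseteq> arcs G \<and> card S = m}. set_weight S * of_bool (determines S))"
    by (intro sum.cong refl) (simp add: square_minor t)
  finally show ?thesis .
qed

lemma sum_one_faced:
  "real (card {\<rho>\<in>embeddings G. one_faced G \<iota> \<rho>}) / real (card (embeddings G)) =
    (\<Sum>S\<in>{S. S \<subseteq> arcs G \<and> card S = m}. set_weight S * of_bool (determines S))"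
    (is "_ = ?W")
proof -
  let ?N = "real (\<Prod>v\<in>verts G. max 1 (card (out_arcs G v)))"
  have fin: "finite (embeddings G)"
    by (rule finite_subset[OF _ finite_permutations[OF finite_arcs]]) (auto simp: embeddings_def)
  have N: "?N > 0" by (auto simp: prod_pos)
  have total: "real (card vertex_orders) = ?N * real (card (embeddings G))"
    using sum_vertex_orders[of "\<lambda>_. 1"] by simp
  have "vertex_orders \<noteq> {}"
    unfolding vertex_orders_def using finite_out_arcs by (auto simp: PiE_eq_empty_iff permutations_of_set_empty_iff)
  then have pos: "real (card vertex_orders) > 0" using finite_vertex_orders by (simp add: card_gt_0_iff)
  have "real (card vertex_orders) * ?W = (\<Sum>L\<in>vertex_orders. of_bool (one_faced G \<iota> (embedding_of L)))"
    unfolding sum_det_intersection[symmetric]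
    by (intro sum.cong refl det_intersection refines_embedding_of)
  also have "\<dots> = ?N * (\<Sum>\<rho>\<in>embeddings G. of_bool (one_faced G \<iota> \<rho>))"
    by (rule sum_vertex_orders)
  also have "(\<Sum>\<rho>\<in>embeddings G. of_bool (one_faced G \<iota> \<rho>)) = real (card {\<rho>\<in>embeddings G. one_faced G \<iota> \<rho>})"
    using fin by (simp add: Int_def)
  finally have "?N * real (card (embeddings G)) * ?W = ?N * real (card {\<rho>\<in>embeddings G. one_faced G \<iota> \<rho>})"
    unfolding total .
  then have "real (card (embeddings G)) * ?W = real (card {\<rho>\<in>embeddings G. one_faced G \<iota> \<rho>})"
    using N by (simp only: mult.assoc mult_left_cancel)
  moreover have "real (card (embeddings G)) > 0" using pos N unfolding total by (simp add: zero_less_mult_iff)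
  ultimately show ?thesis by (simp add: field_simps)
qed

end

section \<open>Decorations as sets of half-edges\<close>

context ribbon_graph
begin

text \<open>The chosen sets are nonempty and disjoint at different vertices, so a decoration is
  recovered from their union. Sets with an odd number of half-edges at some vertex have weight 0 and
  drop out.\<close>

lemma sum_decorations:
  assumes betti: "first_betti G \<iota> = 2 * g"
  shows "(\<Sum>S\<in>{S. S \<subseteq> arcs G \<and> card S = 2 * g}. set_weight S * of_bool (determines S)) =
    (\<Sum>D\<in>decorations G \<iota> g. weight g D)"
proof -
  let ?E = "{S. S \<subseteq> arcs G \<and> card S = 2 * g \<and> determines S \<and> (\<forall>v\<in>verts G. even (card (S \<inter> out_arcs G v)))}"
  define dec :: "'h set \<Rightarrow> 'v \<rightharpoonup> 'h set" where
    "dec S = (\<lambda>v. if v \<in> verts G \<and> S \<inter> out_arcs G v \<noteq> {} then Some (S \<inter> out_arcs G v) else None)" for S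
  have fin: "finite S" if "S \<subseteq> arcs G" for S using that finite_arcs by (rule finite_subset)
  have "(\<Sum>S\<in>{S. S \<subseteq> arcs G \<and> card S = 2 * g}. set_weight S * of_bool (determines S)) =
      (\<Sum>S\<in>?E. set_weight S)"
  proof (rule sum.mono_neutral_cong_right)
    show "finite {S. S \<subseteq> arcs G \<and> card S = 2 * g}" using finite_arcs by simp
    show "\<forall>S\<in>{S. S \<subseteq> arcs G \<and> card S = 2 * g} - ?E. set_weight S * of_bool (determines S) = 0"
    proof
      fix S assume "S \<in> {S. S \<subseteq> arcs G \<and> card S = 2 * g} - ?E"
      then consider "\<not> determines S" | v where "v \<in> verts G" "odd (card (S \<inter> out_arcs G v))" by blast
      then show "set_weight S * of_bool (determines S) = 0"
      proof cases
        case (2 v)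
        then have "set_weight S = 0"
          unfolding set_weight_def by (intro prod_zero[OF finite_verts] bexI[of _ v]) (simp_all add: vertex_weight_def)
        then show ?thesis by simp
      qed simp
    qed
  qed auto
  also have "\<dots> = (\<Sum>D\<in>decorations G \<iota> g. weight g D)"
  proof (rule sum.reindex_bij_witness[where i = "\<lambda>D. \<Union>(ran D)" and j = dec])
    fix S assume S: "S \<in> ?E"
    then have SG: "S \<subseteq> arcs G" "card S = 2 * g" "determines S" by blast+
    have dom: "dom (dec S) = {v\<in>verts G. S \<inter> out_arcs G v \<noteq> {}}"
      unfolding dom_def dec_def by (intro Collect_cong) simp
    have the: "the (dec S v) = S \<inter> out_arcs G v" if "v \<in> dom (dec S)" for v
      using that by (auto simp: dec_def split: if_splits)
    show union: "\<Union>(ran (dec S)) = S"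
    proof
      show "\<Union>(ran (dec S)) \<subseteq> S" by (auto simp: ran_def dec_def split: if_splits)
      show "S \<subseteq> \<Union>(ran (dec S))"
      proof
        fix h assume h: "h \<in> S"
        then have hv: "h \<in> S \<inter> out_arcs G (tail G h)" "tail G h \<in> verts G" using SG(1) by auto
        then have "dec S (tail G h) = Some (S \<inter> out_arcs G (tail G h))" unfolding dec_def by (metis emptyE)
        then have "S \<inter> out_arcs G (tail G h) \<in> ran (dec S)" by (rule ranI)
        then show "h \<in> \<Union>(ran (dec S))" using hv(1) by blast
      qed
    qed
    have "card S = (\<Sum>h\<in>arcs G. of_bool (h \<in> S))"
      using SG(1) finite_arcs by (simp add: Int_absorb1 Int_def[symmetric] flip: Int_def)
    also have "\<dots> = (\<Sum>v\<in>verts G. \<Sum>h\<in>{h\<in>arcs G. tail G h = v}. of_bool (h \<in> S))"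
      by (intro sum.group[symmetric]) auto
    also have "\<dots> = (\<Sum>v\<in>verts G. card (S \<inter> out_arcs G v))"
    proof (rule sum.cong)
      fix v
      have "{h\<in>arcs G. tail G h = v} = out_arcs G v" by (auto simp: out_arcs_def)
      then show "(\<Sum>h\<in>{h\<in>arcs G. tail G h = v}. of_bool (h \<in> S)) = card (S \<inter> out_arcs G v)"
        by (simp add: sum_of_bool_eq finite_out_arcs Int_def conj_commute)
    qed simp
    also have "\<dots> = (\<Sum>v\<in>dom (dec S). card (S \<inter> out_arcs G v))"
      unfolding dom by (intro sum.mono_neutral_right) auto
    finally have sum: "(\<Sum>v\<in>dom (dec S). card (S \<inter> out_arcs G v)) = 2 * g" using SG(2) by simp
    have even: "even (card (S \<inter> out_arcs G v))" if "v \<in> verts G" for v using S that by blast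
    have pos: "card (S \<inter> out_arcs G v) > 0" if "v \<in> dom (dec S)" for v
      using that fin[OF SG(1)] unfolding dom by (simp add: card_gt_0_iff)
    show "dec S \<in> decorations G \<iota> g"
      unfolding decorations_def mem_Collect_eq union
    proof (intro conjI ballI)
      show "dom (dec S) \<subseteq> verts G" unfolding dom by blast
      show "contractible_space (remaining_space G \<iota> S)"
        using contractible_iff_determines[OF SG(1)] SG(2,3) betti by simp
      show "(\<Sum>v\<in>dom (dec S). card (the (dec S v))) = 2 * g"
        using sum by (simp add: the)
      fix v assume v: "v \<in> dom (dec S)"
      show "the (dec S v) \<subseteq> out_arcs G v" "0 < card (the (dec S v))" "even (card (the (dec S v)))"
        using v even pos unfolding the[OF v] dom by blast+
    qed
    \<comment> \<open>Vertices without chosen half-edges are not in the domain; they contribute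
      \<open>vertex_weight 0\<close>, which is 1.\<close>
    have "set_weight S = (\<Prod>v\<in>dom (dec S). vertex_weight (card (S \<inter> out_arcs G v)))"
      unfolding set_weight_def dom by (intro prod.mono_neutral_right) (auto simp: vertex_weight_def)
    also have "\<dots> = (\<Prod>v\<in>dom (dec S). 1 / 2 ^ card (S \<inter> out_arcs G v) * (1 / (real (card (the (dec S v))) + 1)))"
    proof (rule prod.cong)
      fix v assume v: "v \<in> dom (dec S)"
      then have "even (card (S \<inter> out_arcs G v))" using even dom by blast
      then show "vertex_weight (card (S \<inter> out_arcs G v)) =
          1 / 2 ^ card (S \<inter> out_arcs G v) * (1 / (real (card (the (dec S v))) + 1))"
        unfolding the[OF v] by (simp add: vertex_weight_def)
    qed simp
    \<comment> \<open>The local powers of 2 combine to a single one because the numbers of chosen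
      half-edges add up to \<open>2 * g\<close>.\<close>
    also have "\<dots> = (1 / 2 ^ (2 * g)) * (\<Prod>v\<in>dom (dec S). 1 / (real (card (the (dec S v))) + 1))"
      unfolding prod.distrib sum[symmetric] by (simp add: power_sum prod_dividef)
    finally show "weight g (dec S) = set_weight S" by (simp add: weight_def)
  next
    fix D assume "D \<in> decorations G \<iota> g"
    then have D: "dom D \<subseteq> verts G" "\<And>v. v \<in> dom D \<Longrightarrow> the (D v) \<subseteq> out_arcs G v"
      "\<And>v. v \<in> dom D \<Longrightarrow> card (the (D v)) > 0" "\<And>v. v \<in> dom D \<Longrightarrow> even (card (the (D v)))"
      "(\<Sum>v\<in>dom D. card (the (D v))) = 2 * g" "contractible_space (remaining_space G \<iota> (\<Union>(ran D)))"
      unfolding decorations_def by blast+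
    let ?S = "\<Union>(ran D)"
    have ran: "?S = (\<Union>v\<in>dom D. the (D v))" by (force simp: ran_def dom_def)
    have SG: "?S \<subseteq> arcs G" unfolding ran using D(2) by fastforce
    have inter: "?S \<inter> out_arcs G v = (if v \<in> dom D then the (D v) else {})" for v
    proof -
      have "h \<in> ?S \<inter> out_arcs G v \<longleftrightarrow> v \<in> dom D \<and> h \<in> the (D v)" for h
      proof
        assume h: "h \<in> ?S \<inter> out_arcs G v"
        then obtain u where u: "u \<in> dom D" "h \<in> the (D u)" unfolding ran by blast
        then have "h \<in> out_arcs G u" using D(2) by blast
        then have "u = v" using h by simp
        then show "v \<in> dom D \<and> h \<in> the (D v)" using u by blast
      next
        assume h: "v \<in> dom D \<and> h \<in> the (D v)"
        then have "h \<in> out_arcs G v" using D(2) by blast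
        then show "h \<in> ?S \<inter> out_arcs G v" unfolding ran using h by blast
      qed
      then show ?thesis by (cases "v \<in> dom D") (simp_all add: set_eq_iff)
    qed
    have "card ?S = (\<Sum>v\<in>dom D. card (the (D v)))"
      unfolding ran
    proof (rule card_UN_disjoint)
      show "finite (dom D)" using D(1) finite_verts by (rule finite_subset)
      show "\<forall>v\<in>dom D. finite (the (D v))" using D(3) card_gt_0_iff by blast
      show "\<forall>u\<in>dom D. \<forall>v\<in>dom D. u \<noteq> v \<longrightarrow> the (D u) \<inter> the (D v) = {}"
      proof (intro ballI impI)
        fix u v assume uv: "u \<in> dom D" "v \<in> dom D" "u \<noteq> v"
        then have "out_arcs G u \<inter> out_arcs G v = {}" by (auto simp: out_arcs_def)
        then show "the (D u) \<inter> the (D v) = {}" using D(2)[OF uv(1)] D(2)[OF uv(2)] by blast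
      qed
    qed
    then have card: "card ?S = 2 * g" using D(5) by simp
    have "determines ?S" using contractible_iff_determines[OF SG] card betti D(6) by simp
    moreover have "even (card (?S \<inter> out_arcs G v))" for v unfolding inter using D(4) by simp
    ultimately show "?S \<in> ?E" using SG card by blast
    show "dec ?S = D"
    proof
      fix v
      show "dec ?S v = D v"
      proof (cases "v \<in> dom D")
        case True
        then obtain X where X: "D v = Some X" by blast
        have "v \<in> verts G" "X \<noteq> {}" using True D(1) D(3)[OF True] X by auto
        then show ?thesis using True X by (simp add: dec_def inter)
      next
        case False
        then show ?thesis by (simp add: dec_def inter domIff)
      qed
    qed
  qed
  finally show ?thesis .
qed

end

theorem theorem2:
  fixes G :: "('v, 'h) pre_digraph" and \<iota> :: "'h \<Rightarrow> 'h" and g :: nat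
  assumes "fin_digraph G"
    and "bidirected_digraph G \<iota>"
    and "Digraph_Component.connected G"
    and "first_betti G \<iota> = 2 * g"
  shows "real (card {\<rho> \<in> embeddings G. one_faced G \<iota> \<rho>}) / real (card (embeddings G))
    = (\<Sum>D\<in>decorations G \<iota> g. weight g D)"
proof -
  interpret ribbon_graph G \<iota>
    by (intro ribbon_graph.intro ribbon_graph_axioms.intro assms)
  obtain z e where "cycle_basis G \<iota> (2 * g) z e"
    using ex_cycle_basis assms(4) by metis
  then interpret cycle_basis G \<iota> "2 * g" z e .
  show ?thesis
    unfolding sum_one_faced by (rule sum_decorations[OF assms(4)])
qed

end
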